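(* Let $\mathbb F$ be a field of characteristic $p>n$ or $p=0$ and let $0\le k\le n$. Then: (i) For $0\le j\le k$ and $0\le i\le\min\{k-j,n-k\}$, $E_{k,j,i}$ is an irreducible $\mathbb F B_n$-module. (ii) $M^n_k$ is a multiplicity-free $\mathbb F B_n$-module. The restrictions $\epsilon_k$ and $\partial_k$, $0\le k\le n$, generate $\mathrm{Hom}_{B_n}(M^n)$ as a ring.
   Context: Let $V=\{\alpha_1,\bar\alpha_1,\dots,\alpha_n,\bar\alpha_n\}$ be a set of $2n$ distinct elements, with $\bar{\bar\alpha}_i=\alpha_i$. For $0\le k\le n$, $L^n_k$ is the set of $k$-element subsets $x\subseteq V$ with $|x\cap\{\alpha_i,\bar\alpha_i\}|\le1$ for all $i$; $M^n_k$ is the $\mathbb F$-vector space with basis $L^n_k$ ($M^n_k=0$ if $k<0$ or $k>n$), $M^n=\bigoplus_kM^n_k$. Elements are written as polynomials in the vertices: a product of distinct vertices forming such a set denotes that set, extended bilinearly. Linear maps on $x\in L^n_k$: $\epsilon_k(x)=\sum_{y\in L^n_{k+1},\,y\supset x}y$, $\partial_k(x)=\sum_{z\in L^n_{k-1},\,z\subset x}z$, $\nu^+_k=\partial_{k+1}\epsilon_k$. Let $\dot V=\{\alpha_1,\dots,\alpha_n\}$; for disjoint $a,b\subseteq\dot V$, $[a,b]=\prod_{\alpha\in a}(\alpha+\bar\alpha)\prod_{\beta\in b}(\beta-\bar\beta)$, $[\emptyset,\emptyset]=\emptyset$. $E_{k,j}$ is the span of all $[a,b]$ with $a,b$ disjoint,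 $|a|=k-j$, $|b|=j$; it is $\nu^+_k$-invariant, and $E_{k,j,i}$ is the eigenspace of $\nu^+_k|_{E_{k,j}}$ for the eigenvalue $2(k-j+1-i)(n-k-i)$. The hyperoctahedral group $B_n$ is the group of all permutations $g$ of $V$ with $\bar\beta^g=\overline{\beta^g}$ for all $\beta\in V$, acting on faces by $x^g=\{\beta^g:\beta\in x\}$ and hence on $M^n$; the spaces $E_{k,j,i}$ are $B_n$-invariant. $\mathrm{Hom}_{B_n}(M^n)$ is the ring of linear maps $M^n\to M^n$ commuting with $B_n$.
   Formalization: The case n=k=1, p=2 is excluded from multiplicity-freeness (false there), and the ring Hom_{B_n}(M^n) is generated by ε_k, ∂_k together with all scalar multiples of the identities of the M^n_k, since ε_k and ∂_k alone do not generate it (e.g. n=0 over the rationals, or n=2). *)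

theory Defs
  imports
    "HOL-Library.Poly_Mapping"
    "HOL-Library.Multiset"
    "HOL-Library.FuncSet"
    "HOL-Combinatorics.Permutations"
    "HOL-Computational_Algebra.Computational_Algebra"
    "HOL-Algebra.Generated_Rings"
begin

section \<open>Vertices, faces and the hyperoctahedral group\<close>

text \<open>The vertex \<open>\<alpha>\<^sub>i\<close> is the pair \<open>(i, True)\<close> and its opposite is \<open>(i, False)\<close>, \<open>1 \<le> i \<le> n\<close>.\<close>

type_synonym vertex = "nat \<times> bool"

definition bar :: "vertex \<Rightarrow> vertex" where
  "bar v = (fst v, \<not> snd v)"

definition V :: "nat \<Rightarrow> vertex set" where
  "V n = {1..n} \<times> UNIV"

definition Vdot :: "nat \<Rightarrow> vertex set" where
  "Vdot n = {1..n} \<times> {True}"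

definition L :: "nat \<Rightarrow> nat \<Rightarrow> vertex set set" where
  "L n k = {x. x \<subseteq> V n \<and> card x = k \<and> (\<forall>v\<in>Vdot n. card (x \<inter> {v, bar v}) \<le> 1)}"

definition faces :: "nat \<Rightarrow> vertex set set" where
  "faces n = (\<Union>k\<le>n. L n k)"

definition B :: "nat \<Rightarrow> (vertex \<Rightarrow> vertex) set" where
  "B n = {g. g permutes V n \<and> (\<forall>v\<in>V n. g (bar v) = bar (g v))}"

section \<open>The modules of faces\<close>

text \<open>Elements are polynomials in the vertices: a monomial is a multiset of vertices, and a face
  is the squarefree monomial of its vertices.\<close>

type_synonym 'f vpoly = "vertex multiset \<Rightarrow>\<^sub>0 'f"

definition scale :: "'f::field \<Rightarrow> 'f vpoly \<Rightarrow> 'f vpoly" where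
  "scale c p = Poly_Mapping.map ((*) c) p"

lemma lookup_scale [simp]: "Poly_Mapping.lookup (scale c p) m = c * Poly_Mapping.lookup p m"
  by (simp add: scale_def Poly_Mapping.map.rep_eq when_def)

global_interpretation vp: vector_space "scale :: 'f::field \<Rightarrow> 'f vpoly \<Rightarrow> 'f vpoly"
  by unfold_locales (auto intro!: poly_mapping_eqI simp: lookup_add algebra_simps)

definition vert :: "vertex \<Rightarrow> 'f::field vpoly" where
  "vert v = Poly_Mapping.single {#v#} 1"

definition face :: "vertex set \<Rightarrow> 'f::field vpoly" where
  "face x = (\<Prod>v\<in>x. vert v)"

definition coeff_face :: "'f::field vpoly \<Rightarrow> vertex set \<Rightarrow> 'f" where
  "coeff_face p x = Poly_Mapping.lookup p (mset_set x)"

lemma face_eq_single: "finite x \<Longrightarrow> face x = (Poly_Mapping.single (mset_set x) 1 :: 'f::field vpoly)"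
  by (induction rule: finite_induct) (simp_all add: face_def vert_def mult_single)

lemma coeff_face_face:
  "finite x \<Longrightarrow> finite y \<Longrightarrow> coeff_face (face y :: 'f::field vpoly) x = (if x = y then 1 else 0)"
  by (auto simp: coeff_face_def face_eq_single lookup_single when_def dest: arg_cong[where f = set_mset])

definition Mk :: "nat \<Rightarrow> nat \<Rightarrow> 'f::field vpoly set" where
  "Mk n k = vp.span (face ` L n k)"

definition M :: "nat \<Rightarrow> 'f::field vpoly set" where
  "M n = vp.span (face ` faces n)"

text \<open>\<open>extend A \<phi>\<close> is the linear map sending the face \<open>x\<close> to \<open>\<phi> x\<close> if \<open>x \<in> A\<close>, and every other
  monomial to 0. In particular \<open>eps n k\<close>, \<open>del n k\<close> and \<open>proj n k\<close> below vanish on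
  \<open>Mk n l\<close> for \<open>l \<noteq> k\<close>.\<close>

definition extend :: "vertex set set \<Rightarrow> (vertex set \<Rightarrow> 'f::field vpoly) \<Rightarrow> 'f vpoly \<Rightarrow> 'f vpoly" where
  "extend A \<phi> p = (\<Sum>x\<in>A. scale (coeff_face p x) (\<phi> x))"

definition eps :: "nat \<Rightarrow> nat \<Rightarrow> 'f::field vpoly \<Rightarrow> 'f vpoly" where
  "eps n k = extend (L n k) (\<lambda>x. \<Sum>y\<in>{y \<in> L n (k + 1). x \<subset> y}. face y)"

text \<open>For \<open>k = 0\<close> the truncated index \<open>k - 1\<close> is harmless: the sum over \<open>z \<subset> {}\<close> is empty.\<close>

definition del :: "nat \<Rightarrow> nat \<Rightarrow> 'f::field vpoly \<Rightarrow> 'f vpoly" where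
  "del n k = extend (L n k) (\<lambda>x. \<Sum>z\<in>{z \<in> L n (k - 1). z \<subset> x}. face z)"

definition nu_plus :: "nat \<Rightarrow> nat \<Rightarrow> 'f::field vpoly \<Rightarrow> 'f vpoly" where
  "nu_plus n k = del n (k + 1) \<circ> eps n k"

definition proj :: "nat \<Rightarrow> nat \<Rightarrow> 'f::field vpoly \<Rightarrow> 'f vpoly" where
  "proj n k = extend (L n k) face"

definition act :: "nat \<Rightarrow> (vertex \<Rightarrow> vertex) \<Rightarrow> 'f::field vpoly \<Rightarrow> 'f vpoly" where
  "act n g = extend (faces n) (\<lambda>x. face (g ` x))"

section \<open>The subspaces \<open>E\<^bsub>k,j\<^esub>\<close> and \<open>E\<^bsub>k,j,i\<^esub>\<close>\<close>

definition bracket :: "vertex set \<Rightarrow> vertex set \<Rightarrow> 'f::field vpoly" where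
  "bracket a b = (\<Prod>v\<in>a. vert v + vert (bar v)) * (\<Prod>v\<in>b. vert v - vert (bar v))"

definition E :: "nat \<Rightarrow> nat \<Rightarrow> nat \<Rightarrow> 'f::field vpoly set" where
  "E n k j = vp.span {bracket a b | a b.
     a \<subseteq> Vdot n \<and> b \<subseteq> Vdot n \<and> a \<inter> b = {} \<and> card a + j = k \<and> card b = j}"

definition Ei :: "nat \<Rightarrow> nat \<Rightarrow> nat \<Rightarrow> nat \<Rightarrow> 'f::field vpoly set" where
  "Ei n k j i = {v \<in> E n k j. nu_plus n k v =
     scale (of_int (2 * (int k - int j + 1 - int i) * (int n - int k - int i))) v}"

section \<open>\<open>B\<^sub>n\<close>-modules\<close>

definition submodule :: "nat \<Rightarrow> 'f::field vpoly set \<Rightarrow> bool" where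
  "submodule n U \<longleftrightarrow> vp.subspace U \<and> U \<subseteq> M n \<and> (\<forall>g\<in>B n. \<forall>u\<in>U. act n g u \<in> U)"

definition irreducible_module :: "nat \<Rightarrow> 'f::field vpoly set \<Rightarrow> bool" where
  "irreducible_module n U \<longleftrightarrow> submodule n U \<and> U \<noteq> {0} \<and>
     (\<forall>W. submodule n W \<and> W \<subseteq> U \<longrightarrow> W = {0} \<or> W = U)"

definition module_map :: "nat \<Rightarrow> 'f::field vpoly set \<Rightarrow> 'f vpoly set \<Rightarrow> ('f vpoly \<Rightarrow> 'f vpoly) \<Rightarrow> bool" where
  "module_map n U W T \<longleftrightarrow> T \<in> U \<rightarrow> W \<and>
     (\<forall>u\<in>U. \<forall>v\<in>U. T (u + v) = T u + T v) \<and>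
     (\<forall>c. \<forall>u\<in>U. T (scale c u) = scale c (T u)) \<and>
     (\<forall>g\<in>B n. \<forall>u\<in>U. T (act n g u) = act n g (T u))"

definition isomorphic_modules :: "nat \<Rightarrow> 'f::field vpoly set \<Rightarrow> 'f vpoly set \<Rightarrow> bool" where
  "isomorphic_modules n U W \<longleftrightarrow> (\<exists>T. module_map n U W T \<and> bij_betw T U W)"

definition internal_direct_sum :: "'f::field vpoly set \<Rightarrow> 'f vpoly set set \<Rightarrow> bool" where
  "internal_direct_sum U \<U> \<longleftrightarrow> finite \<U> \<and> (\<forall>W\<in>\<U>. W \<subseteq> U) \<and>
     (\<forall>u\<in>U. \<exists>!f. f \<in> (\<Pi>\<^sub>E W\<in>\<U>. W) \<and> u = (\<Sum>W\<in>\<U>. f W))"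

text \<open>Multiplicity-free: a direct sum of pairwise non-isomorphic irreducible modules.\<close>

definition multiplicity_free :: "nat \<Rightarrow> 'f::field vpoly set \<Rightarrow> bool" where
  "multiplicity_free n U \<longleftrightarrow> submodule n U \<and>
     (\<exists>\<U>. internal_direct_sum U \<U> \<and> (\<forall>W\<in>\<U>. irreducible_module n W) \<and>
        (\<forall>W\<in>\<U>. \<forall>W'\<in>\<U>. W \<noteq> W' \<longrightarrow> \<not> isomorphic_modules n W W'))"

section \<open>The ring of \<open>B\<^sub>n\<close>-endomorphisms of \<open>M\<^sup>n\<close>\<close>

text \<open>As usual for functions on a carrier, its elements are undefined outside of \<open>M n\<close>.\<close>

definition hom_ring :: "nat \<Rightarrow> ('f::field vpoly \<Rightarrow> 'f vpoly) ring" where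
  "hom_ring n = \<lparr>carrier = {T \<in> extensional (M n). module_map n (M n) (M n) T},
     monoid.mult = compose (M n), one = (\<lambda>v\<in>M n. v),
     zero = (\<lambda>v\<in>M n. 0), add = (\<lambda>S T. \<lambda>v\<in>M n. S v + T v)\<rparr>"

text \<open>The \<open>\<F>\<close>-algebra generated by the maps between the graded pieces \<open>M\<^sub>k\<close> is the ring generated
  by these maps and the scalar multiples of the identities of the pieces. Neither the scalars nor
  the identities can be dropped: integral polynomials in \<open>\<epsilon>\<^sub>k\<close> and \<open>\<partial>\<^sub>k\<close> yield no scalars outside of
  the prime ring, and for \<open>n \<ge> 2\<close> all \<open>\<epsilon>\<^sub>k\<close> and \<open>\<partial>\<^sub>k\<close> vanish on \<open>E\<^bsub>n,n,0\<^esub>\<close> as well as on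
  \<open>E\<^bsub>n-1,n-2,1\<^esub>\<close>, so that without the identities they only generate maps acting on these two
  spaces by one and the same scalar.\<close>

definition hom_generators :: "nat \<Rightarrow> ('f::field vpoly \<Rightarrow> 'f vpoly) set" where
  "hom_generators n = (\<Union>k\<le>n. {restrict (eps n k) (M n), restrict (del n k) (M n)}
     \<union> {\<lambda>v\<in>M n. scale c (proj n k v) | c. True})"

end

theory Submission
  imports Defs
begin

text \<open>\<open>M\<^sub>k\<close> is the permutation module of \<open>B\<^sub>n\<close> on the \<open>k\<close>-faces, and the orbits on pairs of faces are
  classified by the numbers of common and of antipodal vertices. In the basis of
  \<open>Hom(M\<^sub>k, M\<^sub>l)\<close> with kernels \<open>binomial(|x \<inter> y|, s) \<cdot> binomial(|x \<inter> bar y|, t)\<close> every element is,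
  up to invertible scalars, \<open>\<epsilon>\<^bsup>l-r\<^esup> p(F) \<partial>\<^bsup>k-r\<^esup>\<close> with \<open>r = s + t\<close> and \<open>p\<close> a polynomial, where
  \<open>F = \<epsilon>\<partial> - \<partial>\<epsilon> + const\<close> flips one vertex of a face. Hence \<open>\<epsilon>\<close> and \<open>\<partial>\<close> generate all homomorphisms.
  If 2 is invertible, \<open>E\<^bsub>k,j\<^esub>\<close> is the eigenspace of \<open>F\<close> for \<open>k - 2j\<close>, and \<open>\<epsilon>\<close>, \<open>\<partial>\<close> carry the
  \<open>E\<^bsub>k,j,i\<^esub>\<close> with fixed \<open>(j, i)\<close> into each other, so every endomorphism of \<open>M\<^sub>k\<close> acts on
  \<open>E\<^bsub>k,j,i\<^esub>\<close> as a scalar. For \<open>w\<close> in a submodule \<open>W\<close> of \<open>E\<^bsub>k,j,i\<^esub>\<close> and a face \<open>x\<close> with coefficient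
  \<open>w\<^sub>x \<noteq> 0\<close>, the endomorphism \<open>v \<mapsto> \<Sum>\<^sub>g v\<^bsub>gx\<^esub> gw\<close> maps into \<open>W\<close> and has trace \<open>|B\<^sub>n| w\<^sub>x \<noteq> 0\<close>;
  so its scalar on \<open>E\<^bsub>k,j,i\<^esub>\<close> is nonzero and \<open>W = E\<^bsub>k,j,i\<^esub>\<close>. Composing it with a homomorphism
  into another \<open>E\<^bsub>k,j',i'\<^esub>\<close> shows that the latter vanishes. In characteristic 2, \<open>n \<le> 1\<close>.\<close>

section \<open>Faces\<close>

text \<open>The kernels are products of binomials and not indicators of orbits because they count
  sub-configurations: composing with \<open>eps\<close> or \<open>del\<close> reproduces the kernel
  one level further, up to the factor \<open>l + 1 - r\<close> or \<open>k + 1 - r\<close>. The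
  recurrence that comes from flipping a vertex is solved by dividing by \<open>t\<close>. All
  numbers that have to be inverted lie in \<open>{1..n}\<close>, and 2 is not among the divisors
  unless \<open>n >= 2\<close>; so the generation statement needs no separate treatment of
  characteristic 2. Neither the scalars on the spaces E_{k,j,i} nor their dimensions are computed:
  an endomorphism with image in one summand, which preserves every summand, is zero as soon as its
  scalar on that summand is zero, and this contradicts its trace. What does need computation is that
  the summands are distinct and nonzero. For fixed \<open>j\<close> the eigenvalues for
  \<open>a\<close> and \<open>b\<close> differ by \<open>2(a - b)(a + b - (n - j + 1))\<close>, and
  the range of \<open>i\<close> keeps the last factor between \<open>-n\<close> and
  \<open>-1\<close>. For nonvanishing, an explicit vector is given at the lowest level
  \<open>k = i + j\<close> and moved up by \<open>eps\<close>.\<close>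

definition flip :: "vertex \<Rightarrow> vertex set \<Rightarrow> vertex set" where
  "flip u x = insert (bar u) (x - {u})"

definition free :: "nat \<Rightarrow> vertex set \<Rightarrow> vertex set" where
  "free n x = {u \<in> V n. u \<notin> x \<and> bar u \<notin> x}"

lemma bar_bar [simp]: "bar (bar v) = v"
  by (simp add: bar_def)

lemma bar_neq [simp]: "bar v \<noteq> v" "v \<noteq> bar v"
  by (auto simp: bar_def prod_eq_iff)

lemma bar_eq_iff [simp]: "bar u = bar v \<longleftrightarrow> u = v"
  by (metis bar_bar)

lemma bar_in_V [simp]: "bar v \<in> V n \<longleftrightarrow> v \<in> V n"
  by (auto simp: bar_def V_def mem_Times_iff)

lemma mem_bar_image: "u \<in> bar ` x \<longleftrightarrow> bar u \<in> x"
  by (metis bar_bar image_iff)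

lemma fst_bar [simp]: "fst (bar v) = fst v"
  by (simp add: bar_def)

lemma fst_eq_iff: "fst u = fst v \<longleftrightarrow> u = v \<or> u = bar v"
  by (auto simp: bar_def prod_eq_iff)

lemma finite_V [simp]: "finite (V n)"
  by (simp add: V_def)

lemma card_V: "card (V n) = 2 * n"
  by (simp add: V_def card_cartesian_product UNIV_bool)

text \<open>One of \<open>u\<close> and \<open>bar u\<close> always lies in \<open>Vdot n\<close>,
  so the condition on the pairs can be stated symmetrically in the vertices of the face.\<close>

lemma L_iff: "x \<in> L n k \<longleftrightarrow> x \<subseteq> V n \<and> card x = k \<and> (\<forall>u\<in>x. bar u \<notin> x)"
proof -
  have "card (x \<inter> {v, bar v}) \<le> 1 \<longleftrightarrow> \<not> (v \<in> x \<and> bar v \<in> x)" for v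
  proof -
    have "v \<in> x \<Longrightarrow> bar v \<in> x \<Longrightarrow> x \<inter> {v, bar v} = {v, bar v}" by auto
    moreover have "v \<notin> x \<Longrightarrow> x \<inter> {v, bar v} \<subseteq> {bar v}" "bar v \<notin> x \<Longrightarrow> x \<inter> {v, bar v} \<subseteq> {v}"
      by auto
    ultimately show ?thesis
      using card_mono[of "{v}" "x \<inter> {v, bar v}"] card_mono[of "{bar v}" "x \<inter> {v, bar v}"] by auto
  qed
  moreover have "(\<forall>u\<in>x. bar u \<notin> x) \<longleftrightarrow> (\<forall>v\<in>Vdot n. \<not> (v \<in> x \<and> bar v \<in> x))" if "x \<subseteq> V n"
  proof
    assume R: "\<forall>v\<in>Vdot n. \<not> (v \<in> x \<and> bar v \<in> x)"
    show "\<forall>u\<in>x. bar u \<notin> x"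
    proof
      fix u assume "u \<in> x"
      then have "u \<in> Vdot n \<or> bar u \<in> Vdot n"
        using that by (cases u) (auto simp: V_def Vdot_def bar_def)
      then show "bar u \<notin> x" using R \<open>u \<in> x\<close> by auto
    qed
  qed auto
  ultimately show ?thesis by (auto simp: L_def)
qed

lemma L_D:
  assumes "x \<in> L n k"
  shows "x \<subseteq> V n" "card x = k" "finite x" "\<And>u. u \<in> x \<Longrightarrow> bar u \<notin> x"
  using assms finite_subset[of x "V n"] by (auto simp: L_iff)

lemma finite_L [simp]: "finite (L n k)"
  by (rule finite_subset[of _ "Pow (V n)"]) (auto simp: L_iff)

lemma inj_on_fst_face: "x \<in> L n k \<Longrightarrow> inj_on fst x"
  by (auto simp: inj_on_def L_iff fst_eq_iff)

lemma fst_face_subset: "x \<in> L n k \<Longrightarrow> fst ` x \<subseteq> {1..n}"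
  by (auto simp: L_iff V_def)

lemma card_fst_face: "x \<in> L n k \<Longrightarrow> card (fst ` x) = k"
  using card_image[OF inj_on_fst_face] by (metis L_D(2))

lemma L_le: "x \<in> L n k \<Longrightarrow> k \<le> n"
  using card_fst_face[of x n k] card_mono[OF _ fst_face_subset[of x n k]] by simp

lemma L_empty: "n < k \<Longrightarrow> L n k = {}"
  by (metis L_le ex_in_conv not_le)

lemma L_disjoint: "x \<in> L n k \<Longrightarrow> x \<in> L n l \<Longrightarrow> k = l"
  by (simp add: L_iff)

lemma faces_iff: "x \<in> faces n \<longleftrightarrow> (\<exists>k. x \<in> L n k)"
  unfolding faces_def using L_le by blast

lemma finite_faces [simp]: "finite (faces n)"
  by (simp add: faces_def)

lemma remove_face: "y \<in> L n (Suc k) \<Longrightarrow> u \<in> y \<Longrightarrow> y - {u} \<in> L n k"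
  by (auto simp: L_iff card_Diff_singleton)

lemma insert_face:
  assumes x: "x \<in> L n k" and u: "u \<in> free n x"
  shows "insert u x \<in> L n (Suc k)"
proof -
  have "bar w \<noteq> u" if "w \<in> x" for w using u that by (auto simp: free_def)
  then show ?thesis using L_D[OF x] u by (auto simp: L_iff free_def)
qed

lemma insert_faceD: "insert u x \<in> L n k \<Longrightarrow> u \<notin> x \<Longrightarrow> u \<in> free n x"
  by (auto simp: L_iff free_def)

lemma flip_face:
  assumes x: "x \<in> L n k" and u: "u \<in> x"
  shows "flip u x \<in> L n k"
proof -
  note D = L_D[OF x]
  have "card (flip u x) = Suc (card (x - {u}))"
    using D(3) D(4)[OF u] by (simp add: flip_def)
  also have "\<dots> = k" using D(2,3) u by (metis card_Suc_Diff1)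
  finally have "card (flip u x) = k" .
  moreover have "bar w \<notin> flip u x" if "w \<in> flip u x" for w
    using that D(4)[of w] D(4)[OF u] u by (auto simp: flip_def)
  ultimately show ?thesis using D(1) u by (auto simp: L_iff flip_def)
qed

lemma finite_free [simp]: "finite (free n x)"
  by (simp add: free_def)

lemma bar_free [simp]: "bar u \<in> free n x \<longleftrightarrow> u \<in> free n x"
  by (auto simp: free_def)

lemma card_free:
  assumes "x \<in> L n k"
  shows "card (free n x) = 2 * (n - k)"
proof -
  have "free n x = V n - (x \<union> bar ` x)"
    by (auto simp: free_def mem_bar_image)
  moreover have "card (x \<union> bar ` x) = 2 * k"
    using L_D[OF assms] card_image[of bar x]
    by (subst card_Un_disjoint) (auto simp: mem_bar_image inj_on_def)
  moreover have "x \<union> bar ` x \<subseteq> V n"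
    using L_D(1)[OF assms] by (auto simp: mem_bar_image)
  ultimately show ?thesis
    using L_D(3)[OF assms] by (simp add: card_Diff_subset card_V diff_mult_distrib2)
qed

lemma free_flip:
  assumes x: "x \<in> L n k" and u: "u \<in> x"
  shows "free n (flip u x) = free n x"
proof -
  have "w \<in> flip u x \<or> bar w \<in> flip u x \<longleftrightarrow> w \<in> x \<or> bar w \<in> x" for w
  proof -
    have "bar w = u \<longleftrightarrow> w = bar u" by auto
    then show ?thesis using L_D(4)[OF x u] u by (auto simp: flip_def)
  qed
  then show ?thesis by (auto simp: free_def)
qed

text \<open>Deleting a vertex frees its index for both signs. The second possibility,
  \<open>bar u\<close>, is the source of the flips in the commutator of \<open>eps\<close> and
  \<open>del\<close>.\<close>

lemma free_remove:
  assumes x: "x \<in> L n k" and u: "u \<in> x"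
  shows "free n (x - {u}) = insert u (insert (bar u) (free n x))"
proof -
  have "u \<in> V n" using L_D(1)[OF x] u by auto
  moreover have "bar w = u \<longleftrightarrow> w = bar u" for w by auto
  ultimately show ?thesis using L_D(4)[OF x u] u unfolding free_def by auto
qed

lemma faces_below: "x \<in> L n (Suc k) \<Longrightarrow> {z \<in> L n k. z \<subset> x} = (\<lambda>u. x - {u}) ` x"
proof (intro equalityI subsetI)
  fix z assume x: "x \<in> L n (Suc k)" and z: "z \<in> {z \<in> L n k. z \<subset> x}"
  then obtain u where u: "u \<in> x" "u \<notin> z" by auto
  have "z \<subseteq> x - {u}" "card (x - {u}) = card z"
    using u z L_D(2,3)[OF x] L_D(2)[of z n k] by (auto simp: card_Diff_singleton)
  then have "z = x - {u}" using L_D(3)[OF x] by (metis card_subset_eq finite_Diff)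
  then show "z \<in> (\<lambda>u. x - {u}) ` x" using u by auto
qed (auto simp: remove_face)

lemma inj_remove: "inj_on (\<lambda>u. x - {u}) x"
  by (auto simp: inj_on_def)

lemma faces_above: "x \<in> L n k \<Longrightarrow> {y \<in> L n (Suc k). x \<subset> y} = (\<lambda>u. insert u x) ` free n x"
proof (intro equalityI subsetI)
  fix y assume x: "x \<in> L n k" and y: "y \<in> {y \<in> L n (Suc k). x \<subset> y}"
  then have "x \<in> {z \<in> L n k. z \<subset> y}" by auto
  then obtain u where u: "u \<in> y" "x = y - {u}" using faces_below[of y n k] y by auto
  then have "y = insert u x" "u \<notin> x" by auto
  then show "y \<in> (\<lambda>u. insert u x) ` free n x" using insert_faceD y by blast
qed (auto simp: insert_face free_def)

lemma inj_insert: "inj_on (\<lambda>u. insert u x) (free n x)"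
  by (auto simp: inj_on_def free_def)

section \<open>Coefficients\<close>

lemma face_in_Mk: "x \<in> L n k \<Longrightarrow> face x \<in> Mk n k"
  by (auto simp: Mk_def intro: vp.span_base)

lemma coeff_add [simp]: "coeff_face (v + w) x = coeff_face v x + coeff_face w x"
  by (simp add: coeff_face_def lookup_add)

lemma coeff_diff [simp]: "coeff_face (v - w) x = coeff_face v x - coeff_face w x"
  by (simp add: coeff_face_def lookup_minus)

lemma coeff_zero [simp]: "coeff_face 0 x = 0"
  by (simp add: coeff_face_def)

lemma coeff_scale [simp]: "coeff_face (scale c v) x = c * coeff_face v x"
  by (simp add: coeff_face_def)

lemma coeff_sum [simp]: "coeff_face (\<Sum>i\<in>I. f i) x = (\<Sum>i\<in>I. coeff_face (f i) x)"
  by (induction I rule: infinite_finite_induct) auto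

lemma subspace_Mk: "vp.subspace (Mk n k)" and subspace_M: "vp.subspace (M n)"
  by (simp_all add: Mk_def M_def)

lemma span_faces_expand:
  assumes "finite A" "\<And>x. x \<in> A \<Longrightarrow> finite x" "v \<in> vp.span (face ` A)"
  shows "v = (\<Sum>x\<in>A. scale (coeff_face v x) (face x))"
  using assms(3)
proof (induction rule: vp.span_induct_alt)
  case base
  then show ?case by simp
next
  case (step c f v)
  then obtain y where y: "y \<in> A" "f = face y" by auto
  have "scale (coeff_face f x) (face x) = (if x = y then face y else 0)" if "x \<in> A" for x
    using y that assms(2) by (cases "x = y") (simp_all add: coeff_face_face)
  then have "(\<Sum>x\<in>A. scale (coeff_face f x) (face x)) = f"
    using y assms(1) by simp
  then show ?case using step
    by (simp add: vp.scale_left_distrib sum.distrib flip: vp.scale_scale vp.scale_sum_right)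
qed

lemma Mk_expand: "v \<in> Mk n k \<Longrightarrow> v = (\<Sum>x\<in>L n k. scale (coeff_face v x) (face x))"
  unfolding Mk_def by (rule span_faces_expand) (auto dest: L_D(3))

lemma M_expand: "v \<in> M n \<Longrightarrow> v = (\<Sum>x\<in>faces n. scale (coeff_face v x) (face x))"
  unfolding M_def by (rule span_faces_expand) (auto simp: faces_iff dest: L_D(3))

text \<open>Reduces identities of operators to identities of coefficients. Membership in
  \<open>Mk n k\<close> is essential, since polynomials may contain monomials that are not
  \<open>k\<close>-faces and that this comparison does not see.\<close>

lemma Mk_eqI:
  assumes "v \<in> Mk n k" "w \<in> Mk n k" "\<And>x. x \<in> L n k \<Longrightarrow> coeff_face v x = coeff_face w x"
  shows "v = w"
  using assms(3) Mk_expand[OF assms(1)] Mk_expand[OF assms(2)] by (metis (no_types, lifting) sum.cong)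

lemma M_eqI:
  assumes "v \<in> M n" "w \<in> M n" "\<And>x. x \<in> faces n \<Longrightarrow> coeff_face v x = coeff_face w x"
  shows "v = w"
  using assms(3) M_expand[OF assms(1)] M_expand[OF assms(2)] by (metis (no_types, lifting) sum.cong)

lemma Mk_subset_M: "Mk n k \<subseteq> M n"
  unfolding Mk_def M_def by (intro vp.span_mono image_mono) (auto simp: faces_iff)

lemma Mk_empty: "n < k \<Longrightarrow> Mk n k = {0}"
  by (simp add: Mk_def L_empty)

lemma coeff_extend:
  "coeff_face (extend A \<phi> v) y = (\<Sum>x\<in>A. coeff_face v x * coeff_face (\<phi> x) y)"
  by (simp add: extend_def)

lemma extend_add: "extend A \<phi> (v + w) = extend A \<phi> v + extend A \<phi> w"
  by (simp add: extend_def vp.scale_left_distrib sum.distrib)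

lemma extend_diff: "extend A \<phi> (v - w) = extend A \<phi> v - extend A \<phi> w"
  by (simp add: extend_def vp.scale_left_diff_distrib sum_subtractf)

lemma extend_scale: "extend A \<phi> (scale c v) = scale c (extend A \<phi> v)"
  by (simp add: extend_def vp.scale_sum_right)

lemma extend_0 [simp]: "extend A \<phi> 0 = 0"
  by (simp add: extend_def)

lemma extend_in:
  assumes "vp.subspace S" "\<And>x. x \<in> A \<Longrightarrow> \<phi> x \<in> S"
  shows "extend A \<phi> v \<in> S"
  unfolding extend_def by (intro vp.subspace_sum[OF assms(1)] vp.subspace_scale[OF assms(1)] assms(2))

lemma extend_face:
  assumes "finite A" "\<And>x. x \<in> A \<Longrightarrow> finite x" "x \<in> A"
  shows "extend A \<phi> (face x) = \<phi> x"
proof -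
  have "extend A \<phi> (face x) = (\<Sum>y\<in>A. if y = x then \<phi> x else 0)"
    unfolding extend_def using assms by (intro sum.cong) (auto simp: coeff_face_face)
  then show ?thesis using assms by simp
qed

lemma coeff_sum_faces:
  assumes "finite A" "\<And>x. x \<in> A \<Longrightarrow> finite x" "finite y"
  shows "coeff_face (\<Sum>x\<in>A. face x) y = (if y \<in> A then 1 else 0)"
proof -
  have "coeff_face (\<Sum>x\<in>A. face x) y = (\<Sum>x\<in>A. if x = y then 1 else 0)"
    unfolding coeff_sum using assms by (intro sum.cong) (auto simp: coeff_face_face)
  then show ?thesis using assms by simp
qed

text \<open>Elements of the endomorphism ring are additive and homogeneous only on
  \<open>M n\<close>, so \<open>T\<close> is pulled through the sum over faces by an induction that
  keeps every partial sum in \<open>M n\<close>.\<close>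

lemma linear_eq_extend:
  fixes T :: "'a::field vpoly \<Rightarrow> 'a vpoly"
  assumes "\<And>v w. v \<in> M n \<Longrightarrow> w \<in> M n \<Longrightarrow> T (v + w) = T v + T w"
    "\<And>c v. v \<in> M n \<Longrightarrow> T (scale c v) = scale c (T v)" and v: "v \<in> M n"
  shows "T v = extend (faces n) (\<lambda>x. T (face x)) v"
proof -
  have f: "(face x :: 'a vpoly) \<in> M n" if "x \<in> faces n" for x
    using that unfolding M_def by (auto intro: vp.span_base)
  have "(0 :: 'a vpoly) \<in> M n" by (rule vp.subspace_0[OF subspace_M])
  from assms(2)[OF this, of 0] have T0: "T 0 = 0" by simp
  have "T (\<Sum>x\<in>A. scale (coeff_face v x) (face x)) = (\<Sum>x\<in>A. scale (coeff_face v x) (T (face x)))"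
    if "A \<subseteq> faces n" for A
    using finite_subset[OF that finite_faces] that
  proof (induction A rule: finite_induct)
    case (insert x A)
    have "scale (coeff_face v x) (face x) \<in> M n" "(\<Sum>x\<in>A. scale (coeff_face v x) (face x)) \<in> M n"
      using insert.prems f by (auto intro!: vp.subspace_scale[OF subspace_M] vp.subspace_sum[OF subspace_M])
    then show ?case using insert f by (simp add: assms(1,2))
  qed (simp add: T0)
  from this[of "faces n"] show ?thesis
    unfolding extend_def using M_expand[OF v] by simp
qed

section \<open>The operators in terms of coefficients\<close>

lemma eps_in: "eps n k v \<in> Mk n (Suc k)"
  unfolding eps_def
  by (intro extend_in subspace_Mk vp.subspace_sum[OF subspace_Mk]) (auto simp: face_in_Mk)

lemma del_in: "del n k v \<in> Mk n (k - 1)"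
  unfolding del_def
  by (intro extend_in subspace_Mk vp.subspace_sum[OF subspace_Mk]) (auto simp: face_in_Mk)

lemma proj_in: "proj n k v \<in> Mk n k"
  unfolding proj_def by (intro extend_in subspace_Mk) (auto simp: face_in_Mk)

lemma del_0: "del n 0 v = 0"
proof -
  have "{z \<in> L n (0 - 1). z \<subset> x} = {}" if "x \<in> L n 0" for x using L_D(2,3)[OF that] by simp
  then show ?thesis unfolding del_def extend_def by (intro sum.neutral) (metis sum.empty vp.scale_zero_right)
qed

lemma del_Suc_in: "del n (Suc k) v \<in> Mk n k"
  using del_in by (metis diff_Suc_1)

lemma coeff_proj: "x \<in> L n k \<Longrightarrow> coeff_face (proj n k v) x = coeff_face v x"
proof -
  assume x: "x \<in> L n k"
  have "coeff_face (proj n k v) x = (\<Sum>y\<in>L n k. if y = x then coeff_face v x else 0)"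
    unfolding proj_def coeff_extend using x L_D(3)
    by (intro sum.cong) (auto simp: coeff_face_face)
  then show ?thesis using x by simp
qed

lemma proj_Mk: "v \<in> Mk n k \<Longrightarrow> proj n k v = v"
  by (rule Mk_eqI[OF proj_in]) (auto simp: coeff_proj)

lemma coeff_eps:
  fixes v :: "'a::field vpoly"
  assumes y: "y \<in> L n (Suc k)"
  shows "coeff_face (eps n k v) y = (\<Sum>u\<in>y. coeff_face v (y - {u}))"
proof -
  have "coeff_face (eps n k v) y = (\<Sum>x\<in>L n k. if x \<subset> y then coeff_face v x else 0)"
    unfolding eps_def coeff_extend
  proof (intro sum.cong refl)
    fix x assume "x \<in> L n k"
    have "coeff_face (\<Sum>y\<in>{y \<in> L n (k + 1). x \<subset> y}. face y :: 'a vpoly) y = (if x \<subset> y then 1 else 0)"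
      using y by (subst coeff_sum_faces) (auto dest: L_D(3))
    then show "coeff_face v x * coeff_face (\<Sum>y\<in>{y \<in> L n (k + 1). x \<subset> y}. face y) y
      = (if x \<subset> y then coeff_face v x else 0)" by (simp del: coeff_sum)
  qed
  also have "\<dots> = (\<Sum>x\<in>{x\<in>L n k. x \<subset> y}. coeff_face v x)"
    by (simp add: sum.inter_filter)
  also have "\<dots> = (\<Sum>u\<in>y. coeff_face v (y - {u}))"
    unfolding faces_below[OF y] by (simp add: sum.reindex[OF inj_remove])
  finally show ?thesis .
qed

lemma coeff_del:
  fixes v :: "'a::field vpoly"
  assumes z: "z \<in> L n k"
  shows "coeff_face (del n (Suc k) v) z = (\<Sum>u\<in>free n z. coeff_face v (insert u z))"
proof -
  have "coeff_face (del n (Suc k) v) z = (\<Sum>x\<in>L n (Suc k). if z \<subset> x then coeff_face v x else 0)"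
    unfolding del_def coeff_extend
  proof (intro sum.cong refl)
    fix x assume "x \<in> L n (Suc k)"
    have "coeff_face (\<Sum>z\<in>{z \<in> L n (Suc k - 1). z \<subset> x}. face z :: 'a vpoly) z = (if z \<subset> x then 1 else 0)"
      using z by (subst coeff_sum_faces) (auto dest: L_D(3))
    then show "coeff_face v x * coeff_face (\<Sum>z\<in>{z \<in> L n (Suc k - 1). z \<subset> x}. face z) z
      = (if z \<subset> x then coeff_face v x else 0)" by (simp del: coeff_sum)
  qed
  also have "\<dots> = (\<Sum>x\<in>{x\<in>L n (Suc k). z \<subset> x}. coeff_face v x)"
    by (simp add: sum.inter_filter)
  also have "\<dots> = (\<Sum>u\<in>free n z. coeff_face v (insert u z))"
    unfolding faces_above[OF z] by (simp add: sum.reindex[OF inj_insert])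
  finally show ?thesis .
qed

section \<open>The flip operator as a commutator of \<open>eps\<close> and
  \<open>del\<close>\<close>

definition flip_op :: "nat \<Rightarrow> nat \<Rightarrow> 'f::field vpoly \<Rightarrow> 'f vpoly" where
  "flip_op n k v = eps n (k - 1) (del n k v) - del n (k + 1) (eps n k v)
     + scale (of_int (2 * (int n - int k) - int k)) (proj n k v)"

lemma eps_del_in: "eps n (k - 1) (del n k v) \<in> Mk n k"
  by (cases k) (use eps_in[of n "k - 1" "del n k v"] in
    \<open>auto simp: del_0 eps_def vp.subspace_0[OF subspace_Mk]\<close>)

lemma del_eps_in: "del n (k + 1) (eps n k v) \<in> Mk n k"
  by (simp add: del_Suc_in)

lemma flip_op_in: "flip_op n k v \<in> Mk n k"
  unfolding flip_op_def
  by (intro vp.subspace_add[OF subspace_Mk] vp.subspace_diff[OF subspace_Mk]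
      vp.subspace_scale[OF subspace_Mk] eps_del_in del_eps_in proj_in)

text \<open>Exchanging a vertex of \<open>x\<close> for a free one can be done by deleting first or
  by inserting first, so these terms (\<open>?J\<close>) cancel in the commutator. Paths that return
  to \<open>x\<close> contribute \<open>k\<close> and \<open>2 * (n - k)\<close>; the new vertex of
  the latter paths may be any free vertex. Going through the flip of \<open>u\<close> is possible
  only by deleting first. The scalar in \<open>flip_op\<close> removes the returning paths and
  leaves the flips.\<close>

lemma coeff_flip_op:
  assumes x: "x \<in> L n k"
  shows "coeff_face (flip_op n k v) x = (\<Sum>u\<in>x. coeff_face v (flip u x))"
proof -
  let ?c = "coeff_face v"
  let ?J = "\<Sum>u\<in>free n x. \<Sum>w\<in>x. ?c (insert u (x - {w}))"
  have fx: "finite x" using L_D[OF x] by auto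
  have "coeff_face (del n (k + 1) (eps n k v)) x = (\<Sum>u\<in>free n x. \<Sum>w\<in>insert u x. ?c (insert u x - {w}))"
    by (simp add: coeff_del[OF x] coeff_eps[OF insert_face[OF x]] del: sum.insert cong: sum.cong)
  also have "\<dots> = (\<Sum>u\<in>free n x. ?c x + (\<Sum>w\<in>x. ?c (insert u (x - {w}))))"
  proof (intro sum.cong refl)
    fix u assume "u \<in> free n x"
    then have u: "u \<notin> x" by (auto simp: free_def)
    then have "(\<Sum>w\<in>x. ?c (insert u x - {w})) = (\<Sum>w\<in>x. ?c (insert u (x - {w})))"
      by (intro sum.cong refl arg_cong[where f = ?c]) auto
    then show "(\<Sum>w\<in>insert u x. ?c (insert u x - {w})) = ?c x + (\<Sum>w\<in>x. ?c (insert u (x - {w})))"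
      using u fx by simp
  qed
  also have "\<dots> = of_nat (2 * (n - k)) * ?c x + ?J"
    by (simp add: sum.distrib card_free[OF x])
  finally have 1: "coeff_face (del n (k + 1) (eps n k v)) x = of_nat (2 * (n - k)) * ?c x + ?J" .
  have 2: "coeff_face (eps n (k - 1) (del n k v)) x = of_nat k * ?c x + (\<Sum>u\<in>x. ?c (flip u x)) + ?J"
  proof (cases k)
    case 0
    then have "x = {}" using L_D(2,3)[OF x] by auto
    then show ?thesis using 0 by (simp add: del_0 eps_def)
  next
    case (Suc k')
    have x': "x \<in> L n (Suc k')" using x Suc by simp
    have "coeff_face (eps n (k - 1) (del n k v)) x = (\<Sum>w\<in>x. \<Sum>u\<in>free n (x - {w}). ?c (insert u (x - {w})))"
      unfolding Suc diff_Suc_1 coeff_eps[OF x']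
      by (intro sum.cong refl) (simp add: coeff_del[OF remove_face[OF x']])
    also have "\<dots> = (\<Sum>w\<in>x. ?c x + ?c (flip w x) + (\<Sum>u\<in>free n x. ?c (insert u (x - {w}))))"
    proof (intro sum.cong refl)
      fix w assume w: "w \<in> x"
      have "w \<notin> free n x" "bar w \<notin> free n x" "insert w x = x" using w by (auto simp: free_def)
      then show "(\<Sum>u\<in>free n (x - {w}). ?c (insert u (x - {w})))
        = ?c x + ?c (flip w x) + (\<Sum>u\<in>free n x. ?c (insert u (x - {w})))"
        unfolding free_remove[OF x w] by (simp add: flip_def add.assoc)
    qed
    also have "\<dots> = of_nat k * ?c x + (\<Sum>u\<in>x. ?c (flip u x)) + ?J"
      using sum.swap[of "\<lambda>w u. ?c (insert u (x - {w}))" "free n x" x]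
      by (simp add: sum.distrib L_D(2)[OF x])
    finally show ?thesis .
  qed
  show ?thesis
    unfolding flip_op_def coeff_add coeff_diff coeff_scale coeff_proj[OF x] 1 2
    using L_le[OF x] by (simp add: algebra_simps of_nat_diff)
qed

text \<open>Flipping one vertex commutes with deleting another. The extra term arises when the
  flipped vertex is itself deleted, which amounts to deleting it without a flip. Hence
  \<open>eps\<close> raises an eigenvalue of \<open>flip_op\<close> by 1, so that it preserves
  \<open>j\<close> in \<open>k - 2 * j\<close>.\<close>

lemma flip_op_eps: "flip_op n (Suc k) (eps n k v) = eps n k (flip_op n k v) + eps n k v"
proof (rule Mk_eqI)
  fix y assume y: "y \<in> L n (Suc k)"
  let ?c = "coeff_face v"
  have fy: "finite y" using L_D[OF y] by auto
  have "coeff_face (flip_op n (Suc k) (eps n k v)) y = (\<Sum>u\<in>y. \<Sum>w\<in>flip u y. ?c (flip u y - {w}))"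
    by (simp add: coeff_flip_op[OF y] coeff_eps[OF flip_face[OF y]])
  also have "\<dots> = (\<Sum>u\<in>y. ?c (y - {u}) + (\<Sum>w\<in>y - {u}. ?c (flip u (y - {w}))))"
  proof (intro sum.cong refl)
    fix u assume u: "u \<in> y"
    have b: "bar u \<notin> y" using L_D(4)[OF y u] .
    have "(\<Sum>w\<in>y - {u}. ?c (flip u y - {w})) = (\<Sum>w\<in>y - {u}. ?c (flip u (y - {w})))"
      using b by (intro sum.cong refl arg_cong[where f = ?c]) (auto simp: flip_def)
    moreover have "flip u y - {bar u} = y - {u}" using b by (auto simp: flip_def)
    ultimately show "(\<Sum>w\<in>flip u y. ?c (flip u y - {w})) = ?c (y - {u}) + (\<Sum>w\<in>y - {u}. ?c (flip u (y - {w})))"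
      using b fy by (subst (1) flip_def) simp
  qed
  also have "\<dots> = (\<Sum>w\<in>y. \<Sum>u\<in>y - {w}. ?c (flip u (y - {w}))) + (\<Sum>u\<in>y. ?c (y - {u}))"
  proof -
    have "(\<Sum>u\<in>y. \<Sum>w\<in>y - {u}. ?c (flip u (y - {w}))) = (\<Sum>(u, w)\<in>Sigma y (\<lambda>u. y - {u}). ?c (flip u (y - {w})))"
      using fy by (intro sum.Sigma) auto
    also have "\<dots> = (\<Sum>(w, u)\<in>Sigma y (\<lambda>w. y - {w}). ?c (flip u (y - {w})))"
      by (rule sum.reindex_bij_witness[of _ prod.swap prod.swap]) auto
    also have "\<dots> = (\<Sum>w\<in>y. \<Sum>u\<in>y - {w}. ?c (flip u (y - {w})))"
      using fy by (intro sum.Sigma[symmetric]) auto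
    finally have "(\<Sum>u\<in>y. \<Sum>w\<in>y - {u}. ?c (flip u (y - {w}))) = (\<Sum>w\<in>y. \<Sum>u\<in>y - {w}. ?c (flip u (y - {w})))" .
    then show ?thesis by (simp add: sum.distrib)
  qed
  also have "\<dots> = coeff_face (eps n k (flip_op n k v) + eps n k v) y"
    by (simp add: coeff_eps[OF y] coeff_flip_op[OF remove_face[OF y]])
  finally show "coeff_face (flip_op n (Suc k) (eps n k v)) y
    = coeff_face (eps n k (flip_op n k v) + eps n k v) y" .
qed (simp_all add: flip_op_in eps_in vp.subspace_add[OF subspace_Mk])

text \<open>Dual to the previous identity: the extra term comes from flipping the vertex just
  inserted. It becomes its opposite, which is free as well, so \<open>bar\<close> permutes these
  terms.\<close>

lemma flip_op_del: "del n (Suc k) (flip_op n (Suc k) v) = flip_op n k (del n (Suc k) v) + del n (Suc k) v"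
proof (rule Mk_eqI)
  fix z assume z: "z \<in> L n k"
  let ?c = "coeff_face v"
  have fz: "finite z" using L_D[OF z] by auto
  have "coeff_face (del n (Suc k) (flip_op n (Suc k) v)) z
    = (\<Sum>w\<in>free n z. \<Sum>u\<in>insert w z. ?c (flip u (insert w z)))"
    by (simp add: coeff_del[OF z] coeff_flip_op[OF insert_face[OF z]])
  also have "\<dots> = (\<Sum>w\<in>free n z. ?c (insert (bar w) z) + (\<Sum>u\<in>z. ?c (insert w (flip u z))))"
  proof (intro sum.cong refl)
    fix w assume "w \<in> free n z"
    then have w: "w \<notin> z" by (auto simp: free_def)
    have "(\<Sum>u\<in>z. ?c (flip u (insert w z))) = (\<Sum>u\<in>z. ?c (insert w (flip u z)))"
      using w by (intro sum.cong refl arg_cong[where f = ?c]) (auto simp: flip_def)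
    moreover have "flip w (insert w z) = insert (bar w) z" using w by (auto simp: flip_def)
    ultimately show "(\<Sum>u\<in>insert w z. ?c (flip u (insert w z)))
      = ?c (insert (bar w) z) + (\<Sum>u\<in>z. ?c (insert w (flip u z)))"
      using w fz by simp
  qed
  also have "\<dots> = (\<Sum>u\<in>z. \<Sum>w\<in>free n z. ?c (insert w (flip u z))) + (\<Sum>w\<in>free n z. ?c (insert (bar w) z))"
    using sum.swap[of "\<lambda>w u. ?c (insert w (flip u z))" z "free n z"] by (simp add: sum.distrib)
  also have "(\<Sum>w\<in>free n z. ?c (insert (bar w) z)) = (\<Sum>w\<in>free n z. ?c (insert w z))"
    by (rule sum.reindex_bij_witness[of _ bar bar]) auto
  also have "(\<Sum>u\<in>z. \<Sum>w\<in>free n z. ?c (insert w (flip u z)))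
      = (\<Sum>u\<in>z. \<Sum>w\<in>free n (flip u z). ?c (insert w (flip u z)))"
    using free_flip[OF z] by simp
  also have "\<dots> + (\<Sum>w\<in>free n z. ?c (insert w z)) = coeff_face (flip_op n k (del n (Suc k) v) + del n (Suc k) v) z"
    by (simp add: coeff_del[OF z] coeff_flip_op[OF z] coeff_del[OF flip_face[OF z]])
  finally show "coeff_face (del n (Suc k) (flip_op n (Suc k) v)) z
    = coeff_face (flip_op n k (del n (Suc k) v) + del n (Suc k) v) z" .
qed (simp_all add: del_Suc_in flip_op_in vp.subspace_add[OF subspace_Mk])

section \<open>The hyperoctahedral group\<close>

abbreviation ginv :: "(vertex \<Rightarrow> vertex) \<Rightarrow> vertex \<Rightarrow> vertex" where
  "ginv g \<equiv> inv_into UNIV g"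

lemma B_D:
  assumes "g \<in> B n"
  shows "inj g" "g permutes V n" "\<And>v. g (bar v) = bar (g v)" "\<And>v. g v \<in> V n \<longleftrightarrow> v \<in> V n"
proof -
  show p: "g permutes V n" using assms by (simp add: B_def)
  show "inj g" using permutes_inj[OF p] .
  show "\<And>v. g v \<in> V n \<longleftrightarrow> v \<in> V n" using permutes_in_image[OF p] .
  show "g (bar v) = bar (g v)" for v
    using assms permutes_not_in[OF p] by (cases "v \<in> V n") (auto simp: B_def)
qed

lemma B_comp: "g \<in> B n \<Longrightarrow> h \<in> B n \<Longrightarrow> g \<circ> h \<in> B n"
  using permutes_compose[of h "V n" g] B_D(3)[of g n] B_D(3)[of h n] by (simp add: B_def)

lemma B_inv: "g \<in> B n \<Longrightarrow> ginv g \<in> B n"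
proof -
  assume g: "g \<in> B n"
  have "ginv g (bar v) = bar (ginv g v)" for v
    using B_D[OF g] permutes_inverses[OF B_D(2)[OF g]] by (metis inv_f_f)
  then show ?thesis using permutes_inv[OF B_D(2)[OF g]] by (simp add: B_def)
qed

lemma B_inv_image: "g \<in> B n \<Longrightarrow> ginv g ` (g ` x) = x" "g \<in> B n \<Longrightarrow> g ` (ginv g ` x) = x"
  using B_D(1)[of g n] permutes_surj[OF B_D(2)[of g n]] by (simp_all add: image_inv_f_f image_f_inv_f)

lemma finite_B [simp]: "finite (B n)"
  by (rule finite_subset[OF _ finite_permutations[OF finite_V[of n]]]) (auto simp: B_def)

lemma B_face: "g \<in> B n \<Longrightarrow> x \<in> L n k \<Longrightarrow> g ` x \<in> L n k"
proof -
  assume g: "g \<in> B n" and x: "x \<in> L n k"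
  note D = B_D[OF g]
  have "card (g ` x) = k" using L_D(2)[OF x] card_image[OF inj_on_subset[OF D(1)]] by auto
  moreover have "bar (g u) \<notin> g ` x" if "u \<in> x" for u
    using L_D(4)[OF x that] D(1) by (simp add: inj_image_mem_iff flip: D(3))
  ultimately show ?thesis using L_D(1)[OF x] D(4) by (auto simp: L_iff)
qed

lemma B_faces: "g \<in> B n \<Longrightarrow> x \<in> faces n \<Longrightarrow> g ` x \<in> faces n"
  using B_face unfolding faces_iff by blast

section \<open>Signed permutations and the order of the group\<close>

definition signed_perm :: "(nat \<Rightarrow> nat) \<Rightarrow> nat set \<Rightarrow> vertex \<Rightarrow> vertex" where
  "signed_perm \<pi> S v = (\<pi> (fst v), snd v \<noteq> (fst v \<in> S))"

lemma signed_perm_B: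
  assumes \<pi>: "\<pi> permutes {1..n}" and S: "S \<subseteq> {1..n}"
  shows "signed_perm \<pi> S \<in> B n"
proof -
  have "signed_perm \<pi> S permutes V n"
  proof (rule inj_imp_permutes)
    show "inj_on (signed_perm \<pi> S) (V n)"
    proof (rule inj_onI)
      fix u w assume eq: "signed_perm \<pi> S u = signed_perm \<pi> S w"
      then have "\<pi> (fst u) = \<pi> (fst w)" by (simp add: signed_perm_def)
      then have f: "fst u = fst w" using permutes_inj[OF \<pi>] by (simp add: inj_eq)
      with eq have "snd u = snd w" by (simp add: signed_perm_def) (cases "fst w \<in> S"; simp)
      then show "u = w" using f by (simp add: prod_eq_iff)
    qed
    show "signed_perm \<pi> S v \<in> V n" if "v \<in> V n" for v
      using that permutes_in_image[OF \<pi>, of "fst v"] by (auto simp: signed_perm_def V_def mem_Times_iff)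
    show "signed_perm \<pi> S v = v" if "v \<notin> V n" for v
    proof -
      have "fst v \<notin> {1..n}" using that by (auto simp: V_def mem_Times_iff)
      then have "\<pi> (fst v) = fst v" "fst v \<notin> S" using permutes_not_in[OF \<pi>] S by blast+
      then show ?thesis by (simp add: signed_perm_def)
    qed
  qed simp
  moreover have "signed_perm \<pi> S (bar v) = bar (signed_perm \<pi> S v)" for v
    unfolding signed_perm_def bar_def by (cases "fst v \<in> S") simp_all
  ultimately show ?thesis by (simp add: B_def)
qed

lemma card_B: "card (B n) = fact n * 2 ^ n"
proof -
  let ?P = "{\<pi>. \<pi> permutes {1..n}} \<times> Pow {1..n}"
  have "bij_betw (\<lambda>(\<pi>, S). signed_perm \<pi> S) ?P (B n)"
    unfolding bij_betw_def
  proof (intro conjI equalityI subsetI)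
    show "inj_on (\<lambda>(\<pi>, S). signed_perm \<pi> S) ?P"
    proof (rule inj_onI, clarify)
      fix \<pi> S \<rho> T assume "signed_perm \<pi> S = signed_perm \<rho> T"
      then have "signed_perm \<pi> S (i, True) = signed_perm \<rho> T (i, True)" for i by simp
      then show "\<pi> = \<rho> \<and> S = T" by (auto simp: signed_perm_def)
    qed
    fix g assume "g \<in> (\<lambda>(\<pi>, S). signed_perm \<pi> S) ` ?P"
    then show "g \<in> B n" using signed_perm_B by auto
  next
    fix g assume g: "g \<in> B n"
    note D = B_D[OF g]
    define \<pi> where "\<pi> i = fst (g (i, True))" for i
    define S where "S = {i. \<not> snd (g (i, True))}"
    have out: "g (i, True) = (i, True)" if "i \<notin> {1..n}" for i
      using that permutes_not_in[OF D(2)] by (auto simp: V_def)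
    have "\<pi> permutes {1..n}"
    proof (rule inj_imp_permutes)
      show "inj_on \<pi> {1..n}"
      proof (rule inj_onI)
        fix i j assume "\<pi> i = \<pi> j"
        then have "g (i, True) = g (j, True) \<or> g (i, True) = g (bar (j, True))"
          by (simp add: \<pi>_def fst_eq_iff D(3))
        then show "i = j" using D(1) by (auto simp: inj_eq bar_def)
      qed
      show "\<pi> i \<in> {1..n}" if "i \<in> {1..n}" for i
        using D(4)[of "(i, True)"] that by (auto simp: \<pi>_def V_def mem_Times_iff)
      show "\<pi> i = i" if "i \<notin> {1..n}" for i using out[OF that] by (simp add: \<pi>_def)
    qed simp
    moreover have "S \<subseteq> {1..n}" using out unfolding S_def by fastforce
    moreover have "g v = signed_perm \<pi> S v" for v
    proof (cases v)
      case (Pair i b)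
      have "(i, False) = bar (i, True)" by (simp add: bar_def)
      then have "g (i, False) = bar (g (i, True))" using D(3) by simp
      then show ?thesis unfolding Pair
        by (cases b) (simp_all add: signed_perm_def \<pi>_def S_def bar_def prod_eq_iff)
    qed
    ultimately have "(\<pi>, S) \<in> ?P" "g = signed_perm \<pi> S" by auto
    then show "g \<in> (\<lambda>(\<pi>, S). signed_perm \<pi> S) ` ?P" by force
  qed
  then have "card (B n) = card ?P" by (metis bij_betw_same_card)
  also have "\<dots> = fact n * 2 ^ n"
    using card_permutations[of "{1..n}" n] by (simp add: card_cartesian_product card_Pow)
  finally show ?thesis .
qed

section \<open>Orbits of the group on pairs of faces\<close>

lemma mem_fst_image: "i \<in> fst ` (x :: vertex set) \<longleftrightarrow> (i, True) \<in> x \<or> (i, False) \<in> x"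
proof -
  have "i \<in> fst ` x \<longleftrightarrow> (\<exists>b. (i, b) \<in> x)" by force
  then show ?thesis by (simp add: ex_bool_eq disj_commute)
qed

lemma face_sign: "x \<in> L n k \<Longrightarrow> (i, True) \<in> x \<Longrightarrow> (i, False) \<notin> x"
  using L_D(4)[of x n k "(i, True)"] by (simp add: bar_def)

text \<open>What signed permutations cannot change about an index: whether each face uses it, and
  whether they use it with the same sign.\<close>

definition index_type :: "vertex set \<Rightarrow> vertex set \<Rightarrow> nat \<Rightarrow> bool \<times> bool \<times> bool" where
  "index_type x y i = (i \<in> fst ` x, i \<in> fst ` y, i \<in> fst ` (x \<inter> y))"

lemma card_index_type:
  assumes x: "x \<in> L n k" and y: "y \<in> L n l"
  defines "s \<equiv> card (x \<inter> y)" and "t \<equiv> card (x \<inter> bar ` y)"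
  shows "card {i \<in> {1..n}. index_type x y i = (p, q, r)} =
    (if r then (if p \<and> q then s else 0) else if p then (if q then t else k - (s + t))
     else if q then l - (s + t) else n - (k + l - (s + t)))"
proof -
  define X Y D where "X = fst ` x" and "Y = fst ` y" and "D = fst ` (x \<inter> y)"
  have sub: "X \<subseteq> {1..n}" "Y \<subseteq> {1..n}" and fin: "finite X" "finite Y"
    using fst_face_subset[OF x] fst_face_subset[OF y] by (auto simp: X_def Y_def intro: finite_subset)
  have cX: "card X = k" "card Y = l" using card_fst_face x y by (auto simp: X_def Y_def)
  have inj: "inj_on fst x" using inj_on_fst_face[OF x] .
  have D: "D \<subseteq> X \<inter> Y" by (auto simp: D_def X_def Y_def)
  have cD: "card D = s" unfolding D_def s_def
    by (rule card_image) (rule inj_on_subset[OF inj], auto)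
  have XY: "X \<inter> Y = D \<union> fst ` (x \<inter> bar ` y)"
  proof (rule Set.set_eqI)
    fix i
    show "i \<in> X \<inter> Y \<longleftrightarrow> i \<in> D \<union> fst ` (x \<inter> bar ` y)"
      unfolding X_def Y_def D_def Int_iff Un_iff mem_fst_image mem_bar_image bar_def fst_conv snd_conv simp_thms
      by blast
  qed
  have "D \<inter> fst ` (x \<inter> bar ` y) = {}"
    unfolding D_def
    by (subst inj_on_image_Int[OF inj, symmetric]) (use L_D(4)[OF y] in \<open>auto simp: mem_bar_image\<close>)
  moreover have "card (fst ` (x \<inter> bar ` y)) = t" unfolding t_def
    by (rule card_image) (rule inj_on_subset[OF inj], auto)
  ultimately have cXY: "card (X \<inter> Y) = s + t" unfolding XY
    using cD fin D L_D(3)[OF x] by (subst card_Un_disjoint) (auto simp: D_def)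
  have e: "index_type x y i = (i \<in> X, i \<in> Y, i \<in> D)" for i
    by (simp add: index_type_def X_def Y_def D_def)
  have fD: "finite D" using D fin by (auto intro: finite_subset)
  have "{i \<in> {1..n}. index_type x y i = (p, q, r)} =
    (if r then (if p \<and> q then D else {}) else if p then (if q then X \<inter> Y - D else X - (X \<inter> Y))
     else if q then Y - (X \<inter> Y) else {1..n} - (X \<union> Y))"
    unfolding e using sub D by (cases p; cases q; cases r) auto
  moreover have "card (X \<union> Y) = k + l - (s + t)"
    using card_Un_Int[OF fin] cX cXY by simp
  moreover have "card (X \<inter> Y - D) = t" "card (X - (X \<inter> Y)) = k - (s + t)"
     "card (Y - (X \<inter> Y)) = l - (s + t)"
    using D fin fD cX cXY cD by (simp_all add: card_Diff_subset)
  moreover have "card ({1..n} - (X \<union> Y)) = n - card (X \<union> Y)"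
    using sub fin by (simp add: card_Diff_subset)
  ultimately show ?thesis using cD by simp
qed

lemma pair_transitive:
  assumes x: "x \<in> L n k" "x' \<in> L n k" and y: "y \<in> L n l" "y' \<in> L n l"
    and s: "card (x \<inter> y) = card (x' \<inter> y')" and t: "card (x \<inter> bar ` y) = card (x' \<inter> bar ` y')"
  obtains g where "g \<in> B n" "g ` x = x'" "g ` y = y'"
proof -
  \<comment> \<open>Each type occurs equally often for both pairs, since its multiplicity depends
    only on \<open>k\<close>, \<open>l\<close> and the two intersection numbers; equal multisets of
    types give a permutation of the indices that respects types.\<close>
  have "image_mset (index_type x y) (mset_set {1..n}) = image_mset (index_type x' y') (mset_set {1..n})"
  proof (rule multiset_eqI)
    fix c :: "bool \<times> bool \<times> bool"
    show "count (image_mset (index_type x y) (mset_set {1..n})) c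
      = count (image_mset (index_type x' y') (mset_set {1..n})) c"
      by (cases c) (simp only: count_image_mset_eq_card_vimage[OF finite_atLeastAtMost]
        card_index_type[OF x(1) y(1)] card_index_type[OF x(2) y(2)] s t)
  qed
  then obtain \<pi> where \<pi>: "\<pi> permutes {1..n}" "\<forall>i\<in>{1..n}. index_type x y i = index_type x' y' (\<pi> i)"
    using image_mset_eq_implies_permutes[OF finite_atLeastAtMost] by metis
  \<comment> \<open>The sign change at an index used by \<open>x\<close> is dictated by
    \<open>x'\<close>; only at the other indices may \<open>y\<close> decide. At a common index the
    type already tells whether the signs agree, so matching \<open>x\<close> with \<open>x'\<close>
    matches \<open>y\<close> with \<open>y'\<close> too.\<close>
  define S where "S = {i \<in> {1..n}. i \<in> fst ` x \<and> ((i, True) \<in> x \<longleftrightarrow> (\<pi> i, True) \<notin> x')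
    \<or> i \<notin> fst ` x \<and> i \<in> fst ` y \<and> ((i, True) \<in> y \<longleftrightarrow> (\<pi> i, True) \<notin> y')}"
  let ?g = "signed_perm \<pi> S"
  have g: "?g \<in> B n" using \<pi>(1) by (rule signed_perm_B) (auto simp: S_def)
  note sg = face_sign[OF x(1)] face_sign[OF x(2)] face_sign[OF y(1)] face_sign[OF y(2)]
  have ty: "i \<in> fst ` x \<longleftrightarrow> \<pi> i \<in> fst ` x'" "i \<in> fst ` y \<longleftrightarrow> \<pi> i \<in> fst ` y'"
     "i \<in> fst ` (x \<inter> y) \<longleftrightarrow> \<pi> i \<in> fst ` (x' \<inter> y')" if "i \<in> {1..n}" for i
    using \<pi>(2) that by (auto simp: index_type_def)
  have iS: "i \<in> S \<longleftrightarrow> (if i \<in> fst ` x then (i, True) \<in> x \<longleftrightarrow> (\<pi> i, True) \<notin> x'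
    else i \<in> fst ` y \<and> ((i, True) \<in> y \<longleftrightarrow> (\<pi> i, True) \<notin> y'))" if "i \<in> {1..n}" for i
    using that by (simp add: S_def)
  have "?g v \<in> x'" if v: "v \<in> x" for v
  proof -
    obtain i b where ib: "v = (i, b)" by force
    have i: "i \<in> {1..n}" using L_D(1)[OF x(1)] v ib by (auto simp: V_def)
    have "((i, True) \<in> x \<longrightarrow> (\<pi> i, i \<notin> S) \<in> x') \<and> ((i, False) \<in> x \<longrightarrow> (\<pi> i, i \<in> S) \<in> x')"
      using ty[OF i] sg[of i] sg[of "\<pi> i"] iS[OF i] unfolding mem_fst_image Int_iff
      by (cases "i \<in> S"; simp split: if_splits; blast)
    then show ?thesis using v by (cases b) (simp_all add: ib signed_perm_def)
  qed
  then have "?g ` x \<subseteq> x'" by auto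
  moreover have "card (?g ` x) = card x'" using L_D(2) B_face[OF g x(1)] x(2) by metis
  ultimately have gx: "?g ` x = x'" using card_subset_eq[OF L_D(3)[OF x(2)]] by auto
  have "?g v \<in> y'" if v: "v \<in> y" for v
  proof -
    obtain i b where ib: "v = (i, b)" by force
    have i: "i \<in> {1..n}" using L_D(1)[OF y(1)] v ib by (auto simp: V_def)
    have "((i, True) \<in> y \<longrightarrow> (\<pi> i, i \<notin> S) \<in> y') \<and> ((i, False) \<in> y \<longrightarrow> (\<pi> i, i \<in> S) \<in> y')"
      using ty[OF i] sg[of i] sg[of "\<pi> i"] iS[OF i] unfolding mem_fst_image Int_iff
      by (cases "i \<in> S"; simp split: if_splits; blast)
    then show ?thesis using v by (cases b) (simp_all add: ib signed_perm_def)
  qed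
  then have "?g ` y \<subseteq> y'" by auto
  moreover have "card (?g ` y) = card y'" using L_D(2) B_face[OF g y(1)] y(2) by metis
  ultimately have "?g ` y = y'" using card_subset_eq[OF L_D(3)[OF y(2)]] by auto
  then show thesis using that g gx by blast
qed

section \<open>The action\<close>

lemma coeff_other_level: "v \<in> Mk n k \<Longrightarrow> x \<in> L n l \<Longrightarrow> l \<noteq> k \<Longrightarrow> coeff_face v x = 0"
proof -
  assume v: "v \<in> Mk n k" and x: "x \<in> L n l" and "l \<noteq> k"
  have "coeff_face v x = (\<Sum>y\<in>L n k. coeff_face v y * coeff_face (face y :: 'a vpoly) x)"
    by (subst Mk_expand[OF v]) simp
  also have "\<dots> = 0"
  proof (rule sum.neutral, rule ballI)
    fix y assume y: "y \<in> L n k"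
    have "x \<noteq> y" using L_disjoint x y \<open>l \<noteq> k\<close> by auto
    then show "coeff_face v y * coeff_face (face y :: 'a vpoly) x = 0"
      using L_D(3)[OF x] L_D(3)[OF y] by (simp add: coeff_face_face)
  qed
  finally show ?thesis .
qed

lemma face_in_M: "x \<in> faces n \<Longrightarrow> face x \<in> M n"
  by (auto simp: M_def intro: vp.span_base)

lemma act_in_M: "g \<in> B n \<Longrightarrow> act n g v \<in> M n"
  unfolding act_def by (intro extend_in subspace_M) (auto intro: face_in_M B_faces)

lemma coeff_act: 
  assumes g: "g \<in> B n" and x: "x \<in> faces n"
  shows "coeff_face (act n g v) (g ` x) = coeff_face v x"
proof -
  have fin: "finite y" if "y \<in> faces n" for y using that L_D(3) by (auto simp: faces_iff)
  have "coeff_face v y * coeff_face (face (g ` y) :: 'a vpoly) (g ` x) = (if y = x then coeff_face v x else 0)"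
    if "y \<in> faces n" for y
    using fin[OF x] fin[OF that] by (auto simp: coeff_face_face inj_image_eq_iff[OF B_D(1)[OF g]])
  then show ?thesis unfolding act_def coeff_extend using x by simp
qed

lemma act_in_Mk:
  assumes g: "g \<in> B n" and v: "v \<in> Mk n k"
  shows "act n g v \<in> Mk n k"
  unfolding act_def extend_def
proof (rule vp.subspace_sum[OF subspace_Mk])
  fix x assume x: "x \<in> faces n"
  then obtain l where l: "x \<in> L n l" by (auto simp: faces_iff)
  show "scale (coeff_face v x) (face (g ` x)) \<in> Mk n k"
    using coeff_other_level[OF v l] face_in_Mk[OF B_face[OF g l]]
    by (cases "l = k") (auto intro: vp.subspace_scale[OF subspace_Mk] vp.subspace_0[OF subspace_Mk])
qed

lemma act_comp:
  assumes g: "g \<in> B n" and h: "h \<in> B n"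
  shows "act n g (act n h v) = act n (g \<circ> h) v"
proof (rule M_eqI[OF act_in_M act_in_M])
  fix x assume x: "x \<in> faces n"
  define z where "z = ginv h ` ginv g ` x"
  have z: "z \<in> faces n" "x = g ` h ` z"
    using B_faces[OF B_inv] g h x by (auto simp: z_def B_inv_image)
  show "coeff_face (act n g (act n h v)) x = coeff_face (act n (g \<circ> h) v) x"
    using coeff_act[OF g B_faces[OF h z(1)], of "act n h v"] coeff_act[OF h z(1), of v]
      coeff_act[OF B_comp[OF g h] z(1), of v] z(2) by (simp add: image_comp)
qed (use assms B_comp in auto)

lemma act_add: "act n g (v + w) = act n g v + act n g w"
  and act_diff: "act n g (v - w) = act n g v - act n g w"
  and act_scale: "act n g (scale c v) = scale c (act n g v)"
  by (simp_all add: act_def extend_add extend_diff extend_scale)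

lemma act_face: "x \<in> faces n \<Longrightarrow> act n g (face x) = face (g ` x)"
  unfolding act_def by (rule extend_face) (auto simp: faces_iff dest: L_D(3))

lemma submodule_Mk: "submodule n (Mk n k)"
  by (simp add: submodule_def subspace_Mk Mk_subset_M act_in_Mk)

section \<open>Operators given by kernels\<close>

definition ker_op :: "nat \<Rightarrow> nat \<Rightarrow> nat \<Rightarrow> (vertex set \<Rightarrow> vertex set \<Rightarrow> 'f) \<Rightarrow> 'f::field vpoly \<Rightarrow> 'f vpoly" where
  "ker_op n k l K = extend (L n k) (\<lambda>x. \<Sum>y\<in>L n l. scale (K x y) (face y))"

lemma ker_op_in: "ker_op n k l K v \<in> Mk n l"
  unfolding ker_op_def
  by (intro extend_in subspace_Mk vp.subspace_sum[OF subspace_Mk] vp.subspace_scale[OF subspace_Mk])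
     (auto simp: face_in_Mk)

lemma coeff_ker_op:
  assumes y: "y \<in> L n l"
  shows "coeff_face (ker_op n k l K v) y = (\<Sum>x\<in>L n k. coeff_face v x * K x y)"
proof -
  have "coeff_face (\<Sum>z\<in>L n l. scale (K x z) (face z)) y = K x y" for x
  proof -
    have "K x z * coeff_face (face z :: 'a vpoly) y = (if z = y then K x y else 0)" if "z \<in> L n l" for z
      using L_D(3)[OF that] L_D(3)[OF y] by (auto simp: coeff_face_face)
    then show ?thesis using y by simp
  qed
  then show ?thesis unfolding ker_op_def coeff_extend by simp
qed

lemma ker_op_cong: "(\<And>x y. x \<in> L n k \<Longrightarrow> y \<in> L n l \<Longrightarrow> K x y = K' x y) \<Longrightarrow> ker_op n k l K v = ker_op n k l K' v"
  by (rule Mk_eqI[OF ker_op_in ker_op_in]) (simp add: coeff_ker_op)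

lemma eps_ker: "eps n k v = ker_op n k (Suc k) (\<lambda>x y. of_bool (x \<subset> y)) v"
proof -
  have "(\<Sum>y\<in>{y \<in> L n (k + 1). x \<subset> y}. face y :: 'a vpoly) = (\<Sum>y\<in>L n (Suc k). scale (of_bool (x \<subset> y)) (face y))" for x
    by (simp add: sum.inter_filter) (intro sum.cong; simp)
  then show ?thesis by (simp add: eps_def ker_op_def)
qed

lemma del_ker: "del n k v = ker_op n k (k - 1) (\<lambda>x z. of_bool (z \<subset> x)) v"
proof -
  have "(\<Sum>z\<in>{z \<in> L n (k - 1). z \<subset> x}. face z :: 'a vpoly) = (\<Sum>z\<in>L n (k - 1). scale (of_bool (z \<subset> x)) (face z))" for x
    by (simp add: sum.inter_filter) (intro sum.cong; simp)
  then show ?thesis by (simp add: del_def ker_op_def)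
qed

lemma proj_ker: "proj n k v = ker_op n k k (\<lambda>x y. of_bool (x = y)) v"
proof (rule Mk_eqI[OF proj_in ker_op_in])
  fix x assume x: "x \<in> L n k"
  have "(\<Sum>y\<in>L n k. coeff_face v y * of_bool (y = x)) = (\<Sum>y\<in>L n k. if y = x then coeff_face v x else 0)"
    by (intro sum.cong) auto
  then show "coeff_face (proj n k v) x = coeff_face (ker_op n k k (\<lambda>x y. of_bool (x = y)) v) x"
    using x by (simp add: coeff_proj coeff_ker_op)
qed

lemma ker_op_act:
  assumes inv: "\<And>g x y. g \<in> B n \<Longrightarrow> x \<in> L n k \<Longrightarrow> y \<in> L n l \<Longrightarrow> K (g ` x) (g ` y) = K x y"
    and g: "g \<in> B n"
  shows "ker_op n k l K (act n g v) = act n g (ker_op n k l K v)"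
proof (rule Mk_eqI[OF ker_op_in act_in_Mk[OF g ker_op_in]])
  fix z assume z: "z \<in> L n l"
  define y where "y = ginv g ` z"
  have y: "y \<in> L n l" "z = g ` y" using B_face[OF B_inv[OF g] z] B_inv_image[OF g] by (auto simp: y_def)
  have "(\<Sum>x\<in>L n k. coeff_face (act n g v) x * K x z)
    = (\<Sum>x\<in>L n k. coeff_face (act n g v) (g ` x) * K (g ` x) (g ` y))"
    unfolding y(2)
    by (rule sum.reindex_bij_witness[of _ "\<lambda>x. g ` x" "\<lambda>x. ginv g ` x"])
       (auto simp: B_inv_image[OF g] intro: B_face[OF g] B_face[OF B_inv[OF g]])
  also have "\<dots> = (\<Sum>x\<in>L n k. coeff_face v x * K x y)"
  proof (intro sum.cong refl)
    fix x assume x: "x \<in> L n k"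
    then have "x \<in> faces n" by (auto simp: faces_iff)
    then show "coeff_face (act n g v) (g ` x) * K (g ` x) (g ` y) = coeff_face v x * K x y"
      using inv[OF g x y(1)] coeff_act[OF g, of x v] by simp
  qed
  also have "\<dots> = coeff_face (act n g (ker_op n k l K v)) z"
  proof -
    have "y \<in> faces n" using y(1) faces_iff by blast
    from coeff_act[OF g this, of "ker_op n k l K v"] show ?thesis
      using y by (simp add: coeff_ker_op)
  qed
  finally show "coeff_face (ker_op n k l K (act n g v)) z = coeff_face (act n g (ker_op n k l K v)) z"
    by (simp add: coeff_ker_op[OF z])
qed

lemma B_psubset: "g \<in> B n \<Longrightarrow> g ` x \<subset> g ` y \<longleftrightarrow> x \<subset> y"
  using B_D(1)[of g n] by (simp add: inj_image_subset_iff psubset_eq inj_image_eq_iff)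

lemma eps_act: "g \<in> B n \<Longrightarrow> eps n k (act n g v) = act n g (eps n k v)"
  unfolding eps_ker by (rule ker_op_act) (simp_all add: B_psubset)

lemma del_act: "g \<in> B n \<Longrightarrow> del n k (act n g v) = act n g (del n k v)"
  unfolding del_ker by (rule ker_op_act) (simp_all add: B_psubset)

lemma proj_act: "g \<in> B n \<Longrightarrow> proj n k (act n g v) = act n g (proj n k v)"
  unfolding proj_ker by (rule ker_op_act) (simp_all add: inj_image_eq_iff[OF B_D(1)])

lemma flip_op_act: "g \<in> B n \<Longrightarrow> flip_op n k (act n g v) = act n g (flip_op n k v)"
  by (simp add: flip_op_def eps_act del_act proj_act act_add act_diff act_scale)

section \<open>A basis of the equivariant maps\<close>

text \<open>Both sides count the pairs of an \<open>s\<close>-subset and an element of an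
  \<open>S\<close>-set: the element lies outside of the subset (first summand) or inside (second
  summand).\<close>

lemma binomial_delete: "S * (S - 1 choose s) + s * (S choose s) = S * (S choose s)"
proof (cases S)
  case (Suc m)
  then show ?thesis
  proof (cases s)
    case (Suc s')
    have "Suc s' * (Suc m choose Suc s') = Suc m * (m choose s')"
      by (rule Suc_times_binomial)
    then show ?thesis using \<open>S = Suc m\<close> Suc by (simp add: algebra_simps)
  qed simp
qed auto

text \<open>A nonzero product requires \<open>s <= S\<close> and \<open>t <= T\<close>, so the bound
  on the sum forces equality: in top degree the binomial kernel is the indicator of one
  orbit.\<close>

lemma binomial_delta:
  "S + T \<le> s + t \<Longrightarrow> (S choose s) * (T choose t) = of_bool (S = s \<and> T = t)"
proof (cases "S < s \<or> T < t")
  case False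
  moreover assume "S + T \<le> s + t"
  ultimately have "S = s" "T = t" by auto
  then show ?thesis by simp
qed auto

text \<open>The number of choices of \<open>s\<close> common vertices of \<open>x\<close> and
  \<open>y\<close> together with \<open>t\<close> vertices of \<open>x\<close> that are opposite to
  vertices of \<open>y\<close>.\<close>

definition pair_binomial :: "nat \<Rightarrow> nat \<Rightarrow> vertex set \<Rightarrow> vertex set \<Rightarrow> nat" where
  "pair_binomial s t x y = (card (x \<inter> y) choose s) * (card (x \<inter> bar ` y) choose t)"

lemma card_Int_bar_commute: "card (x \<inter> bar ` y) = card (y \<inter> bar ` x)"
  by (rule bij_betw_same_card[of bar], rule bij_betw_byWitness[of _ bar]) (auto simp: mem_bar_image)

lemma pair_binomial_commute: "pair_binomial s t x y = pair_binomial s t y x"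
  by (simp add: pair_binomial_def Int_commute card_Int_bar_commute[of x y])

lemma split_face:
  assumes x: "x \<in> L n k" and y: "y \<in> L n l"
  shows "y = (y \<inter> x) \<union> (y \<inter> bar ` x) \<union> (y - x - bar ` x)" "y \<inter> x \<inter> (y \<inter> bar ` x) = {}"
    "(y \<inter> x \<union> (y \<inter> bar ` x)) \<inter> (y - x - bar ` x) = {}"
  using L_D(4)[OF x] by (auto simp: mem_bar_image)

lemma card_pair_le:
  assumes x: "x \<in> L n k" and y: "y \<in> L n l"
  shows "card (x \<inter> y) + card (x \<inter> bar ` y) \<le> l"
proof -
  have "card (x \<inter> y) + card (x \<inter> bar ` y) = card (y \<inter> x) + card (y \<inter> bar ` x)"
    by (simp add: Int_commute card_Int_bar_commute[of x y])
  also have "\<dots> = card (y \<inter> x \<union> (y \<inter> bar ` x))"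
    using split_face(2)[OF x y] L_D(3)[OF y] by (simp add: card_Un_disjoint)
  also have "\<dots> \<le> card y" by (rule card_mono) (use L_D(3)[OF y] in auto)
  finally show ?thesis using L_D(2)[OF y] by simp
qed

lemma sum_over_face:
  fixes f :: "vertex \<Rightarrow> nat"
  assumes x: "x \<in> L n k" and y: "y \<in> L n l"
    and "\<And>u. u \<in> y \<Longrightarrow> u \<in> x \<Longrightarrow> f u = a" "\<And>u. u \<in> y \<Longrightarrow> bar u \<in> x \<Longrightarrow> f u = b"
    "\<And>u. u \<in> y \<Longrightarrow> u \<notin> x \<Longrightarrow> bar u \<notin> x \<Longrightarrow> f u = c"
  shows "(\<Sum>u\<in>y. f u) = card (x \<inter> y) * a + card (x \<inter> bar ` y) * b
    + (l - (card (x \<inter> y) + card (x \<inter> bar ` y))) * c"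
proof -
  have fin: "finite y" using L_D(3)[OF y] .
  have "(\<Sum>u\<in>y. f u) = (\<Sum>u\<in>y \<inter> x. f u) + (\<Sum>u\<in>y \<inter> bar ` x. f u) + (\<Sum>u\<in>y - x - bar ` x. f u)"
    using fin split_face(2,3)[OF x y]
    by (subst split_face(1)[OF x y], subst sum.union_disjoint, simp_all, subst sum.union_disjoint, simp_all)
  also have "(\<Sum>u\<in>y \<inter> x. f u) = card (x \<inter> y) * a"
    using assms(3) by (simp add: Int_commute)
  also have "(\<Sum>u\<in>y \<inter> bar ` x. f u) = card (x \<inter> bar ` y) * b"
    using assms(4) by (simp add: mem_bar_image card_Int_bar_commute[of x y])
  also have "(\<Sum>u\<in>y - x - bar ` x. f u) = card (y - x - bar ` x) * c"
    using assms(5) by (simp add: mem_bar_image)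
  also have "card (y - x - bar ` x) = l - (card (x \<inter> y) + card (x \<inter> bar ` y))"
  proof -
    have "l = card (y \<inter> x) + card (y \<inter> bar ` x) + card (y - x - bar ` x)"
      using fin split_face(2,3)[OF x y] L_D(2)[OF y]
      by (subst L_D(2)[OF y, symmetric], subst split_face(1)[OF x y], subst card_Un_disjoint, simp_all,
          subst card_Un_disjoint, simp_all)
    then show ?thesis by (simp add: Int_commute card_Int_bar_commute[of x y])
  qed
  finally show ?thesis .
qed

text \<open>A configuration counted by the kernel occupies \<open>s + t\<close> vertices of
  \<open>y\<close> and survives the deletion of each of the other \<open>l - (s + t)\<close>. The
  additive form avoids truncated subtraction.\<close>

lemma pair_binomial_remove:
  assumes x: "x \<in> L n k" and y: "y \<in> L n l"
  shows "(\<Sum>u\<in>y. pair_binomial s t x (y - {u})) + (s + t) * pair_binomial s t x y = l * pair_binomial s t x y"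
proof -
  define S T where "S = card (x \<inter> y)" and "T = card (x \<inter> bar ` y)"
  have "(\<Sum>u\<in>y. pair_binomial s t x (y - {u})) = S * ((S - 1 choose s) * (T choose t))
      + T * ((S choose s) * (T - 1 choose t)) + (l - (S + T)) * ((S choose s) * (T choose t))"
    unfolding S_def T_def
  proof (rule sum_over_face[OF x y])
    fix u assume u: "u \<in> y"
    have 1: "card (x \<inter> (y - {u})) = card (x \<inter> y) - (if u \<in> x then 1 else 0)"
    proof -
      have "x \<inter> (y - {u}) = x \<inter> y - {u}" by auto
      then show ?thesis using u by (simp add: card_Diff_singleton_if)
    qed
    have 2: "card (x \<inter> bar ` (y - {u})) = card (x \<inter> bar ` y) - (if bar u \<in> x then 1 else 0)"
    proof -
      have "x \<inter> bar ` (y - {u}) = x \<inter> bar ` y - {bar u}" by auto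
      then show ?thesis using u by (simp add: card_Diff_singleton_if)
    qed
    show "pair_binomial s t x (y - {u}) = (card (x \<inter> y) - 1 choose s) * (card (x \<inter> bar ` y) choose t)"
      if "u \<in> x" using that L_D(4)[OF x that] by (simp add: pair_binomial_def 1 2)
    show "pair_binomial s t x (y - {u}) = (card (x \<inter> y) choose s) * (card (x \<inter> bar ` y) - 1 choose t)"
      if "bar u \<in> x" using that L_D(4)[OF x that] by (simp add: pair_binomial_def 1 2)
    show "pair_binomial s t x (y - {u}) = (card (x \<inter> y) choose s) * (card (x \<inter> bar ` y) choose t)"
      if "u \<notin> x" "bar u \<notin> x" using that by (simp add: pair_binomial_def 1 2)
  qed
  then have "(\<Sum>u\<in>y. pair_binomial s t x (y - {u})) + (s + t) * ((S choose s) * (T choose t)) =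
      (S * (S - 1 choose s) + s * (S choose s)) * (T choose t)
      + (T * (T - 1 choose t) + t * (T choose t)) * (S choose s)
      + (l - (S + T)) * ((S choose s) * (T choose t))"
    by (simp add: algebra_simps)
  also have "\<dots> = (S + T + (l - (S + T))) * ((S choose s) * (T choose t))"
    unfolding binomial_delete by (simp add: algebra_simps)
  also have "S + T + (l - (S + T)) = l"
    using card_pair_le[OF x y] by (simp add: S_def T_def)
  finally show ?thesis by (simp add: pair_binomial_def S_def T_def)
qed

text \<open>On faces of size \<open>s + t + 1\<close> all kernels involved are indicators of orbits,
  and a flip moves one vertex of \<open>y\<close> between the common and the antipodal ones. The
  intersection numbers \<open>(s + 1, t)\<close> are reached from \<open>(s, t + 1)\<close> by
  flipping one of \<open>t + 1\<close> antipodal vertices, and from \<open>(s + 2, t - 1)\<close> by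
  flipping one of \<open>s + 2\<close> common ones.\<close>

lemma pair_binomial_flip:
  assumes x: "x \<in> L n r" and y: "y \<in> L n r" and r: "r = Suc (s + t)"
  shows "(\<Sum>u\<in>y. pair_binomial (Suc s) t x (flip u y)) = Suc t * pair_binomial s (Suc t) x y
    + (if t = 0 then 0 else (s + 2) * pair_binomial (s + 2) (t - 1) x y)"
proof -
  define S T where "S = card (x \<inter> y)" and "T = card (x \<inter> bar ` y)"
  have fin: "finite x" using L_D(3)[OF x] .
  have ST: "S + T \<le> Suc (s + t)" using card_pair_le[OF x y] by (simp add: S_def T_def r)
  have "(\<Sum>u\<in>y. pair_binomial (Suc s) t x (flip u y)) = S * ((S - 1 choose Suc s) * (T + 1 choose t))
      + T * ((S + 1 choose Suc s) * (T - 1 choose t)) + (r - (S + T)) * ((S choose Suc s) * (T choose t))"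
    unfolding S_def T_def
  proof (rule sum_over_face[OF x y])
    fix u assume u: "u \<in> y"
    have b: "bar u \<notin> y" using L_D(4)[OF y u] .
    have 1: "x \<inter> flip u y = (if bar u \<in> x then insert (bar u) (x \<inter> y - {u}) else x \<inter> y - {u})"
      by (auto simp: flip_def)
    have 2: "x \<inter> bar ` flip u y = (if u \<in> x then insert u (x \<inter> bar ` y - {bar u}) else x \<inter> bar ` y - {bar u})"
      by (auto simp: flip_def)
    show "pair_binomial (Suc s) t x (flip u y) = (card (x \<inter> y) - 1 choose Suc s) * (card (x \<inter> bar ` y) + 1 choose t)"
      if "u \<in> x" using that L_D(4)[OF x that] u b fin
      by (simp add: pair_binomial_def 1 2 card_Diff_singleton_if card_insert_if mem_bar_image)
    show "pair_binomial (Suc s) t x (flip u y) = (card (x \<inter> y) + 1 choose Suc s) * (card (x \<inter> bar ` y) - 1 choose t)"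
      if "bar u \<in> x" using that L_D(4)[OF x that] u b fin
      by (simp add: pair_binomial_def 1 2 card_Diff_singleton_if card_insert_if mem_bar_image del: binomial_Suc_Suc)
    show "pair_binomial (Suc s) t x (flip u y) = (card (x \<inter> y) choose Suc s) * (card (x \<inter> bar ` y) choose t)"
      if "u \<notin> x" "bar u \<notin> x" using that by (simp add: pair_binomial_def 1 2)
  qed
  also have "S * ((S - 1 choose Suc s) * (T + 1 choose t)) = (if t = 0 then 0 else (s + 2) * ((S choose (s + 2)) * (T choose (t - 1))))"
  proof (cases "S = 0")
    case False
    have "(S - 1 choose Suc s) * (T + 1 choose t) = of_bool (S - 1 = Suc s \<and> T + 1 = t)"
      by (rule binomial_delta) (use ST False in simp)
    moreover have "(S choose (s + 2)) * (T choose (t - 1)) = of_bool (S = s + 2 \<and> T = t - 1)" if "t \<noteq> 0"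
      by (rule binomial_delta) (use ST that in simp)
    ultimately show ?thesis using False by (auto simp: of_bool_def)
  qed auto
  also have "T * ((S + 1 choose Suc s) * (T - 1 choose t)) = Suc t * ((S choose s) * (T choose Suc t))"
  proof (cases "T = 0")
    case False
    have "(S + 1 choose Suc s) * (T - 1 choose t) = of_bool (S + 1 = Suc s \<and> T - 1 = t)"
      by (rule binomial_delta) (use ST False in simp)
    moreover have "(S choose s) * (T choose Suc t) = of_bool (S = s \<and> T = Suc t)"
      by (rule binomial_delta) (use ST in simp)
    ultimately show ?thesis using False by (auto simp: of_bool_def)
  qed auto
  \<comment> \<open>If the indicator is 1 then \<open>S + T = r\<close>, and \<open>y\<close> has no
    vertex that is neither common nor antipodal.\<close>
  also have "(r - (S + T)) * ((S choose Suc s) * (T choose t)) = 0"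
    using binomial_delta[of S T "Suc s" t] ST r by auto
  finally show ?thesis by (simp add: pair_binomial_def S_def T_def del: binomial_Suc_Suc)
qed

definition R_op :: "nat \<Rightarrow> nat \<Rightarrow> nat \<Rightarrow> nat \<Rightarrow> nat \<Rightarrow> 'f::field vpoly \<Rightarrow> 'f vpoly" where
  "R_op n k l s t = ker_op n k l (\<lambda>x y. of_nat (pair_binomial s t x y))"

lemma R_op_in: "R_op n k l s t v \<in> Mk n l"
  by (simp add: R_op_def ker_op_in)

text \<open>Summed form of \<open>pair_binomial_remove\<close>. For \<open>s + t <= l < n\<close>
  the factor is one of \<open>1, ..., n\<close>, so the operator at target level
  \<open>Suc l\<close> can be recovered from the one at level \<open>l\<close>. As
  \<open>s + t\<close> may exceed \<open>Suc l\<close>, the difference is taken in the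
  field.\<close>

lemma eps_R_op:
  "eps n l (R_op n k l s t v) = scale (of_nat (Suc l) - of_nat (s + t)) (R_op n k (Suc l) s t v)"
proof (rule Mk_eqI[OF eps_in vp.subspace_scale[OF subspace_Mk R_op_in]])
  fix y assume y: "y \<in> L n (Suc l)"
  have "coeff_face (eps n l (R_op n k l s t v)) y
    = (\<Sum>u\<in>y. \<Sum>x\<in>L n k. coeff_face v x * of_nat (pair_binomial s t x (y - {u})))"
    unfolding coeff_eps[OF y] R_op_def by (intro sum.cong refl coeff_ker_op remove_face[OF y])
  also have "\<dots> = (\<Sum>x\<in>L n k. coeff_face v x * of_nat (\<Sum>u\<in>y. pair_binomial s t x (y - {u})))"
    by (subst sum.swap) (simp add: sum_distrib_left)
  also have "\<dots> = (\<Sum>x\<in>L n k. (of_nat (Suc l) - of_nat (s + t)) * (coeff_face v x * of_nat (pair_binomial s t x y)))"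
  proof (intro sum.cong refl)
    fix x assume x: "x \<in> L n k"
    have "of_nat (\<Sum>u\<in>y. pair_binomial s t x (y - {u})) + of_nat (s + t) * of_nat (pair_binomial s t x y)
      = (of_nat (Suc l) * of_nat (pair_binomial s t x y) :: 'a)"
      using pair_binomial_remove[OF x y, of s t] by (metis of_nat_add of_nat_mult)
    then have "of_nat (\<Sum>u\<in>y. pair_binomial s t x (y - {u})) =
      ((of_nat (Suc l) - of_nat (s + t)) * of_nat (pair_binomial s t x y) :: 'a)"
      by (simp add: eq_diff_eq left_diff_distrib del: of_nat_Suc of_nat_add of_nat_sum)
    then show "coeff_face v x * of_nat (\<Sum>u\<in>y. pair_binomial s t x (y - {u}))
      = (of_nat (Suc l) - of_nat (s + t)) * (coeff_face v x * of_nat (pair_binomial s t x y))"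
      by (simp add: mult.left_commute del: of_nat_Suc of_nat_add of_nat_sum)
  qed
  also have "\<dots> = coeff_face (scale (of_nat (Suc l) - of_nat (s + t)) (R_op n k (Suc l) s t v)) y"
    unfolding coeff_scale R_op_def coeff_ker_op[OF y] by (rule sum_distrib_left[symmetric])
  finally show "coeff_face (eps n l (R_op n k l s t v)) y
    = coeff_face (scale (of_nat (Suc l) - of_nat (s + t)) (R_op n k (Suc l) s t v)) y" .
qed

lemma R_op_del:
  "R_op n k l s t (del n (Suc k) v) = scale (of_nat (Suc k) - of_nat (s + t)) (R_op n (Suc k) l s t v)"
proof (rule Mk_eqI[OF R_op_in vp.subspace_scale[OF subspace_Mk R_op_in]])
  fix y assume y: "y \<in> L n l"
  have "coeff_face (R_op n k l s t (del n (Suc k) v)) y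
    = (\<Sum>z\<in>L n k. (\<Sum>x\<in>L n (Suc k). coeff_face v x * of_bool (z \<subset> x)) * of_nat (pair_binomial s t z y))"
    unfolding R_op_def coeff_ker_op[OF y] del_ker by (intro sum.cong refl) (simp add: coeff_ker_op)
  also have "\<dots> = (\<Sum>x\<in>L n (Suc k). \<Sum>z\<in>L n k. coeff_face v x * of_bool (z \<subset> x) * of_nat (pair_binomial s t z y))"
    by (simp only: sum_distrib_right) (rule sum.swap)
  also have "\<dots> = (\<Sum>x\<in>L n (Suc k). (of_nat (Suc k) - of_nat (s + t)) * (coeff_face v x * of_nat (pair_binomial s t x y)))"
  proof (intro sum.cong refl)
    fix x assume x: "x \<in> L n (Suc k)"
    have "(\<Sum>z\<in>L n k. coeff_face v x * of_bool (z \<subset> x) * of_nat (pair_binomial s t z y))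
      = (\<Sum>z\<in>{z \<in> L n k. z \<subset> x}. coeff_face v x * of_nat (pair_binomial s t z y))"
      by (simp add: sum.inter_filter) (intro sum.cong; simp)
    also have "\<dots> = coeff_face v x * of_nat (\<Sum>u\<in>x. pair_binomial s t y (x - {u}))"
      unfolding faces_below[OF x] by (simp add: sum.reindex[OF inj_remove] sum_distrib_left pair_binomial_commute)
    finally have *: "(\<Sum>z\<in>L n k. coeff_face v x * of_bool (z \<subset> x) * of_nat (pair_binomial s t z y))
      = coeff_face v x * of_nat (\<Sum>u\<in>x. pair_binomial s t y (x - {u}))" .
    have "of_nat (\<Sum>u\<in>x. pair_binomial s t y (x - {u})) + of_nat (s + t) * of_nat (pair_binomial s t y x)
      = (of_nat (Suc k) * of_nat (pair_binomial s t y x) :: 'a)"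
      using pair_binomial_remove[OF y x, of s t] by (metis of_nat_add of_nat_mult)
    then have "of_nat (\<Sum>u\<in>x. pair_binomial s t y (x - {u})) =
      ((of_nat (Suc k) - of_nat (s + t)) * of_nat (pair_binomial s t x y) :: 'a)"
      by (simp add: eq_diff_eq left_diff_distrib pair_binomial_commute[of s t x y] del: of_nat_Suc of_nat_add of_nat_sum)
    then show "(\<Sum>z\<in>L n k. coeff_face v x * of_bool (z \<subset> x) * of_nat (pair_binomial s t z y))
      = (of_nat (Suc k) - of_nat (s + t)) * (coeff_face v x * of_nat (pair_binomial s t x y))"
      unfolding * by (simp add: mult.left_commute del: of_nat_Suc of_nat_add of_nat_sum)
  qed
  also have "\<dots> = coeff_face (scale (of_nat (Suc k) - of_nat (s + t)) (R_op n (Suc k) l s t v)) y"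
    unfolding coeff_scale R_op_def coeff_ker_op[OF y] by (rule sum_distrib_left[symmetric])
  finally show "coeff_face (R_op n k l s t (del n (Suc k) v)) y
    = coeff_face (scale (of_nat (Suc k) - of_nat (s + t)) (R_op n (Suc k) l s t v)) y" .
qed

lemma flip_R_op:
  assumes r: "r = Suc (s + t)"
  shows "flip_op n r (R_op n r r (Suc s) t v) = scale (of_nat (Suc t)) (R_op n r r s (Suc t) v)
    + (if t = 0 then 0 else scale (of_nat (s + 2)) (R_op n r r (s + 2) (t - 1) v))"
proof (rule Mk_eqI)
  fix y assume y: "y \<in> L n r"
  let ?K = "\<lambda>s t x. of_nat (pair_binomial s t x y) :: 'a"
  have "coeff_face (flip_op n r (R_op n r r (Suc s) t v)) y
    = (\<Sum>u\<in>y. \<Sum>x\<in>L n r. coeff_face v x * of_nat (pair_binomial (Suc s) t x (flip u y)))"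
    unfolding coeff_flip_op[OF y] R_op_def by (intro sum.cong refl coeff_ker_op flip_face[OF y])
  also have "\<dots> = (\<Sum>x\<in>L n r. coeff_face v x * of_nat (\<Sum>u\<in>y. pair_binomial (Suc s) t x (flip u y)))"
    by (subst sum.swap) (simp add: sum_distrib_left)
  also have "\<dots> = (\<Sum>x\<in>L n r. of_nat (Suc t) * (coeff_face v x * ?K s (Suc t) x) +
      (if t = 0 then 0 else of_nat (s + 2) * (coeff_face v x * ?K (s + 2) (t - 1) x)))"
  proof (intro sum.cong refl)
    fix x assume x: "x \<in> L n r"
    show "coeff_face v x * of_nat (\<Sum>u\<in>y. pair_binomial (Suc s) t x (flip u y))
      = of_nat (Suc t) * (coeff_face v x * ?K s (Suc t) x) +
      (if t = 0 then 0 else of_nat (s + 2) * (coeff_face v x * ?K (s + 2) (t - 1) x))"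
      unfolding pair_binomial_flip[OF x y r] by (simp add: algebra_simps)
  qed
  also have "\<dots> = of_nat (Suc t) * (\<Sum>x\<in>L n r. coeff_face v x * ?K s (Suc t) x) +
     (if t = 0 then 0 else of_nat (s + 2) * (\<Sum>x\<in>L n r. coeff_face v x * ?K (s + 2) (t - 1) x))"
    by (simp add: sum.distrib sum_distrib_left)
  also have "\<dots> = coeff_face (scale (of_nat (Suc t)) (R_op n r r s (Suc t) v)
    + (if t = 0 then 0 else scale (of_nat (s + 2)) (R_op n r r (s + 2) (t - 1) v))) y"
    unfolding R_op_def by (simp only: coeff_add coeff_scale coeff_ker_op[OF y] coeff_zero if_distrib[of "\<lambda>v. coeff_face v y"])
  finally show "coeff_face (flip_op n r (R_op n r r (Suc s) t v)) y =
    coeff_face (scale (of_nat (Suc t)) (R_op n r r s (Suc t) v)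
    + (if t = 0 then 0 else scale (of_nat (s + 2)) (R_op n r r (s + 2) (t - 1) v))) y" .
qed (auto intro!: flip_op_in vp.subspace_add[OF subspace_Mk] vp.subspace_scale[OF subspace_Mk] R_op_in
      vp.subspace_0[OF subspace_Mk])

text \<open>Two \<open>r\<close>-faces share \<open>r\<close> vertices only if they are equal. This
  starts the recursion in \<open>R_op_class\<close>.\<close>

lemma R_op_proj: "R_op n r r r 0 v = proj n r v"
  unfolding R_op_def proj_ker
proof (rule ker_op_cong)
  fix x y assume x: "x \<in> L n r" and y: "y \<in> L n r"
  have "(card (x \<inter> y) choose r) = of_bool (x = y)"
  proof (cases "x = y")
    case False
    have "card (x \<inter> y) \<noteq> r"
      using False L_D(2,3)[OF x] L_D(2,3)[OF y] by (metis Int_lower1 Int_lower2 card_subset_eq)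
    moreover have "card (x \<inter> y) \<le> r" using L_D(2,3)[OF x] card_mono[of x "x \<inter> y"] by auto
    ultimately show ?thesis using False by simp
  qed (use L_D(2)[OF x] in simp)
  then show "of_nat (pair_binomial r 0 x y) = of_bool (x = y)" by (simp add: pair_binomial_def)
qed

lemma R_op_0:
  assumes "min k l < s + t"
  shows "R_op n k l s t v = 0"
proof (rule Mk_eqI[OF R_op_in vp.subspace_0[OF subspace_Mk]])
  fix y assume y: "y \<in> L n l"
  have "pair_binomial s t x y = 0" if x: "x \<in> L n k" for x
  proof -
    have "card (x \<inter> y) + card (x \<inter> bar ` y) < s + t"
      using card_pair_le[OF x y] card_pair_le[OF y x] assms
      by (simp add: Int_commute card_Int_bar_commute[of x y])
    then show ?thesis by (auto simp: pair_binomial_def binomial_eq_0_iff)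
  qed
  then show "coeff_face (R_op n k l s t v) y = coeff_face 0 y"
    unfolding R_op_def coeff_ker_op[OF y] by simp
qed

section \<open>Expansion of invariant kernels in products of binomials\<close>

lemma binomial_interpolation:
  fixes f :: "nat \<Rightarrow> 'a::comm_ring_1"
  shows "\<exists>c. \<forall>S\<le>N. f S = (\<Sum>s\<le>N. c s * of_nat (S choose s))"
proof (induction N)
  case 0
  show ?case by (rule exI[of _ f]) simp
next
  case (Suc N)
  then obtain c where c: "\<And>S. S \<le> N \<Longrightarrow> f S = (\<Sum>s\<le>N. c s * of_nat (S choose s))" by auto
  \<comment> \<open>Newton interpolation: \<open>S choose Suc N\<close> is 0 for
    \<open>S <= N\<close> and 1 for \<open>S = Suc N\<close>, so the value at \<open>Suc N\<close>
    is corrected by one new coefficient without any division.\<close>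
  define d where "d = c(Suc N := f (Suc N) - (\<Sum>s\<le>N. c s * of_nat (Suc N choose s)))"
  have d: "(\<Sum>s\<le>N. d s * of_nat (S choose s)) = (\<Sum>s\<le>N. c s * of_nat (S choose s))" for S
    by (intro sum.cong) (auto simp: d_def)
  have "f S = (\<Sum>s\<le>Suc N. d s * of_nat (S choose s))" if "S \<le> Suc N" for S
  proof (cases "S = Suc N")
    case True
    have "d (Suc N) = f (Suc N) - (\<Sum>s\<le>N. c s * of_nat (Suc N choose s))" by (simp add: d_def)
    then show ?thesis unfolding True sum.atMost_Suc d by (simp del: binomial_Suc_Suc)
  next
    case False
    then show ?thesis using that c[of S] unfolding sum.atMost_Suc d by (simp add: binomial_eq_0)
  qed
  then show ?case by blast
qed

lemma binomial_interpolation2: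
  fixes f :: "nat \<Rightarrow> nat \<Rightarrow> 'a::comm_ring_1"
  shows "\<exists>c. \<forall>S\<le>N. \<forall>T\<le>N. f S T = (\<Sum>s\<le>N. \<Sum>t\<le>N. c s t * of_nat ((S choose s) * (T choose t)))"
proof -
  have "\<forall>T. \<exists>c. \<forall>S\<le>N. f S T = (\<Sum>s\<le>N. c s * of_nat (S choose s))"
    by (rule allI, rule binomial_interpolation)
  then have "\<exists>c. \<forall>T. \<forall>S\<le>N. f S T = (\<Sum>s\<le>N. c T s * of_nat (S choose s))" by (rule choice)
  then obtain c where c: "\<And>S T. S \<le> N \<Longrightarrow> f S T = (\<Sum>s\<le>N. c T s * of_nat (S choose s))" by blast
  have "\<forall>s. \<exists>d. \<forall>T\<le>N. c T s = (\<Sum>t\<le>N. d t * of_nat (T choose t))"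
    by (rule allI, rule binomial_interpolation)
  then have "\<exists>d. \<forall>s. \<forall>T\<le>N. c T s = (\<Sum>t\<le>N. d s t * of_nat (T choose t))" by (rule choice)
  then obtain d where d: "\<And>s T. T \<le> N \<Longrightarrow> c T s = (\<Sum>t\<le>N. d s t * of_nat (T choose t))" by blast
  have "f S T = (\<Sum>s\<le>N. \<Sum>t\<le>N. d s t * of_nat ((S choose s) * (T choose t)))" if "S \<le> N" "T \<le> N" for S T
    unfolding c[OF that(1)] d[OF that(2)] sum_distrib_right of_nat_mult
    by (intro sum.cong refl) (simp only: mult.assoc mult.commute[of "of_nat (S choose _)"])
  then show ?thesis by blast
qed

lemma invariant_kernel:
  fixes K :: "vertex set \<Rightarrow> vertex set \<Rightarrow> 'a::field"
  assumes inv: "\<And>g x y. g \<in> B n \<Longrightarrow> x \<in> L n k \<Longrightarrow> y \<in> L n l \<Longrightarrow> K (g ` x) (g ` y) = K x y"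
  shows "\<exists>c. \<forall>v. ker_op n k l K v = (\<Sum>s\<le>n. \<Sum>t\<le>n. scale (c s t) (R_op n k l s t v))"
proof -
  define P where "P S T p \<longleftrightarrow> fst p \<in> L n k \<and> snd p \<in> L n l \<and> card (fst p \<inter> snd p) = S
    \<and> card (fst p \<inter> bar ` snd p) = T" for S T and p :: "vertex set \<times> vertex set"
  define f where "f S T = (let p = SOME p. P S T p in K (fst p) (snd p))" for S T
  have f: "K x y = f (card (x \<inter> y)) (card (x \<inter> bar ` y))" if x: "x \<in> L n k" and y: "y \<in> L n l" for x y
  proof -
    let ?P = "P (card (x \<inter> y)) (card (x \<inter> bar ` y))"
    have "?P (x, y)" using x y by (simp add: P_def)
    then have p: "?P (SOME p. ?P p)" by (rule someI)
    obtain x' y' where xy': "(SOME p. ?P p) = (x', y')" by fastforce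
    have q: "x' \<in> L n k" "y' \<in> L n l" "card (x \<inter> y) = card (x' \<inter> y')" "card (x \<inter> bar ` y) = card (x' \<inter> bar ` y')"
      using p[unfolded xy'] by (auto simp: P_def)
    obtain g where g: "g \<in> B n" "g ` x = x'" "g ` y = y'"
      using pair_transitive[OF x q(1) y q(2,3,4)] .
    show ?thesis using inv[OF g(1) x y] g by (simp add: f_def xy')
  qed
  obtain c where c: "\<And>S T. S \<le> n \<Longrightarrow> T \<le> n \<Longrightarrow>
      f S T = (\<Sum>s\<le>n. \<Sum>t\<le>n. c s t * of_nat ((S choose s) * (T choose t)))"
    using binomial_interpolation2[of n f] by blast
  have K: "K x y = (\<Sum>s\<le>n. \<Sum>t\<le>n. c s t * of_nat (pair_binomial s t x y))"
    if x: "x \<in> L n k" and y: "y \<in> L n l" for x y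
  proof -
    have "card (x \<inter> y) + card (x \<inter> bar ` y) \<le> n" using card_pair_le[OF x y] L_le[OF y] by simp
    then show ?thesis unfolding f[OF x y] pair_binomial_def by (intro c) auto
  qed
  have "ker_op n k l K v = (\<Sum>s\<le>n. \<Sum>t\<le>n. scale (c s t) (R_op n k l s t v))" for v
  proof (rule Mk_eqI[OF ker_op_in])
    show "(\<Sum>s\<le>n. \<Sum>t\<le>n. scale (c s t) (R_op n k l s t v)) \<in> Mk n l"
      by (intro vp.subspace_sum[OF subspace_Mk] vp.subspace_scale[OF subspace_Mk] R_op_in)
    fix y assume y: "y \<in> L n l"
    have "coeff_face (ker_op n k l K v) y
      = (\<Sum>x\<in>L n k. coeff_face v x * (\<Sum>s\<le>n. \<Sum>t\<le>n. c s t * of_nat (pair_binomial s t x y)))"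
      unfolding coeff_ker_op[OF y] by (intro sum.cong refl) (simp add: K[OF _ y])
    also have "\<dots> = (\<Sum>x\<in>L n k. \<Sum>s\<le>n. \<Sum>t\<le>n. c s t * (coeff_face v x * of_nat (pair_binomial s t x y)))"
      by (simp add: sum_distrib_left mult.left_commute)
    also have "\<dots> = (\<Sum>s\<le>n. \<Sum>t\<le>n. \<Sum>x\<in>L n k. c s t * (coeff_face v x * of_nat (pair_binomial s t x y)))"
      by (subst sum.swap, intro sum.cong refl, subst sum.swap, rule refl)
    also have "\<dots> = coeff_face (\<Sum>s\<le>n. \<Sum>t\<le>n. scale (c s t) (R_op n k l s t v)) y"
      by (simp add: R_op_def coeff_ker_op[OF y] sum_distrib_left)
    finally show "coeff_face (ker_op n k l K v) y
      = coeff_face (\<Sum>s\<le>n. \<Sum>t\<le>n. scale (c s t) (R_op n k l s t v)) y" .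
  qed
  then show ?thesis by blast
qed

text \<open>Characteristic 2 is allowed here when \<open>n <= 1\<close>, which lets the generation
  statement be proved in this locale for all cases at once.\<close>

locale char_gt =
  fixes n :: nat and field_type :: "'f::field itself"
  assumes of_nat_nonzero: "0 < m \<Longrightarrow> m \<le> n \<Longrightarrow> of_nat m \<noteq> (0 :: 'f)"
begin

text \<open>The recurrence \<open>flip_R_op\<close> is solved for its term with
  \<open>Suc t\<close>, which expresses it by operators with smaller \<open>t\<close> after division
  by \<open>Suc t\<close>. The predicate \<open>P\<close> is abstract because the result is used for
  two classes: operators acting as a scalar on an eigenspace, and operators in the generated
  ring.\<close>

lemma R_op_class:
  fixes P :: "('f vpoly \<Rightarrow> 'f vpoly) \<Rightarrow> bool"
  assumes add: "\<And>f g. P f \<Longrightarrow> P g \<Longrightarrow> P (\<lambda>v. f v + g v)"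
    and scale: "\<And>c f. P f \<Longrightarrow> P (\<lambda>v. scale c (f v))"
    and flip: "\<And>f. P f \<Longrightarrow> P (\<lambda>v. flip_op n r (f v))"
    and proj: "P (proj n r)"
    and r: "r \<le> n" "s + t = r"
  shows "P (R_op n r r s t)"
  using r(2)
proof (induction t arbitrary: s rule: less_induct)
  case (less t)
  show ?case
  proof (cases t)
    case 0
    then have "R_op n r r s t = (proj n r :: 'f vpoly \<Rightarrow> 'f vpoly)"
      using less.prems by (auto simp: fun_eq_iff R_op_proj)
    then show ?thesis using proj by simp
  next
    case (Suc t')
    have nz: "(of_nat (Suc t') :: 'f) \<noteq> 0" using of_nat_nonzero[of "Suc t'"] less.prems Suc r(1) by (simp del: of_nat_Suc)
    let ?f = "R_op n r r (Suc s) t' :: 'f vpoly \<Rightarrow> 'f vpoly"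
    let ?h = "\<lambda>v. if t' = 0 then 0 else scale (of_nat (s + 2)) (R_op n r r (s + 2) (t' - 1) v) :: 'f vpoly"
    have "P ?f" using less.IH[of t' "Suc s"] less.prems Suc by simp
    moreover have "P ?h"
    proof (cases "t' = 0")
      case True
      have "?h = (\<lambda>v. scale 0 (proj n r v))" using True by simp
      then show ?thesis using scale[OF proj, of 0] by simp
    next
      case False
      then show ?thesis using less.IH[of "t' - 1" "s + 2"] less.prems Suc by (auto intro: scale)
    qed
    ultimately have "P (\<lambda>v. scale (inverse (of_nat (Suc t'))) (flip_op n r (?f v) + scale (- 1) (?h v)))"
      by (intro scale add flip)
    moreover have "R_op n r r s t v = scale (inverse (of_nat (Suc t'))) (flip_op n r (?f v) + scale (- 1) (?h v))" for v
    proof -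
      have "r = Suc (s + t')" using less.prems Suc by simp
      from flip_R_op[OF this, of n v] have "flip_op n r (?f v) + scale (- 1) (?h v) = scale (of_nat (Suc t')) (R_op n r r s t v)"
        using Suc by (simp add: vp.scale_minus_left)
      then show ?thesis using nz by simp
    qed
    ultimately show ?thesis by (simp add: fun_eq_iff[symmetric])
  qed
qed

end

section \<open>Eigenvectors of linear operators\<close>

abbreviation linear_op :: "('f::field vpoly \<Rightarrow> 'f vpoly) \<Rightarrow> bool" where
  "linear_op N \<equiv> module_hom scale scale N"

lemma linear_opI:
  "(\<And>v w. N (v + w) = N v + N w) \<Longrightarrow> (\<And>c v. N (scale c v) = scale c (N v)) \<Longrightarrow> linear_op N"
  by (intro module_hom.intro module_hom_axioms.intro vp.module_axioms) auto

lemma linear_extend: "linear_op (extend A \<phi>)"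
  by (intro linear_opI extend_add extend_scale)

lemma linear_eps: "linear_op (eps n k)" and linear_del: "linear_op (del n k)"
  and linear_proj: "linear_op (proj n k)"
  and linear_act: "linear_op (act n g)"
  by (simp_all only: eps_def del_def proj_def act_def linear_extend)

lemma linear_nu_plus: "linear_op (nu_plus n k)"
  unfolding nu_plus_def
  by (intro linear_opI)
     (simp_all add: module_hom.add[OF linear_eps] module_hom.add[OF linear_del]
       module_hom.scale[OF linear_eps] module_hom.scale[OF linear_del])

lemma linear_flip_op: "linear_op (flip_op n k)"
  unfolding flip_op_def
  by (intro linear_opI)
     (simp_all add: module_hom.add[OF linear_eps] module_hom.add[OF linear_del] module_hom.add[OF linear_proj]
       module_hom.scale[OF linear_eps] module_hom.scale[OF linear_del] module_hom.scale[OF linear_proj]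
       vp.scale_right_distrib vp.scale_right_diff_distrib vp.scale_left_commute[of "of_int _"])

lemma eigenvectors_independent:
  assumes N: "linear_op N" and "finite I" and "inj_on \<mu> I"
    and "\<And>i. i \<in> I \<Longrightarrow> N (w i) = scale (\<mu> i) (w i)" and "(\<Sum>i\<in>I. w i) = 0"
  shows "\<forall>i\<in>I. w i = 0"
  using assms(2-)
proof (induction I arbitrary: w rule: finite_induct)
  case (insert a I)
  \<comment> \<open>The images of the \<open>w i\<close> under \<open>N\<close> minus the scalar
    \<open>\<mu> a\<close>; this kills the component at \<open>a\<close>.\<close>
  define w' where "w' i = scale (\<mu> i - \<mu> a) (w i)" for i
  have "(\<Sum>i\<in>I. w' i) = (\<Sum>i\<in>insert a I. N (w i) - scale (\<mu> a) (w i))"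
    using insert by (simp add: w'_def vp.scale_left_diff_distrib)
  also have "\<dots> = N (\<Sum>i\<in>insert a I. w i) - scale (\<mu> a) (\<Sum>i\<in>insert a I. w i)"
    by (simp only: sum_subtractf module_hom.sum[OF N] vp.scale_sum_right)
  also have "\<dots> = 0" by (simp only: insert.prems(3) module_hom.zero[OF N] vp.scale_zero_right diff_zero)
  finally have "(\<Sum>i\<in>I. w' i) = 0" .
  moreover have "N (w' i) = scale (\<mu> i) (w' i)" if "i \<in> I" for i
    using insert.prems(2)[of i] that by (simp add: w'_def module_hom.scale[OF N] mult.commute)
  ultimately have "\<forall>i\<in>I. w' i = 0"
    using insert.IH insert.prems(1) by (simp add: inj_on_insert)
  moreover have "\<mu> i - \<mu> a \<noteq> 0" if "i \<in> I" for i
    using insert.prems(1) insert.hyps(2) that by (auto simp: inj_on_def)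
  ultimately have "\<forall>i\<in>I. w i = 0" by (simp add: w'_def)
  then show ?case using insert.prems(3) insert.hyps by simp
qed simp

lemma eigenvector_components:
  assumes N: "linear_op N" and "finite I" and inj: "inj_on \<mu> I"
    and w: "\<And>i. i \<in> I \<Longrightarrow> N (w i) = scale (\<mu> i) (w i)"
    and v: "N (\<Sum>i\<in>I. w i) = scale \<theta> (\<Sum>i\<in>I. w i)" and i: "i \<in> I" "\<mu> i \<noteq> \<theta>"
  shows "w i = 0"
proof -
  define w' where "w' i = scale (\<mu> i - \<theta>) (w i)" for i
  have "(\<Sum>i\<in>I. w' i) = (\<Sum>i\<in>I. N (w i)) - (\<Sum>i\<in>I. scale \<theta> (w i))"
    using w by (simp add: w'_def vp.scale_left_diff_distrib sum_subtractf)
  also have "\<dots> = 0" using v by (simp add: module_hom.sum[OF N] vp.scale_sum_right)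
  finally have "\<forall>i\<in>I. w' i = 0"
    using w by (intro eigenvectors_independent[OF N assms(2) inj])
      (simp_all add: w'_def module_hom.scale[OF N] mult.commute)
  then show ?thesis using i by (auto simp: w'_def)
qed

section \<open>Brackets\<close>

lemma scale_conv_mult: "scale c p = Poly_Mapping.single 0 c * p"
  by (simp add: scale_def mult_map_scale_conv_mult)

lemma scale_mult: "scale c p * scale d q = scale (c * d) (p * q)"
proof -
  have "Poly_Mapping.single 0 c * Poly_Mapping.single 0 d = (Poly_Mapping.single 0 (c * d) :: 'a vpoly)"
    by (simp add: mult_single)
  then show ?thesis unfolding scale_conv_mult by (metis (no_types, lifting) mult.assoc mult.left_commute)
qed

lemma prod_scale: "(\<Prod>i\<in>I. scale (c i) (p i)) = scale (\<Prod>i\<in>I. c i) (\<Prod>i\<in>I. p i)"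
  by (induction I rule: infinite_finite_induct) (simp_all add: scale_mult)

text \<open>For \<open>A\<close> contained in \<open>Vdot n\<close>, the cardinality leaves exactly
  one vertex from each pair \<open>v\<close>, \<open>bar v\<close> with \<open>v\<close> in
  \<open>A\<close>: these are the monomials of a product of factors \<open>v + bar v\<close> and
  \<open>v - bar v\<close>.\<close>

definition transversals :: "nat \<Rightarrow> vertex set \<Rightarrow> vertex set set" where
  "transversals n A = {x \<in> L n (card A). x \<subseteq> A \<union> bar ` A}"

lemma Vdot_D:
  assumes "A \<subseteq> Vdot n"
  shows "finite A" "A \<subseteq> V n" "\<And>u. u \<in> A \<Longrightarrow> bar u \<notin> A" "inj_on fst A"
proof -
  show V: "A \<subseteq> V n" using assms by (auto simp: Vdot_def V_def)
  show "finite A" using finite_subset[OF V] by simp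
  show "bar u \<notin> A" if "u \<in> A" for u using assms that by (cases u) (auto simp: Vdot_def bar_def)
  show "inj_on fst A" using assms by (auto simp: Vdot_def inj_on_def)
qed

lemma fst_antipodal: "fst ` (A \<union> bar ` A) = fst ` A"
  by (simp add: image_Un image_image)

lemma transversal_complement:
  assumes A: "A \<subseteq> Vdot n" and x: "x \<in> transversals n A"
  shows "x \<inter> A \<union> bar ` (A - x) = x"
proof -
  have xL: "x \<in> L n (card A)" and xs: "x \<subseteq> A \<union> bar ` A" using x by (auto simp: transversals_def)
  have "fst ` x \<subseteq> fst ` A" using xs fst_antipodal by blast
  moreover have "card (fst ` x) = card (fst ` A)"
    using card_fst_face[OF xL] card_image[OF Vdot_D(4)[OF A]] by simp
  ultimately have f: "fst ` x = fst ` A" using Vdot_D(1)[OF A] by (simp add: card_subset_eq)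
  have "bar v \<in> x" if v: "v \<in> A" "v \<notin> x" for v
  proof -
    have "fst v \<in> fst ` x" unfolding f using v by simp
    then obtain u where "u \<in> x" "fst u = fst v" by auto
    then show ?thesis using v by (auto simp: fst_eq_iff)
  qed
  moreover have "u \<in> bar ` (A - x)" if "u \<in> x" "u \<notin> A" for u
  proof -
    have "bar u \<in> A" using xs that by (auto simp: mem_bar_image)
    then show ?thesis using L_D(4)[OF xL that(1)] by (auto simp: mem_bar_image)
  qed
  ultimately show ?thesis by auto
qed

lemma prod_expand:
  fixes h :: "vertex \<Rightarrow> 'f::field"
  assumes A: "A \<subseteq> Vdot n"
  shows "(\<Prod>v\<in>A. scale (h v) (vert v) + scale (h (bar v)) (vert (bar v)))
    = (\<Sum>x\<in>transversals n A. scale (\<Prod>u\<in>x. h u) (face x))"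
proof -
  note D = Vdot_D[OF A]
  let ?y = "\<lambda>S. S \<union> bar ` (A - S)"
  have "(\<Prod>v\<in>A. scale (h v) (vert v) + scale (h (bar v)) (vert (bar v)))
    = (\<Sum>S\<in>Pow A. (\<Prod>v\<in>S. scale (h v) (vert v)) * (\<Prod>v\<in>A - S. scale (h (bar v)) (vert (bar v))))"
    by (rule prod_add[OF D(1)])
  also have "\<dots> = (\<Sum>S\<in>Pow A. scale (\<Prod>u\<in>?y S. h u) (face (?y S)))"
  proof (intro sum.cong refl)
    fix S assume "S \<in> Pow A"
    then have S: "S \<subseteq> A" "finite S" using D(1) by (auto intro: finite_subset)
    have dis: "S \<inter> bar ` (A - S) = {}" using D(3) S by (auto simp: mem_bar_image)
    have inj: "inj_on bar (A - S)" by (simp add: inj_on_def)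
    have "(\<Prod>v\<in>S. scale (h v) (vert v)) * (\<Prod>v\<in>A - S. scale (h (bar v)) (vert (bar v)))
      = (\<Prod>v\<in>S. scale (h v) (vert v)) * (\<Prod>v\<in>bar ` (A - S). scale (h v) (vert v))"
      by (simp add: prod.reindex[OF inj])
    also have "\<dots> = (\<Prod>v\<in>?y S. scale (h v) (vert v))"
      using S D(1) dis by (intro prod.union_disjoint[symmetric]) auto
    finally show "(\<Prod>v\<in>S. scale (h v) (vert v)) * (\<Prod>v\<in>A - S. scale (h (bar v)) (vert (bar v)))
      = scale (\<Prod>u\<in>?y S. h u) (face (?y S))" by (simp only: prod_scale face_def)
  qed
  also have "\<dots> = (\<Sum>x\<in>transversals n A. scale (\<Prod>u\<in>x. h u) (face x))"
  proof (rule sum.reindex_bij_witness[of _ "\<lambda>x. x \<inter> A" ?y])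
    fix S assume "S \<in> Pow A"
    then have S: "S \<subseteq> A" "finite S" using D(1) by (auto intro: finite_subset)
    show "?y S \<inter> A = S" using D(3) S by (auto simp: mem_bar_image)
    have dis: "S \<inter> bar ` (A - S) = {}" using D(3) S by (auto simp: mem_bar_image)
    have "card (bar ` (A - S)) = card (A - S)" by (rule card_image) (simp add: inj_on_def)
    then have "card (?y S) = card A"
      using S D(1) dis card_mono[OF D(1) S(1)] by (simp add: card_Un_disjoint card_Diff_subset)
    moreover have "bar u \<notin> ?y S" if "u \<in> ?y S" for u
      using that D(3)[of u] D(3)[of "bar u"] S by (auto simp: mem_bar_image)
    moreover have "?y S \<subseteq> V n" using D(2) S by (auto simp: mem_bar_image)
    ultimately show "?y S \<in> transversals n A" using S by (auto simp: transversals_def L_iff)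
  next
    fix x assume x: "x \<in> transversals n A"
    have "A - x \<inter> A = A - x" by auto
    then show "?y (x \<inter> A) = x" using transversal_complement[OF A x] by simp
  qed auto
  finally show ?thesis .
qed

lemma bracket_expand:
  assumes a: "a \<subseteq> Vdot n" and b: "b \<subseteq> Vdot n" and ab: "a \<inter> b = {}"
  shows "bracket a b = (\<Sum>x\<in>transversals n (a \<union> b). scale (\<Prod>u\<in>x. if u \<in> bar ` b then - 1 else 1) (face x))"
proof -
  let ?h = "\<lambda>u. if u \<in> bar ` b then - 1 else 1 :: 'a"
  let ?p = "\<lambda>v. scale (?h v) (vert v) + scale (?h (bar v)) (vert (bar v))"
  have A: "a \<union> b \<subseteq> Vdot n" using a b by simp
  have h: "?h v = 1" if "v \<in> a \<union> b" for v
  proof -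
    have "bar v \<notin> b" using Vdot_D(3)[OF A that] by auto
    then show ?thesis by (simp add: mem_bar_image)
  qed
  have hb: "?h (bar v) = (if v \<in> b then - 1 else 1)" for v by (simp add: mem_bar_image)
  have "(\<Prod>v\<in>a \<union> b. ?p v) = (\<Prod>v\<in>a. ?p v) * (\<Prod>v\<in>b. ?p v)"
    using Vdot_D(1)[OF a] Vdot_D(1)[OF b] ab by (rule prod.union_disjoint)
  also have "(\<Prod>v\<in>a. ?p v) = (\<Prod>v\<in>a. vert v + vert (bar v))"
  proof (intro prod.cong refl)
    fix v assume v: "v \<in> a"
    then have "v \<notin> b" using ab by auto
    then show "?p v = vert v + vert (bar v)" using h[of v] v unfolding hb by simp
  qed
  also have "(\<Prod>v\<in>b. ?p v) = (\<Prod>v\<in>b. vert v - vert (bar v))"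
  proof (intro prod.cong refl)
    fix v assume v: "v \<in> b"
    then show "?p v = vert v - vert (bar v)" using h[of v] unfolding hb by (simp add: vp.scale_minus_left)
  qed
  finally have "(\<Prod>v\<in>a \<union> b. ?p v) = bracket a b" by (simp only: bracket_def)
  then show ?thesis using prod_expand[OF A, of ?h] by (rule trans[OF sym])
qed

lemma card_Int_antipodal:
  assumes x: "x \<in> L n k" and c: "finite c"
  shows "card (x \<inter> (c \<union> bar ` c)) \<le> card c"
proof -
  have "card (x \<inter> (c \<union> bar ` c)) = card (fst ` (x \<inter> (c \<union> bar ` c)))"
    by (rule card_image[symmetric], rule inj_on_subset[OF inj_on_fst_face[OF x]]) auto
  also have "\<dots> \<le> card (fst ` c)"
    using c fst_antipodal[of c] by (intro card_mono) auto
  also have "\<dots> \<le> card c" by (rule card_image_le[OF c])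
  finally show ?thesis .
qed

lemma bracket_in_Mk:
  assumes "a \<subseteq> Vdot n" "b \<subseteq> Vdot n" "a \<inter> b = {}"
  shows "bracket a b \<in> Mk n (card a + card b)"
proof -
  have "card (a \<union> b) = card a + card b"
    using assms Vdot_D(1) by (simp add: card_Un_disjoint)
  then show ?thesis unfolding bracket_expand[OF assms]
    by (intro vp.subspace_sum[OF subspace_Mk] vp.subspace_scale[OF subspace_Mk])
       (auto simp: transversals_def intro!: face_in_Mk)
qed

text \<open>Flipping a vertex over \<open>a\<close> preserves the coefficient and flipping one over
  \<open>b\<close> negates it. A monomial of the bracket has \<open>card a\<close> vertices of the
  first kind and \<open>card b\<close> of the second, so the sum over all flips is
  \<open>card a - card b\<close>.\<close>

lemma flip_op_bracket:
  assumes a: "a \<subseteq> Vdot n" and b: "b \<subseteq> Vdot n" and ab: "a \<inter> b = {}" and k: "card a + card b = k"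
  shows "flip_op n k (bracket a b) = scale (of_int (int k - 2 * int (card b))) (bracket a b :: 'f::field vpoly)"
proof (rule Mk_eqI[OF flip_op_in])
  let ?v = "bracket a b :: 'f vpoly"
  have v: "?v \<in> Mk n k" using bracket_in_Mk[OF a b ab] k by simp
  then show "scale (of_int (int k - 2 * int (card b))) ?v \<in> Mk n k"
    by (rule vp.subspace_scale[OF subspace_Mk])
  let ?h = "\<lambda>u. if u \<in> bar ` b then - 1 else 1 :: 'f"
  let ?C = "a \<union> b \<union> bar ` (a \<union> b)"
  have A: "a \<union> b \<subseteq> Vdot n" using a b by simp
  have fin: "finite a" "finite b" using Vdot_D(1) a b by auto
  have cA: "card (a \<union> b) = k" using fin ab k by (simp add: card_Un_disjoint)
  have coeff: "coeff_face ?v x = (if x \<subseteq> ?C then \<Prod>u\<in>x. ?h u else 0)" if x: "x \<in> L n k" for x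
  proof -
    have "coeff_face ?v x = (\<Sum>y\<in>transversals n (a \<union> b). if y = x then \<Prod>u\<in>x. ?h u else 0)"
      unfolding bracket_expand[OF a b ab] coeff_sum coeff_scale
    proof (intro sum.cong refl)
      fix y assume "y \<in> transversals n (a \<union> b)"
      then have "finite y" using L_D(3) by (auto simp: transversals_def)
      then show "(\<Prod>u\<in>y. ?h u) * coeff_face (face y :: 'f vpoly) x = (if y = x then \<Prod>u\<in>x. ?h u else 0)"
        using L_D(3)[OF x] by (auto simp: coeff_face_face)
    qed
    also have "\<dots> = (if x \<in> transversals n (a \<union> b) then \<Prod>u\<in>x. ?h u else 0)"
      by (simp add: transversals_def)
    finally show ?thesis using x by (simp add: transversals_def cA)
  qed
  fix x assume x: "x \<in> L n k"
  show "coeff_face (flip_op n k ?v) x = coeff_face (scale (of_int (int k - 2 * int (card b))) ?v) x"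
  proof (cases "x \<subseteq> ?C")
    case False
    have "\<not> flip u x \<subseteq> ?C" if u: "u \<in> x" for u
    proof
      assume s: "flip u x \<subseteq> ?C"
      then have "bar u \<in> ?C" by (auto simp: flip_def)
      then have "u \<in> ?C" by (auto simp: mem_bar_image)
      with s False show False by (auto simp: flip_def)
    qed
    then have "coeff_face ?v (flip u x) = 0" if "u \<in> x" for u
      using coeff[OF flip_face[OF x that]] that by simp
    then show ?thesis using False by (simp add: coeff_flip_op[OF x] coeff[OF x])
  next
    case True
    have fx: "finite x" using L_D(3)[OF x] .
    let ?X = "\<lambda>c. x \<inter> (c \<union> bar ` c)"
    have dis: "?X a \<inter> ?X b = {}"
    proof (rule ccontr)
      assume "?X a \<inter> ?X b \<noteq> {}"
      then obtain u where "u \<in> ?X a" "u \<in> ?X b" by blast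
      then have u: "u \<in> a \<or> bar u \<in> a" "u \<in> b \<or> bar u \<in> b"
        by (simp_all only: Int_iff Un_iff mem_bar_image)
      then show False using ab Vdot_D(3)[OF A, of u] by auto
    qed
    have X: "x = ?X a \<union> ?X b" using True by auto
    have "card x = card (?X a) + card (?X b)"
      using fx dis by (subst X, subst card_Un_disjoint) auto
    \<comment> \<open>Both cardinalities are bounded by those of \<open>a\<close> and
      \<open>b\<close>, whose sum is already \<open>k\<close>.\<close>
    then have cb: "card (?X a) = card a" "card (?X b) = card b"
      using card_Int_antipodal[OF x fin(1)] card_Int_antipodal[OF x fin(2)] L_D(2)[OF x] k by linarith+
    have "coeff_face ?v (flip u x) = (if u \<in> b \<union> bar ` b then - 1 else 1) * coeff_face ?v x"
      if u: "u \<in> x" for u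
    proof -
      have "flip u x \<subseteq> ?C" using True u by (auto simp: flip_def mem_bar_image)
      then have "coeff_face ?v (flip u x) = (\<Prod>w\<in>flip u x. ?h w)"
        using coeff[OF flip_face[OF x u]] by simp
      also have "\<dots> = ?h (bar u) * (\<Prod>w\<in>x - {u}. ?h w)"
        using fx L_D(4)[OF x u] by (simp add: flip_def)
      also have "?h (bar u) = (if u \<in> b \<union> bar ` b then - 1 else 1) * ?h u"
        using Vdot_D(3)[OF b, of u] by (auto simp: mem_bar_image)
      also have "\<dots> * (\<Prod>w\<in>x - {u}. ?h w) = (if u \<in> b \<union> bar ` b then - 1 else 1) * (\<Prod>w\<in>x. ?h w)"
        by (subst prod.remove[OF fx u]) (simp only: mult.assoc)
      finally show ?thesis using coeff[OF x] True by simp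
    qed
    then have "coeff_face (flip_op n k ?v) x = (\<Sum>u\<in>x. if u \<in> b \<union> bar ` b then - 1 else 1) * coeff_face ?v x"
      unfolding coeff_flip_op[OF x] sum_distrib_right by (intro sum.cong refl) auto
    also have "(\<Sum>u\<in>x. if u \<in> b \<union> bar ` b then - 1 else 1 :: 'f)
      = (\<Sum>u\<in>?X a. if u \<in> b \<union> bar ` b then - 1 else 1) + (\<Sum>u\<in>?X b. if u \<in> b \<union> bar ` b then - 1 else 1)"
      using fx dis by (subst X, subst sum.union_disjoint) auto
    also have "(\<Sum>u\<in>?X a. if u \<in> b \<union> bar ` b then - 1 else 1 :: 'f) = (\<Sum>u\<in>?X a. 1)"
      using dis by (intro sum.cong refl) auto
    also have "(\<Sum>u\<in>?X b. if u \<in> b \<union> bar ` b then - 1 else 1 :: 'f) = (\<Sum>u\<in>?X b. - 1)"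
      by (intro sum.cong refl) auto
    also have "(\<Sum>u\<in>?X a. 1) + (\<Sum>u\<in>?X b. - 1) = (of_int (int k - 2 * int (card b)) :: 'f)"
      using cb by (simp flip: k)
    finally show ?thesis by simp
  qed
qed

text \<open>Since \<open>v\<close> and \<open>bar v\<close> are half the sum and half the difference
  of \<open>v + bar v\<close> and \<open>v - bar v\<close>, multiplying out over the vertices of the
  face gives a combination of brackets. The sign of \<open>?t\<close> selects between
  \<open>v\<close> and \<open>bar v\<close>.\<close>

lemma face_in_span_brackets:
  assumes two: "(2 :: 'f::field) \<noteq> 0" and x: "x \<in> L n k"
  shows "(face x :: 'f vpoly) \<in> vp.span {bracket a b | a b. a \<subseteq> Vdot n \<and> b \<subseteq> Vdot n \<and> a \<inter> b = {} \<and> card a + card b = k}"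
proof -
  let ?r = "\<lambda>u. if u \<in> Vdot n then u else bar u"
  define A where "A = ?r ` x"
  have V: "u \<in> Vdot n \<or> bar u \<in> Vdot n" if "u \<in> x" for u
    using that L_D(1)[OF x] by (cases u) (auto simp: V_def Vdot_def bar_def)
  have inj: "inj_on ?r x"
    using L_D(4)[OF x] by (auto simp: inj_on_def split: if_splits)
  have A: "A \<subseteq> Vdot n" unfolding A_def by (intro image_subsetI) (auto dest: V split: if_splits)
  have cA: "card A = k" unfolding A_def using card_image[OF inj] L_D(2)[OF x] by simp
  let ?t = "\<lambda>v. if v \<in> x then 1 / 2 else - (1 / 2) :: 'f"
  have half: "1 / 2 + 1 / 2 = (1 :: 'f)" using two by (simp add: field_simps)
  have v: "scale (1 / 2) (vert v + vert (bar v)) + scale (?t v) (vert v - vert (bar v))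
    = (if v \<in> x then vert v else vert (bar v) :: 'f vpoly)" for v
  proof -
    have 1: "scale (1 / 2) p + scale (1 / 2) p = p" for p :: "'f vpoly"
      by (simp only: vp.scale_left_distrib[symmetric] half vp.scale_one)
    have "scale (1 / 2) (p + q) + scale (1 / 2) (p - q) = scale (1 / 2) p + scale (1 / 2) p"
      "scale (1 / 2) (p + q) + scale (- (1 / 2)) (p - q) = scale (1 / 2) q + scale (1 / 2) q" for p q :: "'f vpoly"
      by (simp_all only: vp.scale_right_distrib vp.scale_right_diff_distrib vp.scale_minus_left) simp_all
    then show ?thesis by (simp add: 1)
  qed
  have "(face x :: 'f vpoly) = (\<Prod>v\<in>A. if v \<in> x then vert v else vert (bar v))"
    unfolding face_def A_def prod.reindex[OF inj] comp_def
  proof (intro prod.cong refl)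
    fix u assume u: "u \<in> x"
    then show "vert u = (if ?r u \<in> x then vert (?r u) else vert (bar (?r u)) :: 'f vpoly)"
      using L_D(4)[OF x u] by simp
  qed
  also have "\<dots> = (\<Prod>v\<in>A. scale (1 / 2) (vert v + vert (bar v)) + scale (?t v) (vert v - vert (bar v)))"
    by (simp only: v)
  also have "\<dots> = (\<Sum>S\<in>Pow A. (\<Prod>v\<in>S. scale (1 / 2) (vert v + vert (bar v)))
     * (\<Prod>v\<in>A - S. scale (?t v) (vert v - vert (bar v))))"
    by (rule prod_add[OF Vdot_D(1)[OF A]])
  also have "\<dots> = (\<Sum>S\<in>Pow A. scale ((\<Prod>v\<in>S. 1 / 2) * (\<Prod>v\<in>A - S. ?t v)) (bracket S (A - S)))"
    by (simp only: prod_scale scale_mult bracket_def)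
  also have "\<dots> \<in> vp.span {bracket a b | a b. a \<subseteq> Vdot n \<and> b \<subseteq> Vdot n \<and> a \<inter> b = {} \<and> card a + card b = k}"
  proof (intro vp.span_sum vp.span_scale vp.span_base)
    fix S assume "S \<in> Pow A"
    then have S: "S \<subseteq> A" "finite S" using Vdot_D(1)[OF A] by (auto intro: finite_subset)
    have "card S + card (A - S) = k"
      using S card_mono[OF Vdot_D(1)[OF A] S(1)] cA by (simp add: card_Diff_subset)
    then show "bracket S (A - S) \<in> {bracket a b | a b. a \<subseteq> Vdot n \<and> b \<subseteq> Vdot n \<and> a \<inter> b = {} \<and> card a + card b = k}"
      using S A by blast
  qed
  finally show ?thesis .
qed

lemma E_subset_Mk: "E n k j \<subseteq> Mk n k"
  unfolding E_def by (rule vp.span_minimal[OF _ subspace_Mk]) (use bracket_in_Mk in auto)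

lemma flip_op_E:
  assumes "v \<in> E n k j"
  shows "flip_op n k v = scale (of_int (int k - 2 * int j)) v"
  using assms unfolding E_def
proof (induction rule: vp.span_induct_alt)
  case (step c f v)
  then obtain a b where "f = bracket a b" "a \<subseteq> Vdot n" "b \<subseteq> Vdot n" "a \<inter> b = {}" "card a + j = k" "card b = j"
    by auto
  then have "flip_op n k f = scale (of_int (int k - 2 * int j)) f"
    using flip_op_bracket[of a n b k] by simp
  then show ?case using step(2)
    by (simp add: module_hom.add[OF linear_flip_op] module_hom.scale[OF linear_flip_op]
        vp.scale_right_distrib mult.commute)
qed (simp add: module_hom.zero[OF linear_flip_op])

lemma Mk_decomposition:
  assumes two: "(2 :: 'f::field) \<noteq> 0" and v: "(v :: 'f vpoly) \<in> Mk n k"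
  shows "\<exists>w. v = (\<Sum>j\<le>k. w j) \<and> (\<forall>j\<le>k. w j \<in> E n k j)"
proof -
  let ?G = "{bracket a b | a b. a \<subseteq> Vdot n \<and> b \<subseteq> Vdot n \<and> a \<inter> b = {} \<and> card a + card b = k} :: 'f vpoly set"
  have "v \<in> vp.span ?G"
    using v vp.span_minimal[OF _ vp.subspace_span, of "face ` L n k" ?G] face_in_span_brackets[OF two]
    unfolding Mk_def by blast
  then show ?thesis
  proof (induction rule: vp.span_induct_alt)
    case base
    show ?case by (rule exI[of _ "\<lambda>_. 0"]) (simp add: E_def vp.span_zero)
  next
    case (step c f v)
    then obtain w where w: "v = (\<Sum>j\<le>k. w j)" "\<forall>j\<le>k. w j \<in> E n k j" by blast
    obtain a b where ab: "f = bracket a b" "a \<subseteq> Vdot n" "b \<subseteq> Vdot n" "a \<inter> b = {}" "card a + card b = k"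
      using step(1) by auto
    define j where "j = card b"
    have "f \<in> E n k j" unfolding E_def j_def using ab by (intro vp.span_base) auto
    then have f: "scale c f \<in> E n k j" unfolding E_def by (rule vp.span_scale)
    let ?w = "\<lambda>i. (if i = j then scale c f else 0) + w i"
    have "scale c f + v = (\<Sum>i\<le>k. ?w i)"
      using ab(5) w(1) by (simp add: sum.distrib j_def)
    moreover have "\<forall>i\<le>k. ?w i \<in> E n k i" using f w(2) by (auto simp: E_def vp.span_add)
    ultimately show ?case by blast
  qed
qed

section \<open>Eigenspaces\<close>

text \<open>As a polynomial in \<open>k\<close> this has the roots \<open>j + i - 1\<close> and
  \<open>n - i\<close>. The spaces with fixed \<open>j\<close> and \<open>i\<close> form a string
  over the levels \<open>j + i <= k <= n - i\<close>, linked by \<open>eps\<close> and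
  \<open>del\<close>, and the roots mark where it breaks off.\<close>

definition ev :: "nat \<Rightarrow> nat \<Rightarrow> nat \<Rightarrow> nat \<Rightarrow> int" where
  "ev n k j i = 2 * (int k - int j + 1 - int i) * (int n - int k - int i)"

definition flip_space :: "nat \<Rightarrow> nat \<Rightarrow> nat \<Rightarrow> 'f::field vpoly set" where
  "flip_space n k j = {v \<in> Mk n k. flip_op n k v = scale (of_int (int k - 2 * int j)) v}"

text \<open>For odd or zero characteristic these are the spaces \<open>Ei n k j i\<close>, but \<open>j\<close> and \<open>i\<close> are unrestricted.\<close>

definition joint_space :: "nat \<Rightarrow> nat \<Rightarrow> nat \<Rightarrow> nat \<Rightarrow> 'f::field vpoly set" where
  "joint_space n k j i = {v \<in> flip_space n k j. nu_plus n k v = scale (of_int (ev n k j i)) v}"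

lemma subspace_flip_space: "vp.subspace (flip_space n k j)"
  unfolding flip_space_def
  by (rule vp.subspaceI)
     (auto simp: module_hom.add[OF linear_flip_op] module_hom.scale[OF linear_flip_op] module_hom.zero[OF linear_flip_op]
       vp.scale_right_distrib mult.commute intro: vp.subspace_add[OF subspace_Mk] vp.subspace_0[OF subspace_Mk]
       vp.subspace_scale[OF subspace_Mk])

lemma subspace_joint_space: "vp.subspace (joint_space n k j i)"
  unfolding joint_space_def
  by (rule vp.subspaceI)
     (auto simp: module_hom.add[OF linear_nu_plus] module_hom.scale[OF linear_nu_plus] module_hom.zero[OF linear_nu_plus]
       vp.scale_right_distrib mult.commute intro: vp.subspace_add[OF subspace_flip_space]
       vp.subspace_0[OF subspace_flip_space] vp.subspace_scale[OF subspace_flip_space])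

lemma joint_subset_flip: "joint_space n k j i \<subseteq> flip_space n k j"
  by (auto simp: joint_space_def)

lemma flip_subset_Mk: "flip_space n k j \<subseteq> Mk n k"
  by (auto simp: flip_space_def)

lemma nu_plus_act: "g \<in> B n \<Longrightarrow> nu_plus n k (act n g v) = act n g (nu_plus n k v)"
  by (simp add: nu_plus_def eps_act del_act)

lemma submodule_joint_space: "submodule n (joint_space n k j i)"
  unfolding submodule_def
proof (intro conjI ballI)
  show "joint_space n k j i \<subseteq> M n" using joint_subset_flip flip_subset_Mk Mk_subset_M by blast
  fix g u assume "g \<in> B n" "u \<in> joint_space n k j i"
  then show "act n g u \<in> joint_space n k j i"
    by (auto simp: joint_space_def flip_space_def act_in_Mk flip_op_act nu_plus_act act_scale)
qed (rule subspace_joint_space)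

text \<open>On an eigenspace of \<open>flip_op\<close> the commutator of \<open>eps\<close> and
  \<open>del\<close> is a scalar, namely \<open>2 * (n - k) - k\<close> diminished by the eigenvalue
  \<open>k - 2 * j\<close>. Hence \<open>eps \<circ> del\<close> and \<open>nu_plus\<close> have the
  same eigenvectors there.\<close>

lemma eps_del_flip_space:
  assumes "v \<in> flip_space n k j"
  shows "eps n (k - 1) (del n k v) = nu_plus n k v - scale (of_int (2 * (int n - 2 * int k + int j))) v"
proof -
  have v: "v \<in> Mk n k" "flip_op n k v = scale (of_int (int k - 2 * int j)) v"
    using assms by (auto simp: flip_space_def)
  have "eps n (k - 1) (del n k v) = nu_plus n k v + flip_op n k v - scale (of_int (2 * (int n - int k) - int k)) v"
    unfolding flip_op_def nu_plus_def comp_def by (simp add: proj_Mk[OF v(1)])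
  also have "\<dots> = nu_plus n k v - scale (of_int (2 * (int n - int k) - int k) - of_int (int k - 2 * int j)) v"
    unfolding v(2) by (simp only: vp.scale_left_diff_distrib) (simp only: diff_diff_eq2)
  also have "(of_int (2 * (int n - int k) - int k) - of_int (int k - 2 * int j) :: 'a)
    = of_int (2 * (int n - 2 * int k + int j))"
    unfolding of_int_diff[symmetric] by (rule arg_cong[of _ _ of_int]) simp
  finally show ?thesis .
qed

text \<open>The increment is the scalar commutator at level \<open>Suc k\<close>. Thus the
  eigenvalue of \<open>eps \<circ> del\<close> at level \<open>Suc k\<close> is that of
  \<open>del \<circ> eps\<close> at level \<open>k\<close> with the same \<open>j\<close> and
  \<open>i\<close>, which is why both maps respect this labelling.\<close>

lemma ev_Suc: "ev n (Suc k) j i = ev n k j i + 2 * (int n - 2 * int (Suc k) + int j)"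
  by (simp add: ev_def algebra_simps)

lemma eps_del_joint_space:
  assumes "v \<in> joint_space n (Suc k) j i"
  shows "eps n k (del n (Suc k) v) = scale (of_int (ev n k j i)) v"
proof -
  have "eps n k (del n (Suc k) v) = scale (of_int (ev n (Suc k) j i)) v
      - scale (of_int (2 * (int n - 2 * int (Suc k) + int j))) v"
    using eps_del_flip_space[of v n "Suc k" j] assms by (simp add: joint_space_def del: of_int_mult of_int_add of_int_diff)
  also have "\<dots> = scale (of_int (ev n k j i)) v"
    unfolding vp.scale_left_diff_distrib[symmetric] of_int_diff[symmetric] ev_Suc by simp
  finally show ?thesis .
qed

lemma joint_spaceI:
  assumes v: "v \<in> flip_space n (Suc k) j" and "eps n k (del n (Suc k) v) = scale (of_int (ev n k j i)) v"
  shows "v \<in> joint_space n (Suc k) j i"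
proof -
  have "nu_plus n (Suc k) v = scale (of_int (ev n k j i)) v + scale (of_int (2 * (int n - 2 * int (Suc k) + int j))) v"
    using eps_del_flip_space[OF v] assms(2) by (simp add: eq_diff_eq del: of_int_mult of_int_add of_int_diff)
  also have "\<dots> = scale (of_int (ev n (Suc k) j i)) v"
    unfolding vp.scale_left_distrib[symmetric] of_int_add[symmetric] ev_Suc by simp
  finally show ?thesis using v by (simp add: joint_space_def)
qed

lemma eps_flip_space:
  assumes "v \<in> flip_space n k j"
  shows "eps n k v \<in> flip_space n (Suc k) j"
proof -
  have "flip_op n (Suc k) (eps n k v) = scale (of_int (int k - 2 * int j)) (eps n k v) + scale 1 (eps n k v)"
    using assms by (simp add: flip_space_def flip_op_eps module_hom.scale[OF linear_eps])
  also have "\<dots> = scale (of_int (int (Suc k) - 2 * int j)) (eps n k v)"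
    unfolding vp.scale_left_distrib[symmetric] by (simp add: algebra_simps)
  finally show ?thesis by (simp add: flip_space_def eps_in)
qed

lemma del_flip_space:
  assumes "v \<in> flip_space n (Suc k) j"
  shows "del n (Suc k) v \<in> flip_space n k j"
proof -
  have "flip_op n k (del n (Suc k) v) = del n (Suc k) (flip_op n (Suc k) v) - scale 1 (del n (Suc k) v)"
    by (simp add: flip_op_del)
  also have "\<dots> = scale (of_int (int (Suc k) - 2 * int j)) (del n (Suc k) v) - scale 1 (del n (Suc k) v)"
    using assms by (simp add: flip_space_def module_hom.scale[OF linear_del])
  also have "\<dots> = scale (of_int (int k - 2 * int j)) (del n (Suc k) v)"
    unfolding vp.scale_left_diff_distrib[symmetric] by (simp add: algebra_simps)
  finally show ?thesis by (simp add: flip_space_def del_Suc_in)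
qed

lemma eps_joint_space:
  assumes v: "v \<in> joint_space n k j i"
  shows "eps n k v \<in> joint_space n (Suc k) j i"
proof (rule joint_spaceI)
  have "del n (Suc k) (eps n k v) = scale (of_int (ev n k j i)) v"
    using v by (simp add: joint_space_def nu_plus_def)
  then show "eps n k (del n (Suc k) (eps n k v)) = scale (of_int (ev n k j i)) (eps n k v)"
    by (simp add: module_hom.scale[OF linear_eps])
qed (rule eps_flip_space[OF subsetD[OF joint_subset_flip v]])

lemma del_joint_space:
  assumes v: "v \<in> joint_space n (Suc k) j i"
  shows "del n (Suc k) v \<in> joint_space n k j i"
proof -
  have "nu_plus n k (del n (Suc k) v) = del n (Suc k) (eps n k (del n (Suc k) v))"
    by (simp add: nu_plus_def)
  also have "\<dots> = scale (of_int (ev n k j i)) (del n (Suc k) v)"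
    unfolding eps_del_joint_space[OF v] by (rule module_hom.scale[OF linear_del])
  finally show ?thesis using del_flip_space[OF subsetD[OF joint_subset_flip v]] by (simp add: joint_space_def)
qed

section \<open>Decomposition of \<open>Mk n k\<close> when 2 is invertible\<close>

locale odd_char_gt = char_gt n field_type for n :: nat and field_type :: "'f::field itself" +
  assumes two_nonzero: "(2 :: 'f) \<noteq> 0"
begin

lemma of_int_nonzero:
  assumes "z \<noteq> 0" "\<bar>z\<bar> \<le> int n"
  shows "(of_int z :: 'f) \<noteq> 0"
proof -
  have "(of_nat (nat \<bar>z\<bar>) :: 'f) \<noteq> 0" by (rule of_nat_nonzero) (use assms in auto)
  then have "(of_int \<bar>z\<bar> :: 'f) \<noteq> 0" by (simp add: of_nat_nat)
  then show ?thesis by (cases "z \<ge> 0") auto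
qed

text \<open>Below the top of the string both linear factors lie in \<open>{1..n}\<close>. So
  \<open>del \<circ> eps\<close> is invertible on such a space, which justifies the divisions in the
  two decompositions.\<close>

lemma ev_nonzero:
  assumes "j + i \<le> k" "k + i < n"
  shows "(of_int (ev n k j i) :: 'f) \<noteq> 0"
proof -
  have "(of_int (int k - int j + 1 - int i) :: 'f) \<noteq> 0" "(of_int (int n - int k - int i) :: 'f) \<noteq> 0"
    by (rule of_int_nonzero; use assms in simp)+
  then show ?thesis unfolding ev_def of_int_mult mult_eq_0_iff using two_nonzero by (simp only: of_int_numeral) blast
qed

lemma inj_flip_eigenvalues: "inj_on (\<lambda>j. of_int (int k - 2 * int j) :: 'f) {..n}"
proof (rule inj_onI, rule ccontr)
  fix i j assume ij: "i \<in> {..n}" "j \<in> {..n}" "i \<noteq> j"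
    and eq: "(of_int (int k - 2 * int i) :: 'f) = of_int (int k - 2 * int j)"
  have "(of_int (int i - int j) :: 'f) \<noteq> 0" by (rule of_int_nonzero) (use ij in auto)
  moreover have "2 * (of_int (int i - int j) :: 'f) = of_int (int k - 2 * int j) - of_int (int k - 2 * int i)"
    by (simp add: algebra_simps)
  ultimately show False using two_nonzero unfolding eq by (metis diff_self mult_eq_0_iff)
qed

text \<open>The spaces \<open>E n k j\<close> span \<open>Mk n k\<close> and belong to distinct
  eigenvalues, so an eigenvector has no component outside its own \<open>E n k j\<close>.\<close>

lemma E_eq_flip_space:
  assumes "j \<le> k" "k \<le> n"
  shows "E n k j = (flip_space n k j :: 'f vpoly set)"
proof (intro equalityI subsetI)
  fix v :: "'f vpoly" assume "v \<in> E n k j"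
  then show "v \<in> flip_space n k j" using E_subset_Mk flip_op_E by (auto simp: flip_space_def)
next
  fix v :: "'f vpoly" assume v: "v \<in> flip_space n k j"
  then obtain w where w: "v = (\<Sum>j\<le>k. w j)" "\<forall>j\<le>k. w j \<in> E n k j"
    using Mk_decomposition[OF two_nonzero] flip_subset_Mk by blast
  have inj: "inj_on (\<lambda>j. of_int (int k - 2 * int j) :: 'f) {..k}"
    by (rule inj_on_subset[OF inj_flip_eigenvalues]) (use assms in auto)
  have "w i = 0" if "i \<le> k" "i \<noteq> j" for i
  proof (rule eigenvector_components[OF linear_flip_op finite_atMost inj])
    show "flip_op n k (w i) = scale (of_int (int k - 2 * int i)) (w i)" if "i \<in> {..k}" for i
      using w(2) flip_op_E that by blast
    show "flip_op n k (\<Sum>i\<le>k. w i) = scale (of_int (int k - 2 * int j)) (\<Sum>i\<le>k. w i)"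
      using v w(1) by (simp add: flip_space_def)
    show "i \<in> {..k}" using that by simp
    show "(of_int (int k - 2 * int i) :: 'f) \<noteq> of_int (int k - 2 * int j)"
      using inj_onD[OF inj] that assms(1) by blast
  qed
  then have "v = (\<Sum>i\<le>k. if i = j then w j else 0)" unfolding w(1) by (intro sum.cong) auto
  then have "v = w j" using assms(1) by simp
  then show "v \<in> E n k j" using w(2) assms(1) by blast
qed

text \<open>The eigenvalue \<open>k - 2 * j\<close> with \<open>k < j\<close> differs from all
  \<open>k - 2 * i\<close> with \<open>i <= k\<close>, and no others occur on \<open>Mk n k\<close>.
  At level \<open>j\<close> this forces \<open>del\<close> to vanish, the start of
  \<open>decomposition_low\<close>.\<close>

lemma flip_space_trivial:
  assumes v: "(v :: 'f vpoly) \<in> flip_space n k j" and "k < j" "j \<le> n"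
  shows "v = 0"
proof -
  obtain w where w: "v = (\<Sum>j\<le>k. w j)" "\<forall>j\<le>k. w j \<in> E n k j"
    using Mk_decomposition[OF two_nonzero] flip_subset_Mk v by blast
  have inj: "inj_on (\<lambda>j. of_int (int k - 2 * int j) :: 'f) {..k}"
    by (rule inj_on_subset[OF inj_flip_eigenvalues]) (use assms in auto)
  have "w i = 0" if "i \<le> k" for i
  proof (rule eigenvector_components[OF linear_flip_op finite_atMost inj])
    show "flip_op n k (w i) = scale (of_int (int k - 2 * int i)) (w i)" if "i \<in> {..k}" for i
      using w(2) flip_op_E that by blast
    show "flip_op n k (\<Sum>i\<le>k. w i) = scale (of_int (int k - 2 * int j)) (\<Sum>i\<le>k. w i)"
      using v w(1) by (simp add: flip_space_def)
    show "i \<in> {..k}" using that by simp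
    show "(of_int (int k - 2 * int i) :: 'f) \<noteq> of_int (int k - 2 * int j)"
      using inj_onD[OF inj_flip_eigenvalues[of k], of i j] that assms by auto
  qed
  then show ?thesis unfolding w(1) by simp
qed

lemma Ei_eq_joint_space:
  "j \<le> k \<Longrightarrow> k \<le> n \<Longrightarrow> Ei n k j i = (joint_space n k j i :: 'f vpoly set)"
  by (simp add: Ei_def joint_space_def E_eq_flip_space ev_def)

text \<open>Induction upwards through the levels: the components of \<open>del v\<close> are lifted
  by \<open>eps\<close> and divided by their eigenvalues. Subtracting the lifts from
  \<open>v\<close> leaves a vector killed by \<open>eps \<circ> del\<close>.\<close>

lemma decomposition_low:
  assumes "(v :: 'f vpoly) \<in> flip_space n (j + q) j" "j + 2 * q \<le> n"
  shows "\<exists>w. v = (\<Sum>i\<le>q. w i) \<and> (\<forall>i\<le>q. w i \<in> joint_space n (j + q) j i)"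
  using assms
proof (induction q arbitrary: v)
  case 0
  have "v \<in> joint_space n j j 0"
  proof (cases j)
    case 0
    then show ?thesis using "0.prems"(1) eps_del_flip_space[OF "0.prems"(1)]
      by (simp add: joint_space_def ev_def del_0 module_hom.zero[OF linear_eps])
  next
    case (Suc j')
    have "del n (Suc j') v = 0"
      by (rule flip_space_trivial[of _ j' j]) (use "0.prems" Suc del_flip_space[of v n j' j] in auto)
    then have "v \<in> joint_space n (Suc j') (Suc j') 0"
      using "0.prems"(1) Suc by (intro joint_spaceI) (auto simp: module_hom.zero[OF linear_eps] ev_def)
    then show ?thesis using Suc by simp
  qed
  then show ?case by (intro exI[of _ "\<lambda>_. v"]) simp
next
  case (Suc q)
  let ?k = "j + q"
  have v: "v \<in> flip_space n (Suc ?k) j" using Suc.prems(1) by simp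
  obtain w where w: "del n (Suc ?k) v = (\<Sum>i\<le>q. w i)" "\<And>i. i \<le> q \<Longrightarrow> w i \<in> joint_space n ?k j i"
    using Suc.IH[OF del_flip_space[OF v]] Suc.prems(2) by auto
  define e where "e i = (of_int (ev n ?k j i) :: 'f)" for i
  have e: "e i \<noteq> 0" if "i \<le> q" for i
    unfolding e_def by (rule ev_nonzero) (use that Suc.prems(2) in auto)
  define u where "u i = scale (inverse (e i)) (eps n ?k (w i))" for i
  have u: "u i \<in> joint_space n (Suc ?k) j i" if "i \<le> q" for i
    unfolding u_def using eps_joint_space[OF w(2)[OF that]] by (rule vp.subspace_scale[OF subspace_joint_space])
  define r where "r = v - (\<Sum>i\<le>q. u i)"
  have eu: "eps n ?k (del n (Suc ?k) (u i)) = eps n ?k (w i)" if "i \<le> q" for i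
    unfolding eps_del_joint_space[OF u[OF that]] using e[OF that] by (simp add: u_def e_def[symmetric])
  have "eps n ?k (del n (Suc ?k) r) = (\<Sum>i\<le>q. eps n ?k (w i)) - (\<Sum>i\<le>q. eps n ?k (del n (Suc ?k) (u i)))"
    by (simp only: r_def module_hom.diff[OF linear_del] module_hom.diff[OF linear_eps] w(1)
        module_hom.sum[OF linear_del] module_hom.sum[OF linear_eps])
  also have "\<dots> = 0" using eu by simp
  \<comment> \<open>The first factor of \<open>ev n ?k j (Suc q)\<close> is zero: the remainder
    belongs to the string with \<open>i = Suc q\<close>, which begins at this level.\<close>
  finally have "eps n ?k (del n (Suc ?k) r) = scale (of_int (ev n ?k j (Suc q))) r"
    by (simp add: ev_def)
  moreover have "r \<in> flip_space n (Suc ?k) j"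
    unfolding r_def
    by (intro vp.subspace_diff[OF subspace_flip_space] vp.subspace_sum[OF subspace_flip_space] v
        subsetD[OF joint_subset_flip u]) simp
  ultimately have r: "r \<in> joint_space n (Suc ?k) j (Suc q)" by (intro joint_spaceI)
  let ?w = "\<lambda>i. if i \<le> q then u i else r"
  have "v = (\<Sum>i\<le>Suc q. ?w i)" by (simp add: r_def)
  moreover have "\<forall>i\<le>Suc q. ?w i \<in> joint_space n (Suc ?k) j i" using u r by (auto simp: le_Suc_eq)
  ultimately show ?case by (intro exI[of _ ?w]) simp
qed

text \<open>Mirror image of \<open>decomposition_low\<close>, going down from the top level with
  \<open>eps\<close> and \<open>del\<close> exchanged. The remainder is killed by
  \<open>nu_plus\<close> and belongs to the string that ends at this level,
  \<open>i = n - k\<close>.\<close>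

lemma decomposition_high:
  assumes "(v :: 'f vpoly) \<in> flip_space n k j" "k + d = n" "j + d \<le> k"
  shows "\<exists>w. v = (\<Sum>i\<le>d. w i) \<and> (\<forall>i\<le>d. w i \<in> joint_space n k j i)"
  using assms
proof (induction d arbitrary: k v)
  case 0
  have "nu_plus n k v = 0"
  proof -
    have "eps n k v = 0" using eps_in[of n k v] 0(2) by (simp add: Mk_empty)
    then show ?thesis by (simp add: nu_plus_def module_hom.zero[OF linear_del])
  qed
  then have "v \<in> joint_space n k j 0" using 0 by (simp add: joint_space_def ev_def)
  then show ?case by (intro exI[of _ "\<lambda>_. v"]) simp
next
  case (Suc d)
  note v = Suc.prems(1)
  obtain w where w: "eps n k v = (\<Sum>i\<le>d. w i)" "\<And>i. i \<le> d \<Longrightarrow> w i \<in> joint_space n (Suc k) j i"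
    using Suc.IH[OF eps_flip_space[OF v]] Suc.prems(2,3) by auto
  define e where "e i = (of_int (ev n k j i) :: 'f)" for i
  have e: "e i \<noteq> 0" if "i \<le> d" for i
    unfolding e_def by (rule ev_nonzero) (use that Suc.prems in auto)
  define u where "u i = scale (inverse (e i)) (del n (Suc k) (w i))" for i
  have u: "u i \<in> joint_space n k j i" if "i \<le> d" for i
    unfolding u_def using del_joint_space[OF w(2)[OF that]] by (rule vp.subspace_scale[OF subspace_joint_space])
  define r where "r = v - (\<Sum>i\<le>d. u i)"
  have eu: "nu_plus n k (u i) = del n (Suc k) (w i)" if "i \<le> d" for i
    using u[OF that] e[OF that] by (simp add: joint_space_def) (simp add: u_def e_def[symmetric])
  have sum_v: "nu_plus n k v = (\<Sum>i\<le>d. del n (Suc k) (w i))"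
    by (simp add: nu_plus_def w(1) module_hom.sum[OF linear_del])
  have "nu_plus n k r = (\<Sum>i\<le>d. del n (Suc k) (w i)) - (\<Sum>i\<le>d. nu_plus n k (u i))"
    by (simp only: sum_v r_def module_hom.diff[OF linear_nu_plus] module_hom.sum[OF linear_nu_plus])
  also have "\<dots> = 0" using eu by simp
  finally have "nu_plus n k r = 0" .
  then have "nu_plus n k r = scale (of_int (ev n k j (Suc d))) r"
  proof -
    have "int n - int k - int (Suc d) = 0" using Suc.prems(2) by simp
    then have "ev n k j (Suc d) = 0" by (simp only: ev_def mult_zero_right)
    then show ?thesis using \<open>nu_plus n k r = 0\<close> by simp
  qed
  moreover have "r \<in> flip_space n k j"
    unfolding r_def
    by (intro vp.subspace_diff[OF subspace_flip_space] vp.subspace_sum[OF subspace_flip_space] v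
        subsetD[OF joint_subset_flip u]) simp
  ultimately have r: "r \<in> joint_space n k j (Suc d)" by (simp add: joint_space_def)
  let ?w = "\<lambda>i. if i \<le> d then u i else r"
  have "v = (\<Sum>i\<le>Suc d. ?w i)" by (simp add: r_def)
  moreover have "\<forall>i\<le>Suc d. ?w i \<in> joint_space n k j i" using u r by (auto simp: le_Suc_eq)
  ultimately show ?case by (intro exI[of _ ?w]) simp
qed

lemma flip_space_decomposition:
  assumes v: "(v :: 'f vpoly) \<in> flip_space n k j" and "j \<le> k" "k \<le> n"
  shows "\<exists>w. v = (\<Sum>i\<le>min (k - j) (n - k). w i) \<and> (\<forall>i\<le>min (k - j) (n - k). w i \<in> joint_space n k j i)"
proof (cases "k - j \<le> n - k")
  case True
  then show ?thesis using decomposition_low[of v j "k - j"] assms by (simp add: min_def)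
next
  case False
  then show ?thesis using decomposition_high[of v k j "n - k"] assms by (simp add: min_def)
qed

definition indices :: "nat \<Rightarrow> (nat \<times> nat) set" where
  "indices k = (SIGMA j:{..k}. {..min (k - j) (n - k)})"

lemma finite_indices [simp]: "finite (indices k)"
  by (simp add: indices_def)

lemma Mk_joint_decomposition:
  assumes v: "(v :: 'f vpoly) \<in> Mk n k" and k: "k \<le> n"
  shows "\<exists>w. v = (\<Sum>p\<in>indices k. w p) \<and> (\<forall>p\<in>indices k. w p \<in> joint_space n k (fst p) (snd p))"
proof -
  obtain u where u: "v = (\<Sum>j\<le>k. u j)" "\<forall>j\<le>k. u j \<in> E n k j"
    using Mk_decomposition[OF two_nonzero v] by blast
  have "\<exists>w. u j = (\<Sum>i\<le>min (k - j) (n - k). w i) \<and> (\<forall>i\<le>min (k - j) (n - k). w i \<in> joint_space n k j i)"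
    if "j \<le> k" for j
    using flip_space_decomposition[of "u j" k j] u(2) that k E_eq_flip_space by blast
  then have "\<forall>j\<in>{..k}. \<exists>w. u j = (\<Sum>i\<le>min (k - j) (n - k). w i) \<and> (\<forall>i\<le>min (k - j) (n - k). w i \<in> joint_space n k j i)"
    by simp
  then have "\<exists>w. \<forall>j\<in>{..k}. u j = (\<Sum>i\<le>min (k - j) (n - k). w j i)
      \<and> (\<forall>i\<le>min (k - j) (n - k). w j i \<in> joint_space n k j i)" by (rule bchoice)
  then obtain w where w: "\<forall>j\<in>{..k}. u j = (\<Sum>i\<le>min (k - j) (n - k). w j i)
      \<and> (\<forall>i\<le>min (k - j) (n - k). w j i \<in> joint_space n k j i)" by (elim exE)
  have "v = (\<Sum>j\<le>k. \<Sum>i\<le>min (k - j) (n - k). w j i)"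
    unfolding u(1) using w by (intro sum.cong refl) auto
  also have "\<dots> = (\<Sum>p\<in>indices k. case_prod w p)"
    unfolding indices_def by (subst sum.Sigma) auto
  finally show ?thesis using w by (intro exI[of _ "case_prod w"]) (auto simp: indices_def)
qed

text \<open>The difference of two eigenvalues factors as \<open>2 * (a - b) * ?s\<close>. Distinct
  \<open>a\<close> and \<open>b\<close> bounded by both \<open>k - j\<close> and
  \<open>n - k\<close> satisfy \<open>0 < a + b <= n - j\<close>, so \<open>?s\<close> lies between
  \<open>-n\<close> and \<open>-1\<close>.\<close>

lemma inj_ev:
  assumes "k \<le> n" "j \<le> k"
  shows "inj_on (\<lambda>i. of_int (ev n k j i) :: 'f) {..min (k - j) (n - k)}"
proof (rule inj_onI, rule ccontr)
  fix a b assume ab: "a \<in> {..min (k - j) (n - k)}" "b \<in> {..min (k - j) (n - k)}" "a \<noteq> b"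
    and eq: "(of_int (ev n k j a) :: 'f) = of_int (ev n k j b)"
  let ?s = "int a + int b - (int n - int j + 1)"
  have "ev n k j a - ev n k j b = 2 * (int a - int b) * ?s"
    by (simp add: ev_def algebra_simps)
  then have "(of_int (2 * (int a - int b) * ?s) :: 'f) = 0" using eq by (metis of_int_diff right_minus_eq)
  moreover have "(of_int (int a - int b) :: 'f) \<noteq> 0"
    by (rule of_int_nonzero) (use ab assms in auto)
  moreover have "(of_int ?s :: 'f) \<noteq> 0"
  proof (rule of_int_nonzero)
    have "a + b \<le> n - j" "0 < a + b" using ab assms by auto
    then show "?s \<noteq> 0" "\<bar>?s\<bar> \<le> int n" using assms by auto
  qed
  ultimately show False using two_nonzero unfolding of_int_mult mult_eq_0_iff by (simp only: of_int_numeral) blast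
qed

text \<open>\<open>flip_op\<close> separates the values of \<open>j\<close>, and for each
  \<open>j\<close> the map \<open>nu_plus\<close> separates the values of \<open>i\<close>.\<close>

lemma joint_spaces_independent:
  assumes k: "k \<le> n" and w: "\<And>p. p \<in> indices k \<Longrightarrow> w p \<in> (joint_space n k (fst p) (snd p) :: 'f vpoly set)"
    and s: "(\<Sum>p\<in>indices k. w p) = 0" and p: "p \<in> indices k"
  shows "w p = 0"
proof -
  define u where "u j = (\<Sum>i\<le>min (k - j) (n - k). w (j, i))" for j
  have "(\<Sum>j\<le>k. u j) = (\<Sum>p\<in>indices k. w p)"
    unfolding u_def indices_def by (subst sum.Sigma) auto
  then have 1: "(\<Sum>j\<le>k. u j) = 0" using s by simp
  have w': "w (j, i) \<in> joint_space n k j i" if "j \<le> k" "i \<le> min (k - j) (n - k)" for i j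
    using w[of "(j, i)"] that by (simp add: indices_def)
  have "u j \<in> flip_space n k j" if "j \<le> k" for j
    unfolding u_def using w'[OF that] joint_subset_flip by (intro vp.subspace_sum[OF subspace_flip_space]) blast
  then have "flip_op n k (u j) = scale (of_int (int k - 2 * int j)) (u j)" if "j \<in> {..k}" for j
    using that by (simp add: flip_space_def)
  moreover have "inj_on (\<lambda>j. of_int (int k - 2 * int j) :: 'f) {..k}"
    by (rule inj_on_subset[OF inj_flip_eigenvalues]) (use k in auto)
  ultimately have u0: "\<forall>j\<in>{..k}. u j = 0"
    using 1 by (intro eigenvectors_independent[OF linear_flip_op finite_atMost])
  obtain j i where ji: "p = (j, i)" "j \<le> k" "i \<le> min (k - j) (n - k)"
    using p by (auto simp: indices_def)
  have "\<forall>i\<in>{..min (k - j) (n - k)}. w (j, i) = 0"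
  proof (rule eigenvectors_independent[OF linear_nu_plus finite_atMost inj_ev[OF k ji(2)]])
    show "nu_plus n k (w (j, i)) = scale (of_int (ev n k j i)) (w (j, i))" if "i \<in> {..min (k - j) (n - k)}" for i
      using w'[OF ji(2), of i] that by (simp add: joint_space_def)
    show "(\<Sum>i\<le>min (k - j) (n - k). w (j, i)) = 0" using u0 ji(2) by (simp add: u_def)
  qed
  then show ?thesis using ji by simp
qed

lemma joint_spaces_disjoint:
  assumes k: "k \<le> n" and p: "p \<in> indices k" "q \<in> indices k" "p \<noteq> q"
    and v: "(v :: 'f vpoly) \<in> joint_space n k (fst p) (snd p)" "v \<in> joint_space n k (fst q) (snd q)"
  shows "v = 0"
proof -
  let ?w = "\<lambda>r. if r = p then v else if r = q then - v else 0"
  have "(\<Sum>r\<in>indices k. ?w r) = (\<Sum>r\<in>{p, q}. ?w r)"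
    using p by (intro sum.mono_neutral_right) auto
  then have "(\<Sum>r\<in>indices k. ?w r) = 0" using p(3) by simp
  then have "?w p = 0"
    using p v by (intro joint_spaces_independent[OF k, of ?w])
      (auto intro: vp.subspace_0[OF subspace_joint_space] vp.subspace_neg[OF subspace_joint_space])
  then show ?thesis by simp
qed

end

section \<open>Nonzero eigenvectors\<close>

lemma coeff_combination:
  assumes x: "x \<in> L n k"
  shows "coeff_face (\<Sum>y\<in>L n k. scale (f y) (face y)) x = f x"
proof -
  have "f y * coeff_face (face y :: 'a vpoly) x = (if y = x then f x else 0)" if "y \<in> L n k" for y
    using L_D(3)[OF that] L_D(3)[OF x] by (auto simp: coeff_face_face)
  then show ?thesis using x by simp
qed

text \<open>The vector \<open>\<Prod>\<^sub>l (s\<^bsub>2l-1\<^esub> - s\<^bsub>2l\<^esub>) \<cdot> \<Prod>\<^sub>m d\<^bsub>2i+m\<^esub>\<close> (\<open>1 \<le> l \<le> i\<close>, \<open>1 \<le> m \<le> j\<close>), where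
  \<open>s\<^sub>v = \<alpha>\<^sub>v + bar \<alpha>\<^sub>v\<close> and \<open>d\<^sub>v = \<alpha>\<^sub>v - bar \<alpha>\<^sub>v\<close>, is killed by \<open>\<partial>\<close>. Its factors are numbered
  by \<open>block\<close>, and \<open>block_sign\<close> is the coefficient of a vertex in its factor.\<close>

definition block :: "nat \<Rightarrow> vertex \<Rightarrow> nat" where
  "block i u = (if fst u \<le> 2 * i then (fst u + 1) div 2 else fst u - i)"

definition block_sign :: "nat \<Rightarrow> vertex \<Rightarrow> 'f::field" where
  "block_sign i u = (if fst u \<le> 2 * i then (if odd (fst u) then 1 else - 1) else if snd u then 1 else - 1)"

definition block_coeff :: "nat \<Rightarrow> nat \<Rightarrow> vertex set \<Rightarrow> 'f::field" where
  "block_coeff k i x = (if block i ` x = {1..k} then \<Prod>u\<in>x. block_sign i u else 0)"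

definition block_vector :: "nat \<Rightarrow> nat \<Rightarrow> nat \<Rightarrow> 'f::field vpoly" where
  "block_vector n k i = (\<Sum>x\<in>L n k. scale (block_coeff k i x) (face x))"

lemma block_vector_in: "block_vector n k i \<in> Mk n k"
  unfolding block_vector_def
  by (intro vp.subspace_sum[OF subspace_Mk] vp.subspace_scale[OF subspace_Mk] face_in_Mk)

lemma coeff_block_vector: "x \<in> L n k \<Longrightarrow> coeff_face (block_vector n k i) x = block_coeff k i x"
  unfolding block_vector_def by (rule coeff_combination)

lemma block_bar [simp]: "block i (bar u) = block i u"
  by (simp add: block_def)

lemma block_sign_bar: "block_sign i (bar u) = (if block i u \<le> i then 1 else - 1) * block_sign i u"
proof -
  have "block i u \<le> i \<longleftrightarrow> fst u \<le> 2 * i" by (auto simp: block_def)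
  then show ?thesis by (simp add: block_sign_def) (simp add: bar_def)
qed

text \<open>A sign-reversing involution of the block: it exchanges the indices \<open>2l - 1\<close>
  and \<open>2l\<close> in the blocks up to \<open>i\<close>, and a vertex with its opposite in the
  other blocks. Twice the sum is therefore zero.\<close>

lemma sum_block_sign:
  assumes two: "(2 :: 'f::field) \<noteq> 0" and n: "2 * i + j \<le> n" and b: "b \<in> {1..i + j}"
  shows "(\<Sum>u\<in>{u \<in> V n. block i u = b}. block_sign i u :: 'f) = 0"
proof -
  let ?S = "{u \<in> V n. block i u = b}"
  define \<tau> where "\<tau> u = (if fst u \<le> 2 * i then (if odd (fst u) then fst u + 1 else fst u - 1, snd u) else bar u)" for u
  have \<tau>: "\<tau> (\<tau> u) = u \<and> \<tau> u \<in> ?S \<and> (block_sign i (\<tau> u) :: 'f) = - block_sign i u" if u: "u \<in> ?S" for u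
  proof -
    obtain m c where mc: "u = (m, c)" by force
    have m: "1 \<le> m" "m \<le> n" "block i (m, c) = b" using u mc by (auto simp: V_def)
    show ?thesis
    proof (cases "m \<le> 2 * i")
      case True
      show ?thesis
      proof (cases "odd m")
        case odd: True
        then obtain q where q: "m = 2 * q + 1" by (elim oddE)
        then have "Suc (Suc (2 * q)) \<le> 2 * i" using True by presburger
        then show ?thesis using True m n q unfolding mc
          by (auto simp: \<tau>_def block_def block_sign_def V_def)
      next
        case False
        then have "even m" by simp
        then obtain q where "m = 2 * q" by (elim evenE)
        then obtain q' where "m = 2 * q' + 2" using m(1) by (cases q) auto
        then show ?thesis using True m n unfolding mc
          by (auto simp: \<tau>_def block_def block_sign_def V_def)
      qed
    next
      case False
      then show ?thesis using m unfolding mc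
        by (auto simp: \<tau>_def block_def block_sign_def V_def bar_def)
    qed
  qed
  have "(\<Sum>u\<in>?S. block_sign i u :: 'f) = (\<Sum>u\<in>?S. - block_sign i u)"
    by (rule sum.reindex_bij_witness[of _ \<tau> \<tau>]) (use \<tau> in auto)
  then have "(\<Sum>u\<in>?S. block_sign i u :: 'f) + (\<Sum>u\<in>?S. block_sign i u) = 0"
    by (simp only: sum_negf eq_neg_iff_add_eq_0)
  then have "2 * (\<Sum>u\<in>?S. block_sign i u :: 'f) = 0" by (simp only: mult_2)
  then show ?thesis using two by simp
qed

text \<open>Exchanging a vertex with its opposite fixes each of the \<open>i\<close> factors built
  from sums and negates each of the \<open>j\<close> differences. The flips add up to
  \<open>i - j\<close>, which is \<open>k - 2 * j\<close> for \<open>k = i + j\<close>.\<close>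

lemma flip_op_block_vector:
  "flip_op n (i + j) (block_vector n (i + j) i) = scale (of_int (int i - int j)) (block_vector n (i + j) i :: 'f::field vpoly)"
proof (rule Mk_eqI[OF flip_op_in vp.subspace_scale[OF subspace_Mk block_vector_in]])
  fix x assume x: "x \<in> L n (i + j)"
  let ?c = "block_coeff (i + j) i :: vertex set \<Rightarrow> 'f"
  let ?s = "\<lambda>b. if b \<le> i then 1 else - 1 :: 'f"
  let ?z = "block_vector n (i + j) i :: 'f vpoly"
  have fx: "finite x" using L_D(3)[OF x] .
  have "?c (flip u x) = ?s (block i u) * ?c x" if u: "u \<in> x" for u
  proof -
    have "block i ` flip u x = insert (block i u) (block i ` (x - {u}))" by (simp add: flip_def)
    also have "\<dots> = block i ` x" using u by auto
    finally have "block i ` flip u x = block i ` x" .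
    moreover have "(\<Prod>w\<in>flip u x. block_sign i w) = (?s (block i u) * block_sign i u) * (\<Prod>w\<in>x - {u}. block_sign i w)"
      using fx L_D(4)[OF x u] by (simp add: flip_def block_sign_bar)
    moreover have "\<dots> = ?s (block i u) * (\<Prod>w\<in>x. block_sign i w)"
      by (subst prod.remove[OF fx u]) (simp only: mult.assoc)
    ultimately show ?thesis by (simp only: block_coeff_def mult_zero_right split: if_split) simp
  qed
  then have 1: "coeff_face (flip_op n (i + j) ?z) x = (\<Sum>u\<in>x. ?s (block i u)) * ?c x"
    unfolding coeff_flip_op[OF x] sum_distrib_right
    by (intro sum.cong refl) (simp add: coeff_block_vector[OF flip_face[OF x]])
  show "coeff_face (flip_op n (i + j) ?z) x = coeff_face (scale (of_int (int i - int j)) ?z) x"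
  proof (cases "block i ` x = {1..i + j}")
    case True
    have "inj_on (block i) x" by (rule eq_card_imp_inj_on[OF fx]) (simp add: True L_D(2)[OF x])
    then have "bij_betw (block i) x {1..i + j}" using True by (simp add: bij_betw_def)
    then have "(\<Sum>u\<in>x. ?s (block i u)) = (\<Sum>b\<in>{1..i + j}. ?s b)" by (rule sum.reindex_bij_betw)
    also have "\<dots> = of_int (int i - int j)"
    proof (induction j)
      case 0
      show ?case by simp
    next
      case (Suc j)
      then show ?case by (simp add: algebra_simps)
    qed
    finally show ?thesis unfolding 1 by (simp add: coeff_block_vector[OF x])
  next
    case False
    then show ?thesis unfolding 1 by (simp add: coeff_block_vector[OF x] block_coeff_def)
  qed
qed

text \<open>Only a face that meets all blocks but one has extensions with nonzero coefficient. These
  extensions add a vertex of the missing block, and the signs in a block cancel.\<close>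

lemma del_block_vector:
  assumes two: "(2 :: 'f::field) \<noteq> 0" and n: "2 * i + j \<le> n" and k: "i + j = Suc k"
  shows "del n (Suc k) (block_vector n (Suc k) i :: 'f vpoly) = 0"
proof (rule Mk_eqI[OF del_Suc_in vp.subspace_0[OF subspace_Mk]])
  fix y assume y: "y \<in> L n k"
  let ?c = "block_coeff (Suc k) i :: vertex set \<Rightarrow> 'f"
  let ?Y = "block i ` y"
  let ?P = "\<Prod>u\<in>y. block_sign i u :: 'f"
  have fy: "finite y" using L_D(3)[OF y] .
  have "coeff_face (del n (Suc k) (block_vector n (Suc k) i)) y = (\<Sum>u\<in>free n y. ?c (insert u y))"
    unfolding coeff_del[OF y] by (intro sum.cong refl coeff_block_vector insert_face[OF y])
  also have "\<dots> = 0"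
  proof (cases "\<exists>b. insert b ?Y = {1..Suc k} \<and> b \<notin> ?Y")
    case True
    then obtain b where b: "insert b ?Y = {1..Suc k}" "b \<notin> ?Y" by blast
    let ?S = "{u \<in> V n. block i u = b}"
    have "?c (insert u y) = (if block i u = b then block_sign i u * ?P else 0)" if u: "u \<in> free n y" for u
    proof -
      have "insert (block i u) ?Y = {1..Suc k} \<longleftrightarrow> block i u = b" using b by auto
      moreover have "u \<notin> y" using u by (simp add: free_def)
      ultimately show ?thesis using fy by (simp add: block_coeff_def)
    qed
    then have "(\<Sum>u\<in>free n y. ?c (insert u y)) = (\<Sum>u\<in>{u \<in> free n y. block i u = b}. block_sign i u * ?P)"
      by (simp add: sum.inter_filter)
    \<comment> \<open>All vertices of the missing block are free, because opposite vertices share a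
      block.\<close>
    also have "{u \<in> free n y. block i u = b} = ?S"
    proof -
      have "u \<in> free n y" if "u \<in> ?S" for u
      proof -
        have "block i u \<notin> ?Y" "block i (bar u) \<notin> ?Y" using that b(2) by auto
        then have "u \<notin> y" "bar u \<notin> y" by blast+
        then show ?thesis using that by (simp add: free_def)
      qed
      then show ?thesis by (auto simp: free_def)
    qed
    also have "(\<Sum>u\<in>?S. block_sign i u * ?P) = (\<Sum>u\<in>?S. block_sign i u) * ?P"
      by (rule sum_distrib_right[symmetric])
    also have "\<dots> = 0"
    proof -
      have "b \<in> {1..i + j}" using b(1) unfolding k by blast
      from sum_block_sign[OF two n this] show ?thesis by simp
    qed
    finally show ?thesis .
  next
    case False
    have "?c (insert u y) = 0" if u: "u \<in> free n y" for u
    proof (rule ccontr)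
      assume "?c (insert u y) \<noteq> 0"
      then have eq: "insert (block i u) ?Y = {1..Suc k}" by (auto simp: block_coeff_def split: if_splits)
      moreover have "block i u \<notin> ?Y"
      proof
        assume "block i u \<in> ?Y"
        then have "?Y = {1..Suc k}" using eq by auto
        then have "Suc k \<le> card y" using card_image_le[OF fy, of "block i"] by simp
        then show False using L_D(2)[OF y] by simp
      qed
      ultimately show False using False by blast
    qed
    then show ?thesis by simp
  qed
  finally show "coeff_face (del n (Suc k) (block_vector n (Suc k) i)) y = coeff_face (0 :: 'f vpoly) y" by simp
qed

lemma block_vector_nonzero:
  assumes n: "2 * i + j \<le> n"
  shows "(block_vector n (i + j) i :: 'f::field vpoly) \<noteq> 0"
proof
  assume z: "(block_vector n (i + j) i :: 'f vpoly) = 0"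
  \<comment> \<open>One positive vertex from each block: the even index from a block of two indices,
    and the only index from the others. The coefficient of this face is a product of signs.\<close>
  let ?f = "\<lambda>l. (if l \<le> i then 2 * l else l + i, True)"
  define x where "x = ?f ` {1..i + j}"
  have b: "block i (?f l) = l" for l by (auto simp: block_def)
  have "inj_on ?f {1..i + j}" by (rule inj_on_inverseI[where g = "block i"], rule b)
  then have "card x = i + j" by (simp add: x_def card_image)
  moreover have "x \<subseteq> V n" using n by (auto simp: x_def V_def)
  moreover have "\<forall>u\<in>x. bar u \<notin> x" by (auto simp: x_def bar_def)
  ultimately have x: "x \<in> L n (i + j)" by (simp add: L_iff)
  have "block i ` x = {1..i + j}" unfolding x_def image_image b by simp
  then have "(block_coeff (i + j) i x :: 'f) = (\<Prod>u\<in>x. block_sign i u)" by (simp add: block_coeff_def)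
  moreover have "\<dots> \<noteq> 0" using L_D(3)[OF x] by (simp add: block_sign_def)
  moreover have "(block_coeff (i + j) i x :: 'f) = coeff_face (block_vector n (i + j) i) x"
    by (rule coeff_block_vector[OF x, symmetric])
  ultimately show False using z by simp
qed

lemma nonzero_coeff:
  assumes "v \<in> Mk n k" "v \<noteq> 0"
  obtains x where "x \<in> L n k" "coeff_face v x \<noteq> 0"
  using Mk_eqI[OF assms(1) vp.subspace_0[OF subspace_Mk]] assms(2) by auto

section \<open>Averages over the group\<close>

text \<open>The sum over the group of the conjugates of the rank one map that sends \<open>v\<close>
  to \<open>coeff_face v x\<close> times \<open>w\<close>. This explains the equivariance as well as
  the trace, which is the order of the group times \<open>coeff_face w x\<close>.\<close>

definition average :: "nat \<Rightarrow> vertex set \<Rightarrow> 'f::field vpoly \<Rightarrow> 'f vpoly \<Rightarrow> 'f vpoly" where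
  "average n x w v = (\<Sum>g\<in>B n. scale (coeff_face v (g ` x)) (act n g w))"

lemma linear_average: "linear_op (average n x w)"
  unfolding average_def
  by (intro linear_opI) (simp_all add: vp.scale_left_distrib sum.distrib vp.scale_sum_right)

lemma submodule_D:
  assumes "submodule n W"
  shows "vp.subspace W" "W \<subseteq> M n" "\<And>g u. g \<in> B n \<Longrightarrow> u \<in> W \<Longrightarrow> act n g u \<in> W"
  using assms by (auto simp: submodule_def)

lemma average_in: "submodule n W \<Longrightarrow> w \<in> W \<Longrightarrow> average n x w v \<in> W"
  unfolding average_def
  by (intro vp.subspace_sum[OF submodule_D(1)] vp.subspace_scale[OF submodule_D(1)] submodule_D(3))

lemma average_ker_op:
  assumes x: "x \<in> L n k" and w: "w \<in> Mk n k"
  shows "average n x w v = ker_op n k k (\<lambda>y z. \<Sum>g\<in>B n. of_bool (g ` x = y) * coeff_face (act n g w) z) v"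
proof (rule Mk_eqI[OF average_in[OF submodule_Mk w] ker_op_in])
  fix z assume z: "z \<in> L n k"
  have "coeff_face (average n x w v) z = (\<Sum>g\<in>B n. coeff_face v (g ` x) * coeff_face (act n g w) z)"
    by (simp add: average_def)
  also have "\<dots> = (\<Sum>g\<in>B n. \<Sum>y\<in>L n k. coeff_face v y * (of_bool (g ` x = y) * coeff_face (act n g w) z))"
  proof (intro sum.cong refl)
    fix g assume "g \<in> B n"
    then have gx: "g ` x \<in> L n k" using B_face x by blast
    have "(\<Sum>y\<in>L n k. coeff_face v y * (of_bool (g ` x = y) * coeff_face (act n g w) z))
      = (\<Sum>y\<in>L n k. if y = g ` x then coeff_face v (g ` x) * coeff_face (act n g w) z else 0)"
      by (intro sum.cong refl) auto
    then show "coeff_face v (g ` x) * coeff_face (act n g w) z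
      = (\<Sum>y\<in>L n k. coeff_face v y * (of_bool (g ` x = y) * coeff_face (act n g w) z))"
      using gx by simp
  qed
  also have "\<dots> = (\<Sum>y\<in>L n k. coeff_face v y * (\<Sum>g\<in>B n. of_bool (g ` x = y) * coeff_face (act n g w) z))"
    by (subst sum.swap) (simp only: sum_distrib_left)
  finally show "coeff_face (average n x w v) z
    = coeff_face (ker_op n k k (\<lambda>y z. \<Sum>g\<in>B n. of_bool (g ` x = y) * coeff_face (act n g w) z) v) z"
    by (simp only: coeff_ker_op[OF z])
qed

lemma average_kernel_invariant:
  assumes h: "h \<in> B n" and y: "y \<in> L n k" and z: "z \<in> L n k"
  shows "(\<Sum>g\<in>B n. of_bool (g ` x = h ` y) * coeff_face (act n g w) (h ` z))
    = (\<Sum>g\<in>B n. of_bool (g ` x = y) * coeff_face (act n g w) z)"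
proof -
  note D = B_D[OF h]
  have hi: "ginv h \<circ> h = id" "h \<circ> ginv h = id"
    using permutes_inv_o[OF D(2)] by auto
  have zf: "z \<in> faces n" using z faces_iff by blast
  show ?thesis
  proof (rule sum.reindex_bij_witness[of _ "\<lambda>g. h \<circ> g" "\<lambda>g. ginv h \<circ> g"])
    fix g assume g: "g \<in> B n"
    show "h \<circ> (ginv h \<circ> g) = g" "ginv h \<circ> (h \<circ> g) = g" using hi by (simp_all add: o_assoc)
    show "ginv h \<circ> g \<in> B n" "h \<circ> g \<in> B n" using B_comp B_inv h g by blast+
    have g': "ginv h \<circ> g \<in> B n" using B_comp B_inv h g by blast
    have "(ginv h \<circ> g) ` x = y \<longleftrightarrow> g ` x = h ` y"
      unfolding image_comp[symmetric] using B_inv_image[OF h] by metis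
    moreover have "act n g w = act n h (act n (ginv h \<circ> g) w)"
      using act_comp[OF h g', of w] hi by (simp add: o_assoc)
    then have "coeff_face (act n g w) (h ` z) = coeff_face (act n (ginv h \<circ> g) w) z"
      using coeff_act[OF h zf] by simp
    ultimately show "of_bool ((ginv h \<circ> g) ` x = y) * coeff_face (act n (ginv h \<circ> g) w) z
      = of_bool (g ` x = h ` y) * coeff_face (act n g w) (h ` z)" by simp
  qed
qed

lemma trace_average:
  assumes x: "x \<in> L n k"
  shows "(\<Sum>y\<in>L n k. coeff_face (average n x w (face y)) y) = of_nat (card (B n)) * coeff_face w x"
proof -
  have xf: "x \<in> faces n" using x faces_iff by blast
  have "(\<Sum>y\<in>L n k. coeff_face (average n x w (face y)) y)
    = (\<Sum>y\<in>L n k. \<Sum>g\<in>B n. if y = g ` x then coeff_face (act n g w) (g ` x) else 0)"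
  proof (intro sum.cong refl)
    fix y assume y: "y \<in> L n k"
    show "coeff_face (average n x w (face y)) y = (\<Sum>g\<in>B n. if y = g ` x then coeff_face (act n g w) (g ` x) else 0)"
      unfolding average_def coeff_sum coeff_scale
    proof (intro sum.cong refl)
      fix g assume "g \<in> B n"
      then have "finite (g ` x)" using L_D(3)[OF x] by simp
      then show "coeff_face (face y :: 'a vpoly) (g ` x) * coeff_face (act n g w) y
        = (if y = g ` x then coeff_face (act n g w) (g ` x) else 0)"
        using L_D(3)[OF y] by (auto simp: coeff_face_face)
    qed
  qed
  also have "\<dots> = (\<Sum>g\<in>B n. \<Sum>y\<in>L n k. if y = g ` x then coeff_face (act n g w) (g ` x) else 0)"
    by (rule sum.swap)
  also have "\<dots> = (\<Sum>g\<in>B n. coeff_face w x)"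
    using B_face[OF _ x] by (intro sum.cong refl) (simp add: coeff_act[OF _ xf])
  finally show ?thesis by simp
qed

text \<open>The vector \<open>w\<close> enters the average only through its translates
  \<open>act n g w\<close>, and \<open>T\<close> takes these to the translates of
  \<open>T w\<close>.\<close>

lemma average_module_map:
  assumes T: "module_map n U W T" and U: "submodule n U" and w: "w \<in> U"
  shows "T (average n x w v) = average n x (T w) v"
proof -
  note D = submodule_D[OF U]
  have T0: "T 0 = 0"
    using T vp.subspace_0[OF D(1)] unfolding module_map_def by (metis vp.scale_zero_left)
  have "T (\<Sum>g\<in>G. scale (coeff_face v (g ` x)) (act n g w)) = (\<Sum>g\<in>G. scale (coeff_face v (g ` x)) (act n g (T w)))"
    if "G \<subseteq> B n" for G
    using finite_subset[OF that finite_B] that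
  proof (induction G rule: finite_induct)
    case (insert g G)
    have a: "act n g w \<in> U" using D(3) insert.prems w by simp
    then have 1: "scale (coeff_face v (g ` x)) (act n g w) \<in> U" by (rule vp.subspace_scale[OF D(1)])
    have 2: "(\<Sum>g\<in>G. scale (coeff_face v (g ` x)) (act n g w)) \<in> U"
      using insert.prems w by (intro vp.subspace_sum[OF D(1)] vp.subspace_scale[OF D(1)] D(3)) auto
    have "T (scale (coeff_face v (g ` x)) (act n g w)) = scale (coeff_face v (g ` x)) (act n g (T w))"
      using T a w insert.prems by (simp add: module_map_def)
    then show ?case using T 1 2 insert by (simp add: module_map_def)
  qed (simp add: T0)
  then show ?thesis unfolding average_def by simp
qed

section \<open>Scalar action, irreducibility and multiplicity-freeness\<close>

context odd_char_gt
begin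

text \<open>At level \<open>s + t\<close> the operator is built from \<open>flip_op\<close>, which
  acts as a scalar. Each further level is reached by conjugating with \<open>eps\<close> and
  \<open>del\<close>, which yields the operator there up to the invertible square
  \<open>m * m\<close>, and \<open>eps \<circ> del\<close> is a scalar on the joint space.\<close>

lemma R_op_scalar:
  assumes "k \<le> n"
  shows "\<exists>c. \<forall>v\<in>joint_space n k j i. R_op n k k s t v = (scale c v :: 'f vpoly)"
proof (cases "s + t \<le> k")
  case False
  then show ?thesis by (intro exI[of _ 0]) (simp add: R_op_0)
next
  case True
  define r where "r = s + t"
  have "r + d \<le> n \<Longrightarrow> \<exists>c. \<forall>v\<in>joint_space n (r + d) j i. R_op n (r + d) (r + d) s t v = (scale c v :: 'f vpoly)" for d
  proof (induction d)
    case 0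
    let ?P = "\<lambda>f. \<exists>c. \<forall>v\<in>joint_space n r j i. f v = (scale c v :: 'f vpoly)"
    have "?P (R_op n r r s t)"
    proof (rule R_op_class)
      fix f g :: "'f vpoly \<Rightarrow> 'f vpoly" and c :: 'f
      assume f: "?P f"
      then obtain a where a: "\<forall>v\<in>joint_space n r j i. f v = scale a v" by blast
      show "?P (\<lambda>v. scale c (f v))" using a by (intro exI[of _ "c * a"]) simp
      have "flip_op n r (f v) = scale (a * of_int (int r - 2 * int j)) v" if "v \<in> joint_space n r j i" for v
        using that a by (simp add: module_hom.scale[OF linear_flip_op] joint_space_def flip_space_def)
      then show "?P (\<lambda>v. flip_op n r (f v))" by blast
      assume "?P g"
      then obtain b where "\<forall>v\<in>joint_space n r j i. g v = scale b v" by blast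
      then show "?P (\<lambda>v. f v + g v)" using a by (intro exI[of _ "a + b"]) (simp add: vp.scale_left_distrib)
    next
      show "?P (proj n r)"
        by (intro exI[of _ 1]) (use proj_Mk flip_subset_Mk joint_subset_flip in fastforce)
    qed (use 0 r_def in auto)
    then show ?case by simp
  next
    case (Suc d)
    let ?k = "r + d"
    obtain c where c: "\<And>v. v \<in> joint_space n ?k j i \<Longrightarrow> R_op n ?k ?k s t v = (scale c v :: 'f vpoly)"
      using Suc by auto
    define m where "m = (of_nat (Suc ?k) - of_nat (s + t) :: 'f)"
    have "m = of_nat (Suc d)" by (simp add: m_def r_def)
    then have m: "m \<noteq> 0" using of_nat_nonzero[of "Suc d"] Suc.prems by (simp del: of_nat_Suc)
    have "R_op n (Suc ?k) (Suc ?k) s t v = scale (inverse (m * m) * (c * of_int (ev n ?k j i))) v"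
      if v: "v \<in> joint_space n (Suc ?k) j i" for v :: "'f vpoly"
    proof -
      have "scale (m * m) (R_op n (Suc ?k) (Suc ?k) s t v) = eps n ?k (R_op n ?k ?k s t (del n (Suc ?k) v))"
        unfolding R_op_del m_def[symmetric] module_hom.scale[OF linear_eps] eps_R_op by simp
      also have "\<dots> = scale (c * of_int (ev n ?k j i)) v"
        by (simp add: c[OF del_joint_space[OF v]] module_hom.scale[OF linear_eps] eps_del_joint_space[OF v])
      finally have "scale (inverse (m * m)) (scale (m * m) (R_op n (Suc ?k) (Suc ?k) s t v))
        = scale (inverse (m * m)) (scale (c * of_int (ev n ?k j i)) v)" by (rule arg_cong)
      moreover have "inverse (m * m) * (m * m) = 1" by (rule left_inverse) (use m in simp)
      ultimately show ?thesis by (simp only: vp.scale_scale vp.scale_one)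
    qed
    then show ?case by auto
  qed
  from this[of "k - r"] show ?thesis using True assms by (simp add: r_def)
qed

lemma equivariant_scalar:
  assumes k: "k \<le> n"
    and inv: "\<And>g x y. g \<in> B n \<Longrightarrow> x \<in> L n k \<Longrightarrow> y \<in> L n k \<Longrightarrow> K (g ` x) (g ` y) = (K x y :: 'f)"
  shows "\<exists>c. \<forall>v\<in>joint_space n k j i. ker_op n k k K v = scale c v"
proof -
  obtain c where c: "\<And>v. ker_op n k k K v = (\<Sum>s\<le>n. \<Sum>t\<le>n. scale (c s t) (R_op n k k s t v))"
    using invariant_kernel[of n k k K, OF inv] by blast
  define d where "d s t = (SOME d. \<forall>v\<in>joint_space n k j i. R_op n k k s t v = (scale d v :: 'f vpoly))" for s t
  have d: "R_op n k k s t v = scale (d s t) v" if "v \<in> joint_space n k j i" for s t v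
    using someI_ex[OF R_op_scalar[OF k, of j i s t]] that unfolding d_def by blast
  have "ker_op n k k K v = scale (\<Sum>s\<le>n. \<Sum>t\<le>n. c s t * d s t) v" if "v \<in> joint_space n k j i" for v
    unfolding c by (simp add: d[OF that] vp.scale_sum_left)
  then show ?thesis by blast
qed

lemma average_scalar:
  assumes k: "k \<le> n" and x: "x \<in> L n k" and w: "w \<in> Mk n k"
  shows "\<exists>c. \<forall>v\<in>joint_space n k j i. average n x w v = (scale c v :: 'f vpoly)"
  unfolding average_ker_op[OF x w] by (intro equivariant_scalar k average_kernel_invariant)

lemma card_B_nonzero: "(of_nat (card (B n)) :: 'f) \<noteq> 0"
proof -
  have "(of_nat (fact m) :: 'f) \<noteq> 0" if "m \<le> n" for m
    using that
  proof (induction m)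
    case (Suc m)
    then show ?case using of_nat_nonzero[of "Suc m"] by (simp only: fact_Suc of_nat_mult of_nat_id) simp
  qed simp
  then show ?thesis unfolding card_B using two_nonzero by simp
qed

text \<open>The image of another summand lies in that summand, by scalar action, and in the summand
  of \<open>w\<close>, which is a submodule; so it is zero. If \<open>c\<close> were zero too, the
  average would vanish on all of \<open>Mk n k\<close>, contrary to its trace.\<close>

lemma average_scalar_nonzero:
  assumes k: "k \<le> n" and p: "p \<in> indices k" and w: "w \<in> joint_space n k (fst p) (snd p)"
    and x: "x \<in> L n k" "coeff_face w x \<noteq> 0"
  shows "\<exists>c. c \<noteq> 0 \<and> (\<forall>v\<in>joint_space n k (fst p) (snd p). average n x w v = (scale c v :: 'f vpoly))"
proof -
  let ?U = "\<lambda>q. joint_space n k (fst q) (snd q) :: 'f vpoly set"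
  have wk: "w \<in> Mk n k" using w joint_subset_flip flip_subset_Mk by blast
  obtain c where c: "\<forall>v\<in>?U p. average n x w v = scale c v" using average_scalar[OF k x(1) wk] by blast
  have "c \<noteq> 0"
  proof
    assume c0: "c = 0"
    have "average n x w v = 0" if q: "q \<in> indices k" and v: "v \<in> ?U q" for q v
    proof (cases "q = p")
      case True
      then show ?thesis using c c0 v by simp
    next
      case False
      obtain d where "average n x w v = scale d v" using average_scalar[OF k x(1) wk] v by blast
      then have "average n x w v \<in> ?U q" using vp.subspace_scale[OF subspace_joint_space v] by simp
      moreover have "average n x w v \<in> ?U p" by (rule average_in[OF submodule_joint_space w])
      ultimately show ?thesis using joint_spaces_disjoint[OF k q p False] by blast
    qed
    then have 0: "average n x w v = 0" if v: "v \<in> Mk n k" for v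
    proof -
      assume A: "\<And>q v. q \<in> indices k \<Longrightarrow> v \<in> ?U q \<Longrightarrow> average n x w v = 0"
      obtain u where u: "v = (\<Sum>q\<in>indices k. u q)" "\<forall>q\<in>indices k. u q \<in> ?U q"
        using Mk_joint_decomposition[OF v k] by blast
      show ?thesis unfolding u(1) module_hom.sum[OF linear_average] using A u(2) by simp
    qed
    have "(\<Sum>y\<in>L n k. coeff_face (average n x w (face y)) y) = 0"
      by (intro sum.neutral ballI) (simp only: 0[OF face_in_Mk] coeff_zero)
    then show False using trace_average[OF x(1), of w] card_B_nonzero x(2) by simp
  qed
  then show ?thesis using c by blast
qed

text \<open>The block vector lies at the bottom \<open>k = i + j\<close> of the string. From there
  \<open>eps\<close> moves up without killing vectors, since \<open>del \<circ> eps\<close> is a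
  nonzero scalar until the top \<open>k = n - i\<close> is reached.\<close>

lemma joint_space_nonzero:
  assumes k: "k \<le> n" and p: "p \<in> indices k"
  shows "\<exists>v\<in>joint_space n k (fst p) (snd p). (v :: 'f vpoly) \<noteq> 0"
proof -
  obtain j i where ji: "p = (j, i)" "j \<le> k" "i \<le> k - j" "i \<le> n - k" using p by (auto simp: indices_def)
  have "i + j + d + i \<le> n \<Longrightarrow> \<exists>v\<in>joint_space n (i + j + d) j i. (v :: 'f vpoly) \<noteq> 0" for d
  proof (induction d)
    case 0
    let ?z = "block_vector n (i + j) i :: 'f vpoly"
    have n: "2 * i + j \<le> n" using 0 by simp
    have "int (i + j) - 2 * int j = int i - int j" by simp
    then have f: "?z \<in> flip_space n (i + j) j"
      using block_vector_in flip_op_block_vector unfolding flip_space_def mem_Collect_eq by metis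
    have "?z \<in> joint_space n (i + j) j i"
    proof (cases "i + j")
      case 0
      then show ?thesis using f eps_del_flip_space[OF f]
        by (simp add: joint_space_def ev_def del_0 module_hom.zero[OF linear_eps])
    next
      case (Suc k')
      \<comment> \<open>Level \<open>k'\<close> is just below the string, at a root of
        \<open>ev\<close>, so a vector killed by \<open>del\<close> has the required eigenvalue of
        \<open>eps \<circ> del\<close>.\<close>
      have "int k' - int j + 1 - int i = 0" using Suc by simp
      then have "ev n k' j i = 0" by (simp only: ev_def mult_zero_left mult_zero_right)
      then show ?thesis using f del_block_vector[OF two_nonzero n Suc]
        unfolding Suc by (intro joint_spaceI) (simp_all add: module_hom.zero[OF linear_eps])
    qed
    then show ?case using block_vector_nonzero[OF n] by auto
  next
    case (Suc d)
    let ?k = "i + j + d"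
    obtain v :: "'f vpoly" where v: "v \<in> joint_space n ?k j i" "v \<noteq> 0" using Suc by auto
    have "del n (Suc ?k) (eps n ?k v) = scale (of_int (ev n ?k j i)) v"
      using v(1) by (simp add: joint_space_def nu_plus_def)
    moreover have "(of_int (ev n ?k j i) :: 'f) \<noteq> 0" by (rule ev_nonzero) (use Suc.prems in auto)
    ultimately have "eps n ?k v \<noteq> 0" using v(2) by (auto simp: module_hom.zero[OF linear_del])
    then show ?case using eps_joint_space[OF v(1)] by auto
  qed
  from this[of "k - (i + j)"] show ?thesis using ji k by simp
qed

lemma irreducible_joint_space:
  assumes k: "k \<le> n" and p: "p \<in> indices k"
  shows "irreducible_module n (joint_space n k (fst p) (snd p) :: 'f vpoly set)"
  unfolding irreducible_module_def
proof (intro conjI allI impI)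
  let ?U = "joint_space n k (fst p) (snd p) :: 'f vpoly set"
  show "submodule n ?U" by (rule submodule_joint_space)
  show "?U \<noteq> {0}" using joint_space_nonzero[OF k p] by auto
  fix W assume W: "submodule n W \<and> W \<subseteq> ?U"
  show "W = {0} \<or> W = ?U"
  proof (cases "W = {0}")
    case False
    then obtain w where w: "w \<in> W" "w \<noteq> 0" using W vp.subspace_0 by (auto simp: submodule_def)
    have wU: "w \<in> ?U" using W w by blast
    then have "w \<in> Mk n k" using joint_subset_flip flip_subset_Mk by blast
    then obtain x where x: "x \<in> L n k" "coeff_face w x \<noteq> 0" using nonzero_coeff w(2) by blast
    obtain c where c: "c \<noteq> 0" "\<forall>v\<in>?U. average n x w v = scale c v"
      using average_scalar_nonzero[OF k p wU x] by blast
    have "v \<in> W" if v: "v \<in> ?U" for v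
    proof -
      have "scale c v \<in> W" using average_in[of n W w x v] W w(1) c(2) v by simp
      moreover have "vp.subspace W" using W by (simp add: submodule_def)
      ultimately have "scale (inverse c) (scale c v) \<in> W" by (metis vp.subspace_scale)
      then show ?thesis using c(1) by simp
    qed
    then show ?thesis using W by blast
  qed simp
qed

text \<open>The average formed with \<open>T w\<close> is a scalar on the first space but maps into
  the second, so it kills \<open>w\<close>. It is also \<open>T\<close> applied to the average
  formed with \<open>w\<close>, which multiplies \<open>w\<close> by some
  \<open>c \<noteq> 0\<close>. Hence \<open>T w = 0\<close>, and \<open>T\<close> is not
  injective.\<close>

lemma joint_spaces_not_isomorphic:
  assumes k: "k \<le> n" and pq: "p \<in> indices k" "q \<in> indices k" "p \<noteq> q"
  shows "\<not> isomorphic_modules n (joint_space n k (fst p) (snd p) :: 'f vpoly set) (joint_space n k (fst q) (snd q))"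
proof
  let ?U = "\<lambda>q. joint_space n k (fst q) (snd q) :: 'f vpoly set"
  assume "isomorphic_modules n (?U p) (?U q)"
  then obtain T where T: "module_map n (?U p) (?U q) T" and bij: "bij_betw T (?U p) (?U q)"
    by (auto simp: isomorphic_modules_def)
  obtain w where w: "w \<in> ?U p" "w \<noteq> 0" using joint_space_nonzero[OF k pq(1)] by blast
  have "w \<in> Mk n k" using w joint_subset_flip flip_subset_Mk by blast
  then obtain x where x: "x \<in> L n k" "coeff_face w x \<noteq> 0" using nonzero_coeff w(2) by blast
  obtain c where c: "c \<noteq> 0" "\<forall>v\<in>?U p. average n x w v = scale c v"
    using average_scalar_nonzero[OF k pq(1) w(1) x] by blast
  have Tw: "T w \<in> ?U q" using T w(1) by (auto simp: module_map_def)
  then have "T w \<in> Mk n k" using joint_subset_flip flip_subset_Mk by blast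
  then obtain d where d: "\<forall>v\<in>?U p. average n x (T w) v = scale d v" using average_scalar[OF k x(1)] by blast
  have "average n x (T w) w \<in> ?U q" by (rule average_in[OF submodule_joint_space Tw])
  moreover have "average n x (T w) w \<in> ?U p" using d w(1) vp.subspace_scale[OF subspace_joint_space] by simp
  ultimately have "average n x (T w) w = 0" using joint_spaces_disjoint[OF k pq] by blast
  then have "T (scale c w) = 0"
    using average_module_map[OF T submodule_joint_space w(1), of x w] c(2) w(1) by simp
  then have "scale c (T w) = 0" using T w(1) by (simp add: module_map_def)
  then have Tw0: "T w = 0" using c(1) by simp
  have 0: "0 \<in> ?U p" by (rule vp.subspace_0[OF subspace_joint_space])
  have "T (scale 0 0) = scale 0 (T 0)" using T 0 unfolding module_map_def by blast
  then have "T 0 = 0" by simp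
  then have "w = 0" using bij 0 w(1) Tw0 by (metis bij_betw_def inj_on_contraD)
  then show False using w(2) by simp
qed

lemma multiplicity_free_Mk:
  assumes k: "k \<le> n"
  shows "multiplicity_free n (Mk n k :: 'f vpoly set)"
proof -
  let ?U = "\<lambda>p. joint_space n k (fst p) (snd p) :: 'f vpoly set"
  \<comment> \<open>The direct sum is over a set of submodules, so different indices must give
    different spaces; this holds because the spaces are nonzero and meet trivially.\<close>
  have inj: "inj_on ?U (indices k)"
  proof (rule inj_onI, rule ccontr)
    fix p q assume pq: "p \<in> indices k" "q \<in> indices k" "?U p = ?U q" "p \<noteq> q"
    obtain v where "v \<in> ?U p" "v \<noteq> 0" using joint_space_nonzero[OF k pq(1)] by blast
    then show False using joint_spaces_disjoint[OF k pq(1,2,4)] pq(3) by blast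
  qed
  have reindex: "(\<Sum>W\<in>?U ` indices k. f W) = (\<Sum>p\<in>indices k. f (?U p))" for f :: "'f vpoly set \<Rightarrow> 'f vpoly"
    by (simp add: sum.reindex[OF inj])
  have "internal_direct_sum (Mk n k) (?U ` indices k)"
    unfolding internal_direct_sum_def
  proof (intro conjI ballI)
    show "finite (?U ` indices k)" by simp
    show "W \<subseteq> Mk n k" if "W \<in> ?U ` indices k" for W using that joint_subset_flip flip_subset_Mk by blast
    fix u :: "'f vpoly" assume "u \<in> Mk n k"
    then obtain w where w: "u = (\<Sum>p\<in>indices k. w p)" "\<forall>p\<in>indices k. w p \<in> ?U p"
      using Mk_joint_decomposition[OF _ k] by blast
    let ?f = "restrict (\<lambda>W. w (inv_into (indices k) ?U W)) (?U ` indices k)"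
    have f: "?f (?U p) = w p" if "p \<in> indices k" for p
      using that inv_into_f_f[OF inj that] by simp
    show "\<exists>!f. f \<in> (\<Pi>\<^sub>E W\<in>?U ` indices k. W) \<and> u = (\<Sum>W\<in>?U ` indices k. f W)"
    proof (rule ex1I[of _ ?f], rule conjI)
      show "?f \<in> (\<Pi>\<^sub>E W\<in>?U ` indices k. W)"
      proof (rule PiE_I)
        fix W assume "W \<in> ?U ` indices k"
        then obtain p where p: "p \<in> indices k" "W = ?U p" by blast
        show "?f W \<in> W" unfolding p(2) f[OF p(1)] using w(2) p(1) by blast
      qed simp
      show "u = (\<Sum>W\<in>?U ` indices k. ?f W)"
        unfolding reindex w(1) by (intro sum.cong refl) (simp only: f)
    next
      fix f assume fa: "f \<in> (\<Pi>\<^sub>E W\<in>?U ` indices k. W) \<and> u = (\<Sum>W\<in>?U ` indices k. f W)"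
      have in_U: "f (?U p) \<in> ?U p" if "p \<in> indices k" for p using fa that by (auto simp: PiE_iff)
      have "(\<Sum>p\<in>indices k. f (?U p) - w p) = 0"
        using fa w(1) unfolding sum_subtractf reindex by simp
      then have eq: "f (?U p) - w p = 0" if "p \<in> indices k" for p
        using in_U w(2) that
        by (intro joint_spaces_independent[OF k, of "\<lambda>p. f (?U p) - w p"])
           (auto intro: vp.subspace_diff[OF subspace_joint_space])
      show "f = ?f"
      proof (rule extensionalityI[of _ "?U ` indices k"])
        show "f \<in> extensional (?U ` indices k)" using fa by (simp add: PiE_iff)
        fix W assume "W \<in> ?U ` indices k"
        then obtain p where p: "p \<in> indices k" "W = ?U p" by blast
        show "f W = ?f W" unfolding p(2) f[OF p(1)] using eq[OF p(1)] by simp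
      qed simp
    qed
  qed
  moreover have "\<forall>W\<in>?U ` indices k. irreducible_module n W" using irreducible_joint_space[OF k] by blast
  moreover have "\<forall>W\<in>?U ` indices k. \<forall>W'\<in>?U ` indices k. W \<noteq> W' \<longrightarrow> \<not> isomorphic_modules n W W'"
    using joint_spaces_not_isomorphic[OF k] by blast
  ultimately show ?thesis
    unfolding multiplicity_free_def by (intro conjI exI[of _ "?U ` indices k"] submodule_Mk)
qed

end

section \<open>The endomorphism ring\<close>

lemma M_closed:
  shows "(0 :: 'f::field vpoly) \<in> M n" "u \<in> M n \<Longrightarrow> v \<in> M n \<Longrightarrow> (u + v :: 'f vpoly) \<in> M n"
    "u \<in> M n \<Longrightarrow> (scale c u :: 'f vpoly) \<in> M n"
  using vp.subspace_0[OF subspace_M] vp.subspace_add[OF subspace_M] vp.subspace_scale[OF subspace_M] by auto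

lemma carrier_hom_ring_iff:
  "T \<in> carrier (hom_ring n) \<longleftrightarrow> T \<in> extensional (M n) \<and> (\<forall>v\<in>M n. T v \<in> M n) \<and>
    (\<forall>u\<in>M n. \<forall>v\<in>M n. T (u + v) = T u + T v) \<and> (\<forall>c. \<forall>u\<in>M n. T (scale c u) = scale c (T u)) \<and>
    (\<forall>g\<in>B n. \<forall>u\<in>M n. T (act n g u) = act n g (T u))"
  by (simp add: hom_ring_def module_map_def Pi_iff)

lemma hom_ring_ops:
  "S \<otimes>\<^bsub>hom_ring n\<^esub> T = compose (M n) S T" "\<one>\<^bsub>hom_ring n\<^esub> = (\<lambda>v\<in>M n. v)"
  "\<zero>\<^bsub>hom_ring n\<^esub> = (\<lambda>v\<in>M n. 0)" "S \<oplus>\<^bsub>hom_ring n\<^esub> T = (\<lambda>v\<in>M n. S v + T v)"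
  by (simp_all add: hom_ring_def)

lemma restrict_in_carrier:
  assumes "linear_op f" "\<And>v. v \<in> M n \<Longrightarrow> f v \<in> M n"
    "\<And>g v. g \<in> B n \<Longrightarrow> v \<in> M n \<Longrightarrow> f (act n g v) = act n g (f v)"
  shows "restrict f (M n) \<in> carrier (hom_ring n)"
  using assms module_hom.add[OF assms(1)] module_hom.scale[OF assms(1)]
  by (simp add: carrier_hom_ring_iff M_closed act_in_M)

lemma carrier_D:
  assumes "T \<in> carrier (hom_ring n)"
  shows "T \<in> extensional (M n)" "\<And>v. v \<in> M n \<Longrightarrow> T v \<in> M n"
    "\<And>u v. u \<in> M n \<Longrightarrow> v \<in> M n \<Longrightarrow> T (u + v) = T u + T v" "\<And>c u. u \<in> M n \<Longrightarrow> T (scale c u) = scale c (T u)"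
    "\<And>g u. g \<in> B n \<Longrightarrow> u \<in> M n \<Longrightarrow> T (act n g u) = act n g (T u)"
  using assms unfolding carrier_hom_ring_iff by blast+

text \<open>Needed so that the ring generated by elements of the carrier stays inside the
  carrier.\<close>

lemma ring_hom_ring: "ring (hom_ring n :: ('f::field vpoly \<Rightarrow> 'f vpoly) ring)"
proof -
  let ?R = "hom_ring n :: ('f vpoly \<Rightarrow> 'f vpoly) ring"
  have ext: "S = T" if "S \<in> extensional (M n)" "T \<in> extensional (M n)" "\<And>v. v \<in> M n \<Longrightarrow> S v = T v"
    for S T :: "'f vpoly \<Rightarrow> 'f vpoly" using that by (rule extensionalityI)
  have add: "S \<oplus>\<^bsub>?R\<^esub> T \<in> carrier ?R" if "S \<in> carrier ?R" "T \<in> carrier ?R" for S T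
    using carrier_D[OF that(1)] carrier_D[OF that(2)]
    by (simp add: carrier_hom_ring_iff hom_ring_ops M_closed act_in_M act_add vp.scale_right_distrib)
  have mult: "S \<otimes>\<^bsub>?R\<^esub> T \<in> carrier ?R" if "S \<in> carrier ?R" "T \<in> carrier ?R" for S T
    using carrier_D[OF that(1)] carrier_D[OF that(2)]
    by (simp add: carrier_hom_ring_iff hom_ring_ops compose_def M_closed act_in_M)
  have neg: "(\<lambda>v\<in>M n. scale (- 1) (T v)) \<in> carrier ?R" if "T \<in> carrier ?R" for T
    using carrier_D[OF that]
    by (simp add: carrier_hom_ring_iff M_closed act_in_M vp.subspace_neg[OF subspace_M] module_hom.neg[OF linear_act])
  have zero: "\<zero>\<^bsub>?R\<^esub> \<in> carrier ?R"
    by (simp add: carrier_hom_ring_iff hom_ring_ops M_closed act_in_M module_hom.zero[OF linear_act])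
  have one: "\<one>\<^bsub>?R\<^esub> \<in> carrier ?R"
    by (simp add: carrier_hom_ring_iff hom_ring_ops M_closed act_in_M)
  show ?thesis
  proof (rule ringI)
    show "abelian_group ?R"
    proof (rule abelian_groupI)
      fix S T U assume S: "S \<in> carrier ?R" and T: "T \<in> carrier ?R" and U: "U \<in> carrier ?R"
      show "S \<oplus>\<^bsub>?R\<^esub> T \<oplus>\<^bsub>?R\<^esub> U = S \<oplus>\<^bsub>?R\<^esub> (T \<oplus>\<^bsub>?R\<^esub> U)"
        by (rule ext) (simp_all add: hom_ring_ops add.assoc)
    next
      fix S T assume "S \<in> carrier ?R" "T \<in> carrier ?R"
      show "S \<oplus>\<^bsub>?R\<^esub> T = T \<oplus>\<^bsub>?R\<^esub> S" by (rule ext) (simp_all add: hom_ring_ops add.commute)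
    next
      fix T assume T: "T \<in> carrier ?R"
      show "\<zero>\<^bsub>?R\<^esub> \<oplus>\<^bsub>?R\<^esub> T = T" by (rule ext) (simp_all add: hom_ring_ops carrier_D(1)[OF T])
      show "\<exists>S\<in>carrier ?R. S \<oplus>\<^bsub>?R\<^esub> T = \<zero>\<^bsub>?R\<^esub>"
        by (rule bexI[OF _ neg[OF T]], rule ext) (simp_all add: hom_ring_ops)
    qed (use add zero in auto)
    show "monoid ?R"
    proof (rule monoidI)
      fix S T U assume S: "S \<in> carrier ?R" and T: "T \<in> carrier ?R" and U: "U \<in> carrier ?R"
      show "S \<otimes>\<^bsub>?R\<^esub> T \<otimes>\<^bsub>?R\<^esub> U = S \<otimes>\<^bsub>?R\<^esub> (T \<otimes>\<^bsub>?R\<^esub> U)"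
        by (rule ext) (simp_all add: hom_ring_ops compose_def carrier_D(2)[OF U])
    next
      fix T assume T: "T \<in> carrier ?R"
      show "\<one>\<^bsub>?R\<^esub> \<otimes>\<^bsub>?R\<^esub> T = T" "T \<otimes>\<^bsub>?R\<^esub> \<one>\<^bsub>?R\<^esub> = T"
        by (rule ext; simp add: hom_ring_ops compose_def carrier_D(1,2)[OF T])+
    qed (use mult one in auto)
  next
    fix S T U assume S: "S \<in> carrier ?R" and T: "T \<in> carrier ?R" and U: "U \<in> carrier ?R"
    show "(S \<oplus>\<^bsub>?R\<^esub> T) \<otimes>\<^bsub>?R\<^esub> U = S \<otimes>\<^bsub>?R\<^esub> U \<oplus>\<^bsub>?R\<^esub> T \<otimes>\<^bsub>?R\<^esub> U"
      by (rule ext) (simp_all add: hom_ring_ops compose_def carrier_D(2)[OF U])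
    show "U \<otimes>\<^bsub>?R\<^esub> (S \<oplus>\<^bsub>?R\<^esub> T) = U \<otimes>\<^bsub>?R\<^esub> S \<oplus>\<^bsub>?R\<^esub> U \<otimes>\<^bsub>?R\<^esub> T"
      by (rule ext) (simp_all add: hom_ring_ops compose_def M_closed carrier_D(2)[OF S] carrier_D(2)[OF T] carrier_D(3)[OF U])
  qed
qed

lemma hom_generators_subset: "hom_generators n \<subseteq> carrier (hom_ring n)"
proof -
  have "restrict (eps n k) (M n) \<in> carrier (hom_ring n)" for k
    using eps_in Mk_subset_M by (intro restrict_in_carrier linear_eps eps_act) blast+
  moreover have "restrict (del n k) (M n) \<in> carrier (hom_ring n)" for k
    using del_in Mk_subset_M by (intro restrict_in_carrier linear_del del_act) blast+
  moreover have "(\<lambda>v\<in>M n. scale c (proj n k v)) \<in> carrier (hom_ring n)" for k c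
  proof (rule restrict_in_carrier)
    show "linear_op (\<lambda>v. scale c (proj n k v))"
      by (intro linear_opI)
         (simp_all add: module_hom.add[OF linear_proj] module_hom.scale[OF linear_proj] vp.scale_right_distrib mult.commute)
    show "scale c (proj n k v) \<in> M n" for v using proj_in Mk_subset_M M_closed(3) by blast
  qed (simp add: proj_act act_scale)
  ultimately show ?thesis by (auto simp: hom_generators_def)
qed

text \<open>Operators are total functions, whereas the elements of \<open>hom_ring n\<close> are
  undefined outside \<open>M n\<close>; restriction translates between the two.\<close>

definition generated :: "nat \<Rightarrow> ('f::field vpoly \<Rightarrow> 'f vpoly) \<Rightarrow> bool" where
  "generated n f \<longleftrightarrow> restrict f (M n) \<in> generate_ring (hom_ring n) (hom_generators n)"

lemma generated_add: "generated n f \<Longrightarrow> generated n g \<Longrightarrow> generated n (\<lambda>v. f v + g v)"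
  using generate_ring.eng_add[of "restrict f (M n)" "hom_ring n" "hom_generators n" "restrict g (M n)"]
  by (simp add: generated_def hom_ring_ops cong: restrict_cong)

lemma generated_comp:
  assumes "generated n f" "generated n g" "\<And>v. v \<in> M n \<Longrightarrow> g v \<in> M n"
  shows "generated n (\<lambda>v. f (g v))"
proof -
  have "compose (M n) (restrict f (M n)) (restrict g (M n)) = restrict (\<lambda>v. f (g v)) (M n)"
    using assms(3) by (auto simp: compose_def restrict_def fun_eq_iff)
  then show ?thesis
    using generate_ring.eng_mult[of "restrict f (M n)" "hom_ring n" "hom_generators n" "restrict g (M n)"] assms(1,2)
    by (simp add: generated_def hom_ring_ops)
qed

lemma generated_scale_proj: "k \<le> n \<Longrightarrow> generated n (\<lambda>v. scale c (proj n k v))"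
  unfolding generated_def by (rule generate_ring.incl) (auto simp: hom_generators_def)

lemma generated_zero: "generated n (\<lambda>v. 0)"
  using generated_scale_proj[of 0 n 0] by simp

lemma generated_eps: "generated n (eps n k :: 'f::field vpoly \<Rightarrow> 'f vpoly)"
proof (cases "k \<le> n")
  case True
  then show ?thesis unfolding generated_def by (intro generate_ring.incl) (auto simp: hom_generators_def)
next
  case False
  then have "eps n k = (\<lambda>v :: 'f vpoly. 0)" by (simp add: eps_def extend_def L_empty fun_eq_iff)
  then show ?thesis using generated_zero by simp
qed

lemma generated_del: "generated n (del n k :: 'f::field vpoly \<Rightarrow> 'f vpoly)"
proof (cases "k \<le> n")
  case True
  then show ?thesis unfolding generated_def by (intro generate_ring.incl) (auto simp: hom_generators_def)
next
  case False
  then have "del n k = (\<lambda>v :: 'f vpoly. 0)" by (simp add: del_def extend_def L_empty fun_eq_iff)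
  then show ?thesis using generated_zero by simp
qed

lemma Mk_in_M: "v \<in> Mk n k \<Longrightarrow> v \<in> M n"
  using Mk_subset_M by blast

text \<open>Scalars are available only on a single level, as multiples of \<open>proj n k\<close>. A
  range inside one \<open>Mk n k\<close> makes that projection the identity on the values of
  \<open>f\<close>.\<close>

lemma generated_scale:
  assumes f: "generated n f" "\<And>v. f v \<in> Mk n k"
  shows "generated n (\<lambda>v. scale c (f v))"
proof (cases "k \<le> n")
  case True
  have "generated n (\<lambda>v. scale c (proj n k (f v)))"
    by (rule generated_comp[OF generated_scale_proj[OF True] f(1) Mk_in_M[OF f(2)]])
  then show ?thesis by (simp add: proj_Mk[OF f(2)])
next
  case False
  then have "f v = 0" for v using f(2)[of v] by (simp add: Mk_empty)
  then show ?thesis using generated_zero by simp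
qed

lemma generated_sum:
  "(\<And>i. i \<in> I \<Longrightarrow> generated n (f i)) \<Longrightarrow> generated n (\<lambda>v. \<Sum>i\<in>I. f i v)"
  by (induction I rule: infinite_finite_induct) (simp_all add: generated_zero generated_add)

lemma generated_flip_op:
  assumes "k \<le> n"
  shows "generated n (flip_op n k :: 'f::field vpoly \<Rightarrow> 'f vpoly)"
proof -
  have "generated n (\<lambda>v. eps n (k - 1) (del n k v))"
    by (rule generated_comp[OF generated_eps generated_del Mk_in_M[OF del_in]])
  moreover have "generated n (\<lambda>v. scale (- 1) (del n (k + 1) (eps n k v)))"
    by (rule generated_scale[OF generated_comp[OF generated_del generated_eps Mk_in_M[OF eps_in]] del_eps_in])
  ultimately have "generated n (\<lambda>v :: 'f vpoly. eps n (k - 1) (del n k v) + scale (- 1) (del n (k + 1) (eps n k v))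
      + scale (of_int (2 * (int n - int k) - int k)) (proj n k v))"
    by (intro generated_add generated_scale_proj[OF assms])
  moreover have "flip_op n k = (\<lambda>v :: 'f vpoly. eps n (k - 1) (del n k v) + scale (- 1) (del n (k + 1) (eps n k v))
      + scale (of_int (2 * (int n - int k) - int k)) (proj n k v))"
    by (simp add: flip_op_def fun_eq_iff)
  ultimately show ?thesis by (simp only:)
qed

section \<open>Generation of the endomorphism ring\<close>

context char_gt
begin

lemma generated_R_op:
  assumes k: "k \<le> n" and l: "l \<le> n"
  shows "generated n (R_op n k l s t :: 'f vpoly \<Rightarrow> 'f vpoly)"
proof (cases "min k l < s + t")
  case True
  then have "R_op n k l s t = (\<lambda>v :: 'f vpoly. 0)" by (simp add: R_op_0 fun_eq_iff)
  then show ?thesis using generated_zero by simp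
next
  case False
  define r where "r = s + t"
  have r: "r \<le> k" "r \<le> l" using False by (auto simp: r_def)
  \<comment> \<open>The range is tracked together with generation, since closure under scalars and
    under composition depends on it.\<close>
  let ?P = "\<lambda>f. generated n f \<and> (\<forall>v. f v \<in> (Mk n r :: 'f vpoly set))"
  have "?P (R_op n r r s t)"
  proof (rule R_op_class)
    show "?P (\<lambda>v. f v + g v)" if "?P f" "?P g" for f g
      using that by (simp add: generated_add vp.subspace_add[OF subspace_Mk])
    show "?P (\<lambda>v. scale c (f v))" if "?P f" for c f
      using that generated_scale[of n f r] by (simp add: vp.subspace_scale[OF subspace_Mk])
    show "?P (\<lambda>v. flip_op n r (f v))" if "?P f" for f
    proof (intro conjI allI flip_op_in generated_comp[OF generated_flip_op])
      show "generated n f" using that by blast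
      show "f v \<in> M n" for v using that Mk_in_M by blast
    qed (use r k in simp)
    show "?P (proj n r)" using generated_scale_proj[of r n 1] r k by (simp add: proj_in)
  qed (use r k in \<open>auto simp: r_def\<close>)
  then have base: "generated n (R_op n r r s t :: 'f vpoly \<Rightarrow> 'f vpoly)" by blast
  \<comment> \<open>The price of raising the target by \<open>eps\<close> or the source by
    \<open>del\<close> from level \<open>r + d\<close> to the next one; it equals
    \<open>Suc d\<close>, which is at most \<open>n\<close>.\<close>
  have m: "(of_nat (Suc (r + d)) - of_nat (s + t) :: 'f) \<noteq> 0" if "r + d < n" for d
  proof -
    have "(of_nat (Suc (r + d)) - of_nat (s + t) :: 'f) = of_nat (Suc d)" by (simp add: r_def)
    moreover have "of_nat (Suc d) \<noteq> (0 :: 'f)" by (rule of_nat_nonzero) (use that in auto)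
    ultimately show ?thesis by (simp only: not_False_eq_True)
  qed
  have up: "r + d \<le> n \<Longrightarrow> generated n (R_op n r (r + d) s t :: 'f vpoly \<Rightarrow> 'f vpoly)" for d
  proof (induction d)
    case 0
    then show ?case using base by simp
  next
    case (Suc d)
    let ?m = "of_nat (Suc (r + d)) - of_nat (s + t) :: 'f"
    have "generated n (\<lambda>v :: 'f vpoly. scale (inverse ?m) (eps n (r + d) (R_op n r (r + d) s t v)))"
      using Suc by (intro generated_scale[OF generated_comp[OF generated_eps _ Mk_in_M[OF R_op_in]] eps_in]) simp
    moreover have "(\<lambda>v :: 'f vpoly. scale (inverse ?m) (eps n (r + d) (R_op n r (r + d) s t v))) = R_op n r (r + Suc d) s t"
      using m[of d] Suc.prems unfolding eps_R_op by (auto simp: fun_eq_iff)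
    ultimately show ?case by simp
  qed
  have "r + d \<le> n \<Longrightarrow> generated n (R_op n (r + d) l s t :: 'f vpoly \<Rightarrow> 'f vpoly)" for d
  proof (induction d)
    case 0
    then show ?case using up[of "l - r"] r l by simp
  next
    case (Suc d)
    let ?m = "of_nat (Suc (r + d)) - of_nat (s + t) :: 'f"
    have "generated n (\<lambda>v :: 'f vpoly. scale (inverse ?m) (R_op n (r + d) l s t (del n (Suc (r + d)) v)))"
      using Suc by (intro generated_scale[OF generated_comp[OF _ generated_del Mk_in_M[OF del_in]] R_op_in]) simp
    moreover have "(\<lambda>v :: 'f vpoly. scale (inverse ?m) (R_op n (r + d) l s t (del n (Suc (r + d)) v))) = R_op n (r + Suc d) l s t"
      using m[of d] Suc.prems unfolding R_op_del by (auto simp: fun_eq_iff)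
    ultimately show ?case by simp
  qed
  from this[of "k - r"] show ?thesis using r k by simp
qed

lemma generate_ring_hom_ring:
  "generate_ring (hom_ring n :: ('f vpoly \<Rightarrow> 'f vpoly) ring) (hom_generators n) = carrier (hom_ring n)"
proof (intro equalityI subsetI)
  fix T :: "'f vpoly \<Rightarrow> 'f vpoly"
  assume "T \<in> generate_ring (hom_ring n) (hom_generators n)"
  then show "T \<in> carrier (hom_ring n)"
    using ring.generate_ring_in_carrier[OF ring_hom_ring hom_generators_subset] by blast
next
  fix T :: "'f vpoly \<Rightarrow> 'f vpoly"
  assume T: "T \<in> carrier (hom_ring n)"
  note D = carrier_D[OF T]
  define K where "K x y = coeff_face (T (face x)) y" for x y
  \<comment> \<open>An endomorphism may mix levels, so its matrix is cut into blocks for all pairs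
    of source and target levels; each block is invariant under the group.\<close>
  let ?S = "\<lambda>v. \<Sum>k\<le>n. \<Sum>l\<le>n. ker_op n k l K v"
  have inv: "K (g ` x) (g ` y) = K x y" if g: "g \<in> B n" and x: "x \<in> L n k" and y: "y \<in> L n l" for g x y k l
  proof -
    have f: "x \<in> faces n" "y \<in> faces n" using x y faces_iff by blast+
    have "T (face (g ` x)) = act n g (T (face x))"
      using D(5)[OF g face_in_M[OF f(1)]] by (simp add: act_face[OF f(1)])
    then show ?thesis using coeff_act[OF g f(2)] by (simp add: K_def)
  qed
  have "generated n (ker_op n k l K)" if k: "k \<le> n" and l: "l \<le> n" for k l
  proof -
    have "\<exists>c. \<forall>v. ker_op n k l K v = (\<Sum>s\<le>n. \<Sum>t\<le>n. scale (c s t) (R_op n k l s t v))"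
      by (rule invariant_kernel) (rule inv)
    then obtain c where c: "\<And>v. ker_op n k l K v = (\<Sum>s\<le>n. \<Sum>t\<le>n. scale (c s t) (R_op n k l s t v))"
      by blast
    have "generated n (\<lambda>v. \<Sum>s\<le>n. \<Sum>t\<le>n. scale (c s t) (R_op n k l s t v))"
      by (intro generated_sum generated_scale[OF generated_R_op[OF k l] R_op_in])
    moreover have "ker_op n k l K = (\<lambda>v. \<Sum>s\<le>n. \<Sum>t\<le>n. scale (c s t) (R_op n k l s t v))"
      using c by (simp add: fun_eq_iff)
    ultimately show ?thesis by simp
  qed
  then have "generated n ?S" by (intro generated_sum) auto
  moreover have "T v = ?S v" if v: "v \<in> M n" for v
  proof (rule M_eqI)
    show "T v \<in> M n" using D(2)[OF v] .
    show "?S v \<in> M n"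
      by (intro vp.subspace_sum[OF subspace_M] Mk_in_M[OF ker_op_in])
    fix y assume "y \<in> faces n"
    then obtain m where m: "y \<in> L n m" using faces_iff by blast
    have "coeff_face (T v) y = (\<Sum>x\<in>faces n. coeff_face v x * K x y)"
      by (subst linear_eq_extend[OF D(3,4) v]) (simp_all add: coeff_extend K_def)
    also have "\<dots> = (\<Sum>k\<le>n. \<Sum>x\<in>L n k. coeff_face v x * K x y)"
      unfolding faces_def by (rule sum.UNION_disjoint) (use L_disjoint in auto)
    also have "\<dots> = (\<Sum>k\<le>n. \<Sum>l\<le>n. if l = m then \<Sum>x\<in>L n k. coeff_face v x * K x y else 0)"
      using L_le[OF m] by simp
    also have "\<dots> = (\<Sum>k\<le>n. \<Sum>l\<le>n. coeff_face (ker_op n k l K v) y)"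
    proof (intro sum.cong refl)
      fix k l
      show "(if l = m then \<Sum>x\<in>L n k. coeff_face v x * K x y else 0) = coeff_face (ker_op n k l K v) y"
        by (cases "l = m") (simp_all add: coeff_ker_op[OF m] coeff_other_level[OF ker_op_in m])
    qed
    finally show "coeff_face (T v) y = coeff_face (?S v) y" by simp
  qed
  then have "restrict ?S (M n) = T"
    using D(1) by (intro extensionalityI[of _ "M n"]) simp_all
  ultimately show "T \<in> generate_ring (hom_ring n) (hom_generators n)" by (simp add: generated_def)
qed

end

section \<open>Characteristic two\<close>

lemma irreducible_line:
  assumes "submodule n (vp.span {v})" "v \<noteq> 0"
  shows "irreducible_module n (vp.span {v :: 'f::field vpoly})"
  unfolding irreducible_module_def
proof (intro conjI allI impI)
  show "submodule n (vp.span {v})" by fact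
  show "vp.span {v} \<noteq> {0}" using assms(2) vp.span_base[of v "{v}"] by auto
  fix W assume W: "submodule n W \<and> W \<subseteq> vp.span {v}"
  then have sW: "vp.subspace W" by (simp add: submodule_def)
  show "W = {0} \<or> W = vp.span {v}"
  proof (cases "W = {0}")
    case False
    then obtain w where w: "w \<in> W" "w \<noteq> 0" using vp.subspace_0[OF sW] by blast
    then obtain c where c: "w = scale c v" using W by (auto simp: vp.span_singleton)
    then have "c \<noteq> 0" using w(2) by auto
    moreover have "scale (inverse c) w \<in> W" using vp.subspace_scale[OF sW w(1)] .
    ultimately have "v \<in> W" using c by simp
    then have "vp.span {v} \<subseteq> W" using sW by (intro vp.span_minimal) auto
    then show ?thesis using W by blast
  qed simp
qed

lemma multiplicity_free_irreducible:
  assumes "irreducible_module n U"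
  shows "multiplicity_free n U"
  unfolding multiplicity_free_def
proof (intro conjI exI[of _ "{U}"])
  show "submodule n U" using assms by (simp add: irreducible_module_def)
  show "internal_direct_sum U {U}"
    unfolding internal_direct_sum_def
  proof (intro conjI ballI)
    fix u assume u: "u \<in> U"
    show "\<exists>!f. f \<in> (\<Pi>\<^sub>E W\<in>{U}. W) \<and> u = (\<Sum>W\<in>{U}. f W)"
    proof (rule ex1I[of _ "\<lambda>W\<in>{U}. u"])
      show "(\<lambda>W\<in>{U}. u) \<in> (\<Pi>\<^sub>E W\<in>{U}. W) \<and> u = (\<Sum>W\<in>{U}. (\<lambda>W\<in>{U}. u) W)" using u by simp
      show "f = (\<lambda>W\<in>{U}. u)" if "f \<in> (\<Pi>\<^sub>E W\<in>{U}. W) \<and> u = (\<Sum>W\<in>{U}. f W)" for f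
        using that by (intro extensionalityI[of _ "{U}"]) (auto simp: PiE_iff)
    qed
  qed auto
qed (use assms in auto)

lemma face_empty_invariant: "act n g (face {}) = face {}"
proof -
  have "{} \<in> L n 0" by (simp add: L_iff)
  then have "{} \<in> faces n" using faces_iff by blast
  from act_face[OF this, of g] show ?thesis by simp
qed

lemma submodule_span_singleton:
  assumes "v \<in> M n" "\<And>g. g \<in> B n \<Longrightarrow> act n g v = v"
  shows "submodule n (vp.span {v})"
proof -
  have "vp.span {v} \<subseteq> M n" using assms(1) by (intro vp.span_minimal subspace_M) auto
  moreover have "act n g u \<in> vp.span {v}" if "g \<in> B n" "u \<in> vp.span {v}" for g u
    using that assms(2) by (auto simp: vp.span_singleton act_scale)
  ultimately show ?thesis by (simp add: submodule_def)
qed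

lemma Mk_0: "Mk n 0 = vp.span {face {}}"
proof -
  have "x = {}" if "x \<in> L n 0" for x using L_D(2,3)[OF that] by simp
  moreover have "{} \<in> L n 0" by (simp add: L_iff)
  ultimately have "L n 0 = {{}}" by blast
  then show ?thesis by (simp add: Mk_def)
qed

lemma irreducible_Mk_0: "irreducible_module n (Mk n 0 :: 'f::field vpoly set)"
  unfolding Mk_0
proof (rule irreducible_line)
  have "face {} \<in> (M n :: 'f vpoly set)" using Mk_in_M face_in_Mk[of "{}" n 0] by (auto simp: L_iff)
  then show "submodule n (vp.span {face {} :: 'f vpoly})"
    by (rule submodule_span_singleton) (rule face_empty_invariant)
  have "coeff_face (face {} :: 'f vpoly) {} = 1" by (simp add: coeff_face_face)
  then show "(face {} :: 'f vpoly) \<noteq> 0" by auto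
qed

lemma Vdot_subset_1:
  assumes "n \<le> 1" "x \<subseteq> Vdot n"
  shows "x = (if card x = 0 then {} else {(1, True)})"
proof -
  have "x \<subseteq> {(1, True)}" using assms by (auto simp: Vdot_def)
  then have "x = {} \<or> x = {(1, True)}" by (rule subset_singletonD)
  then show ?thesis by auto
qed

lemma E_singleton:
  assumes n: "n \<le> 1" and j: "j \<le> k" "k \<le> n"
  defines "s \<equiv> \<lambda>m :: nat. if m = 0 then {} else {(1, True)} :: vertex set"
  shows "E n k j = vp.span {bracket (s (k - j)) (s j)}"
proof -
  have s: "s m \<subseteq> Vdot n" "card (s m) = m" if "m \<le> n" for m
    using that n by (auto simp: s_def Vdot_def)
  have "{bracket a b | a b. a \<subseteq> Vdot n \<and> b \<subseteq> Vdot n \<and> a \<inter> b = {} \<and> card a + j = k \<and> card b = j}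
    = {bracket (s (k - j)) (s j) :: 'a vpoly}"
  proof (intro equalityI subsetI)
    fix v :: "'a vpoly"
    assume "v \<in> {bracket a b | a b. a \<subseteq> Vdot n \<and> b \<subseteq> Vdot n \<and> a \<inter> b = {} \<and> card a + j = k \<and> card b = j}"
    then obtain a b where v: "v = bracket a b" "a \<subseteq> Vdot n" "b \<subseteq> Vdot n" "card a + j = k" "card b = j" by blast
    have "card a = k - j" using v(4) by simp
    then have "a = s (k - j)" "b = s j"
      using Vdot_subset_1[OF n v(2)] Vdot_subset_1[OF n v(3)] v(5) by (auto simp: s_def)
    then show "v \<in> {bracket (s (k - j)) (s j)}" using v(1) by simp
  next
    fix v :: "'a vpoly" assume v: "v \<in> {bracket (s (k - j)) (s j)}"
    have "s (k - j) \<inter> s j = {}" using j n by (auto simp: s_def)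
    moreover have "card (s (k - j)) + j = k" using s(2)[of "k - j"] j by simp
    ultimately show "v \<in> {bracket a b | a b. a \<subseteq> Vdot n \<and> b \<subseteq> Vdot n \<and> a \<inter> b = {} \<and> card a + j = k \<and> card b = j}"
      using v s[of "k - j"] s[of j] j by (simp, intro exI[of _ "s (k - j)"] exI[of _ "s j"]) simp
  qed
  then show ?thesis by (simp add: E_def)
qed

text \<open>Because -1 = 1, for \<open>n = k = 1\<close> both brackets are the sum of the two
  opposite vertices. The group permutes these vertices, so the space is a line of fixed
  vectors.\<close>

lemma irreducible_E_char_2:
  assumes two: "(2 :: 'f::field) = 0" and n: "n \<le> 1" and j: "j \<le> k" "k \<le> n"
  shows "irreducible_module n (E n k j :: 'f vpoly set)"
proof (cases "k = 0")
  case True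
  then have "E n k j = vp.span {face {} :: 'f vpoly}"
    using E_singleton[OF n j] j by (simp add: bracket_def face_def)
  then show ?thesis using irreducible_Mk_0[of n] by (simp add: Mk_0)
next
  case False
  then have n1: "n = 1" "k = 1" using j n by auto
  let ?u = "(1, True) :: vertex"
  let ?v = "face {?u} + face {bar ?u} :: 'f vpoly"
  have neg: "- p = p" for p :: "'f vpoly"
  proof -
    have "p + p = scale (1 + 1) p" by (simp only: vp.scale_left_distrib vp.scale_one)
    then have "p + p = 0" using two by (simp only: one_add_one vp.scale_zero_left)
    then show ?thesis by (rule minus_unique)
  qed
  have "bracket {?u} {} = ?v" "bracket {} {?u} = ?v"
    using neg[of "face {bar ?u}"] by (simp_all add: bracket_def face_def)
  moreover have "j = 0 \<or> j = 1" using j n1 by auto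
  ultimately have "bracket (if k - j = 0 then {} else {?u}) (if j = 0 then {} else {?u}) = ?v"
    using n1 by (elim disjE) (simp_all only: diff_zero diff_self_eq_0 if_True if_False one_neq_zero simp_thms)
  then have E: "E n k j = vp.span {?v}"
    by (simp only: E_singleton[OF n j])
  have L: "{w} \<in> L n 1" if "w \<in> V n" for w using that by (simp add: L_iff)
  have V: "V n = {?u, bar ?u}" by (auto simp: V_def n1 bar_def)
  have f: "{?u} \<in> faces n" "{bar ?u} \<in> faces n" using L V faces_iff by blast+
  show ?thesis unfolding E
  proof (rule irreducible_line, rule submodule_span_singleton)
    show "?v \<in> M n" using face_in_M f by (intro M_closed) auto
    show "act n g ?v = ?v" if g: "g \<in> B n" for g
    proof -
      have "act n g ?v = face {g ?u} + face {bar (g ?u)}"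
        by (simp add: act_add act_face[OF f(1)] act_face[OF f(2)] B_D(3)[OF g] del: One_nat_def)
      moreover have "g ?u = ?u \<or> g ?u = bar ?u" using B_D(4)[OF g, of ?u] V by auto
      ultimately show ?thesis by (auto simp: add.commute)
    qed
    have "coeff_face ?v {?u} = 1" by (simp add: coeff_face_face)
    then show "?v \<noteq> 0" by (metis coeff_zero zero_neq_one)
  qed
qed

text \<open>All eigenvalues contain the factor 2, so the eigenspace is the kernel of
  \<open>nu_plus\<close>. For \<open>n <= 1\<close> this kernel is everything: \<open>eps\<close>
  vanishes at the top level, and at level 0 \<open>nu_plus\<close> is itself an even multiple of the
  identity.\<close>

lemma Ei_char_2:
  assumes two: "(2 :: 'f::field) = 0" and n: "n \<le> 1" and j: "k \<le> n"
  shows "Ei n k j i = (E n k j :: 'f vpoly set)"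
proof -
  have z: "(of_int (2 * a) :: 'f) = 0" for a using two by simp
  have "nu_plus n k v = 0" if v: "v \<in> E n k j" for v :: "'f vpoly"
  proof (cases "k = n")
    case True
    then have "eps n k v = 0" using eps_in[of n k v] by (simp add: Mk_empty)
    then show ?thesis by (simp add: nu_plus_def module_hom.zero[OF linear_del])
  next
    case False
    then have k: "k = 0" using n j by simp
    have "v \<in> flip_space n k j" using v E_subset_Mk flip_op_E by (auto simp: flip_space_def)
    from eps_del_flip_space[OF this] show ?thesis
      unfolding z by (simp add: k del_0 module_hom.zero[OF linear_eps])
  qed
  then show ?thesis unfolding Ei_def mult.assoc z by auto
qed

text \<open>The case excluded from the second claim is a genuine exception: for
  \<open>n = k = 1\<close> the group of order 2 swaps the two faces, and in characteristic 2 the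
  only nonzero proper submodule is the line spanned by their sum, which has no complement.\<close>

theorem theorem4p1:
  fixes n k :: nat
  assumes char: "CHAR('f::field) = 0 \<or> CHAR('f) > n"
    and k: "k \<le> n"
  shows "(\<forall>j i. j \<le> k \<longrightarrow> i \<le> min (k - j) (n - k) \<longrightarrow>
            irreducible_module n (Ei n k j i :: 'f vpoly set))
       \<and> (\<not> (n = 1 \<and> k = 1 \<and> CHAR('f) = 2) \<longrightarrow> multiplicity_free n (Mk n k :: 'f vpoly set))
       \<and> generate_ring (hom_ring n :: ('f vpoly \<Rightarrow> 'f vpoly) ring) (hom_generators n) = carrier (hom_ring n)"
proof -
  interpret char_gt n "TYPE('f)"
  proof
    fix m :: nat assume m: "0 < m" "m \<le> n"
    then have "\<not> CHAR('f) dvd m" using char by (auto dest: dvd_imp_le)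
    then show "of_nat m \<noteq> (0 :: 'f)" by (simp add: of_nat_eq_0_iff_char_dvd)
  qed
  show ?thesis
  proof (cases "(2 :: 'f) = 0")
    case two: True
    then have "CHAR('f) dvd 2" by (metis of_nat_eq_0_iff_char_dvd of_nat_numeral)
    then have c: "CHAR('f) = 2" using CHAR_not_1' two_is_prime_nat by (metis One_nat_def prime_nat_iff)
    then have n: "n \<le> 1" using char by simp
    have "irreducible_module n (Ei n k j i :: 'f vpoly set)" if "j \<le> k" for j i
      using irreducible_E_char_2[OF two n that k] Ei_char_2[OF two n k] by simp
    moreover have "multiplicity_free n (Mk n k :: 'f vpoly set)" if "\<not> (n = 1 \<and> k = 1 \<and> CHAR('f) = 2)"
    proof -
      have "k = 0" using that c n k by auto
      then show ?thesis using multiplicity_free_irreducible[OF irreducible_Mk_0] by simp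
    qed
    ultimately show ?thesis using generate_ring_hom_ring by blast
  next
    case False
    then interpret odd_char_gt n "TYPE('f)" by unfold_locales
    have "irreducible_module n (Ei n k j i :: 'f vpoly set)" if "j \<le> k" "i \<le> min (k - j) (n - k)" for j i
      using irreducible_joint_space[OF k, of "(j, i)"] that by (simp add: Ei_eq_joint_space k indices_def)
    then show ?thesis using generate_ring_hom_ring multiplicity_free_Mk[OF k] by blast
  qed
qed

end
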